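(* Let $a>0$ and $b\in\mathbb{R}$. Let $P_{a,b}$ be the quadratic Kramers-Fokker-Planck operator on $L^2(\mathbb{R}^4)$ and $M_{a,b}$ its associated $4\times 4$ matrix, both defined in the context, and let $$\lambda_1=\tfrac12\bigl(1-\mathrm{i}b-\sqrt{-b^2-2\mathrm{i}b-4a+1}\bigr),\quad \lambda_2=\tfrac12\bigl(1-\mathrm{i}b+\sqrt{-b^2-2\mathrm{i}b-4a+1}\bigr),$$ $$\lambda_3=\tfrac12\bigl(1+\mathrm{i}b-\sqrt{-b^2+2\mathrm{i}b-4a+1}\bigr),\quad \lambda_4=\tfrac12\bigl(1+\mathrm{i}b+\sqrt{-b^2+2\mathrm{i}b-4a+1}\bigr),$$ which are the eigenvalues of $M_{a,b}$. Then the generalized eigenvalues of $P_{a,b}$ are exactly the numbers $$\alpha_k=\sum_{j=1}^4\lambda_j k_j,\qquad k=(k_1,k_2,k_3,k_4)\in\mathbb{N}^4 .$$ In addition: 1) When $b\to+\infty$, $$\lambda_{1}=\frac{a}{b^2}+\mathcal{O}(\langle a\rangle^2 b^{-4})-\mathrm{i}\Bigl(-\frac{a}{b}+\mathcal{O}(\langle a\rangle^2 b^{-3})\Bigr),$$ $$\lambda_{2}=1-\frac{a}{b^2}+\mathcal{O}(\langle a\rangle^2 b^{-4})-\mathrm{i}\Bigl(b+\frac{a}{b}+\mathcal{O}(\langle a\rangle^2 b^{-3})\Bigr),$$ $$\lambda_{3}=\frac{a}{b^2}+\mathcal{O}(\langle a\rangle^2 b^{-4})+\mathrm{i}\Bigl(-\frac{a}{b}+\mathcal{O}(\langle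 a\rangle^2 b^{-3})\Bigr),$$ $$\lambda_{4}=1-\frac{a}{b^2}+\mathcal{O}(\langle a\rangle^2 b^{-4})+\mathrm{i}\Bigl(b+\frac{a}{b}+\mathcal{O}(\langle a\rangle^2 b^{-3})\Bigr),$$ where $\langle a\rangle=(1+a^2)^{1/2}$. 2) If $b\neq 0$, then $\operatorname{Im}\lambda_j\neq 0$ for every eigenvalue $\lambda_j$ of $M_{a,b}$. 3) The spectrum of $M_{a,b}$ does not depend on the sign of $b$, i.e. $M_{a,b}$ and $M_{a,-b}$ have the same spectrum.
   Context: For $a>0$, $b\in\mathbb{R}$ and variables $x=(x_1,x_2)$, $v=(v_1,v_2)\in\mathbb{R}^2$, the operator $P_{a,b}$ acts on $L^2(\mathbb{R}^4_{x,v})$ and is given by $$2P_{a,b}=(-\nabla_v+v)\cdot(\nabla_v+v)+2\sqrt a\,(v\cdot\nabla_x-x\cdot\nabla_v)+2b\,(v_1\partial_{v_2}-v_2\partial_{v_1}),$$ with domain $\{u\in L^2(\mathbb{R}^4): P_{a,b}u\in L^2(\mathbb{R}^4)\}$ (derivatives in the sense of distributions). A generalized eigenvalue of $P_{a,b}$ is a $\lambda\in\mathbb{C}$ for which there exist $N\ge 1$ and a nonzero $u$ in the domain of $P_{a,b}^N$ with $(P_{a,b}-\lambda)^N u=0$. The associated matrix is $$M_{a,b}=\begin{pmatrix}1&b&\sqrt a&0\\-b&1&0&\sqrt a\\-\sqrt a&0&0&0\\0&-\sqrt a&0&0\end{pmatrix}.$$ Here $\mathbb{N}=\{0,1,2,\dots\}$,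 and $\sqrt{\cdot}$ of a complex number is the principal square root (real part $\ge0$). The $\mathcal{O}$ terms are real, with absolute implied constants (independent of $a$ and $b$), in the regime $b>0$ with $\langle a\rangle b^{-2}$ sufficiently small. *)

theory Defs
  imports "HOL-Analysis.Analysis" "Jordan_Normal_Form.Spectral_Radius"
begin

type_synonym phase = "(real^2) \<times> (real^2)"  \<comment> \<open>points \<open>(x, v)\<close>\<close>

section \<open>Test functions and distributions\<close>

definition dir_deriv :: "phase \<Rightarrow> (phase \<Rightarrow> complex) \<Rightarrow> phase \<Rightarrow> complex" where
  "dir_deriv e f = (\<lambda>p. frechet_derivative f (at p) e)"

primrec iter_deriv :: "phase list \<Rightarrow> (phase \<Rightarrow> complex) \<Rightarrow> phase \<Rightarrow> complex" where
  "iter_deriv [] f = f"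
| "iter_deriv (e # es) f = dir_deriv e (iter_deriv es f)"

text \<open>Differentiability of all iterated directional derivatives makes each of them continuous, so
  this is the class of infinitely differentiable functions.\<close>

definition smooth :: "(phase \<Rightarrow> complex) \<Rightarrow> bool" where
  "smooth f \<longleftrightarrow> (\<forall>es p. iter_deriv es f differentiable (at p))"

definition test_functions :: "(phase \<Rightarrow> complex) set" where
  "test_functions = {\<phi>. smooth \<phi> \<and> compact (closure {p. \<phi> p \<noteq> 0})}"

text \<open>Distributions are represented by functionals of which only the values on test functions
  matter. Only functionals obtained from square integrable functions by differentiation and
  multiplication by polynomials occur below; those are automatically linear and continuous on test
  functions.\<close>

type_synonym distribution = "(phase \<Rightarrow> complex) \<Rightarrow> complex"

definition dist_of :: "(phase \<Rightarrow> complex) \<Rightarrow> distribution" where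
  "dist_of u = (\<lambda>\<phi>. \<integral>p. u p * \<phi> p \<partial>lborel)"

definition ddiff :: "phase \<Rightarrow> distribution \<Rightarrow> distribution" where
  "ddiff e T = (\<lambda>\<phi>. - T (dir_deriv e \<phi>))"

definition dmult :: "(phase \<Rightarrow> real) \<Rightarrow> distribution \<Rightarrow> distribution" where
  "dmult g T = (\<lambda>\<phi>. T (\<lambda>p. of_real (g p) * \<phi> p))"

section \<open>The Kramers-Fokker-Planck operator\<close>

definition xc :: "2 \<Rightarrow> phase \<Rightarrow> real" where "xc j = (\<lambda>p. vec_nth (fst p) j)"
definition vc :: "2 \<Rightarrow> phase \<Rightarrow> real" where "vc j = (\<lambda>p. vec_nth (snd p) j)"

definition d_x :: "2 \<Rightarrow> distribution \<Rightarrow> distribution" where "d_x j = ddiff (axis j 1, 0)"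
definition d_v :: "2 \<Rightarrow> distribution \<Rightarrow> distribution" where "d_v j = ddiff (0, axis j 1)"

text \<open>The two factors of \<open>(-\<nabla>\<^sub>v + v) \<cdot> (\<nabla>\<^sub>v + v)\<close>.\<close>

definition annihil :: "2 \<Rightarrow> distribution \<Rightarrow> distribution" where
  "annihil j T = (\<lambda>\<phi>. d_v j T \<phi> + dmult (vc j) T \<phi>)"

definition creat :: "2 \<Rightarrow> distribution \<Rightarrow> distribution" where
  "creat j T = (\<lambda>\<phi>. - d_v j T \<phi> + dmult (vc j) T \<phi>)"

definition KFP :: "real \<Rightarrow> real \<Rightarrow> distribution \<Rightarrow> distribution" where
  "KFP a b T = (\<lambda>\<phi>. (1/2) *
     ((\<Sum>j\<in>UNIV. creat j (annihil j T) \<phi>)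
      + 2 * of_real (sqrt a) *
          (\<Sum>j\<in>UNIV. dmult (vc j) (d_x j T) \<phi> - dmult (xc j) (d_v j T) \<phi>)
      + 2 * of_real b * (dmult (vc 1) (d_v 2 T) \<phi> - dmult (vc 2) (d_v 1 T) \<phi>)))"

text \<open>Elements of \<open>L\<^sup>2\<close> are represented by functions, so that equality in \<open>L\<^sup>2\<close> is equality almost
  everywhere. Accordingly, the operator is given by its graph, a relation in which \<open>f\<close> ranges over
  all representatives of the image of \<open>u\<close>. Relational powers are then the powers of the
  unbounded operator with their natural domains.\<close>

definition L2 :: "(phase \<Rightarrow> complex) set" where
  "L2 = {u. u \<in> borel_measurable lborel \<and> integrable lborel (\<lambda>p. (cmod (u p))\<^sup>2)}"

definition KFP_graph :: "real \<Rightarrow> real \<Rightarrow> (phase \<Rightarrow> complex) rel" where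
  "KFP_graph a b = {(u, f). u \<in> L2 \<and> f \<in> L2 \<and>
     (\<forall>\<phi>\<in>test_functions. KFP a b (dist_of u) \<phi> = dist_of f \<phi>)}"

definition KFP_shift_graph :: "real \<Rightarrow> real \<Rightarrow> complex \<Rightarrow> (phase \<Rightarrow> complex) rel" where
  "KFP_shift_graph a b \<mu> = {(u, \<lambda>p. f p - \<mu> * u p) | u f. (u, f) \<in> KFP_graph a b}"

definition generalized_eigenvalue :: "real \<Rightarrow> real \<Rightarrow> complex \<Rightarrow> bool" where
  "generalized_eigenvalue a b \<mu> \<longleftrightarrow>
     (\<exists>N\<ge>1. \<exists>u\<in>Domain (KFP_graph a b ^^ N).
        \<not> (AE p in lborel. u p = 0) \<and> (u, \<lambda>p. 0) \<in> KFP_shift_graph a b \<mu> ^^ N)"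

section \<open>The associated matrix\<close>

definition KFP_matrix :: "real \<Rightarrow> real \<Rightarrow> complex mat" where
  "KFP_matrix a b = map_mat of_real (mat_of_rows_list 4
     [[1, b, sqrt a, 0],
      [-b, 1, 0, sqrt a],
      [- sqrt a, 0, 0, 0],
      [0, - sqrt a, 0, 0]])"

definition lam1 :: "real \<Rightarrow> real \<Rightarrow> complex" where
  "lam1 a b = 1/2 * (1 - \<i> * of_real b - csqrt (- (of_real b)\<^sup>2 - 2 * \<i> * of_real b - 4 * of_real a + 1))"
definition lam2 :: "real \<Rightarrow> real \<Rightarrow> complex" where
  "lam2 a b = 1/2 * (1 - \<i> * of_real b + csqrt (- (of_real b)\<^sup>2 - 2 * \<i> * of_real b - 4 * of_real a + 1))"
definition lam3 :: "real \<Rightarrow> real \<Rightarrow> complex" where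
  "lam3 a b = 1/2 * (1 + \<i> * of_real b - csqrt (- (of_real b)\<^sup>2 + 2 * \<i> * of_real b - 4 * of_real a + 1))"
definition lam4 :: "real \<Rightarrow> real \<Rightarrow> complex" where
  "lam4 a b = 1/2 * (1 + \<i> * of_real b + csqrt (- (of_real b)\<^sup>2 + 2 * \<i> * of_real b - 4 * of_real a + 1))"

definition japanese :: "real \<Rightarrow> real" where
  "japanese a = sqrt (1 + a^2)"

end

theory Submission
  imports Defs "HOL-Probability.Distributions"
begin

text \<open>Write \<open>g\<close> for the Gaussian \<open>exp (- \<bar>X\<bar>\<^sup>2 / 2)\<close>, which is annihilated by the operator. Conjugating by \<open>g\<close>
turns the operator into \<open>L\<close>, a vector field with linear coefficients minus half of the velocity
Laplacian, and \<open>L\<close> acts on polynomials. The vector field acts on linear forms by the matrix of the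
theorem, up to a choice of basis. In the complex coordinates \<open>x\<^sub>1 \<plusminus> \<i> x\<^sub>2\<close>, \<open>v\<^sub>1 \<plusminus> \<i> v\<^sub>2\<close> it splits into
two blocks, and there are independent linear forms \<open>y\<^sub>1, ..., y\<^sub>4\<close> for which it is triangular with
diagonal \<open>\<lambda>\<^sub>1, ..., \<lambda>\<^sub>4\<close>, including the case in which the matrix is not diagonalisable. Hence
\<open>L\<close> maps the monomial \<open>y\<^sup>k\<close> to \<open>\<alpha>\<^sub>k y\<^sup>k\<close> plus monomials of smaller weight (\<open>conj_KFP_emono\<close>), where the
weight is \<open>2 k\<^sub>1 + k\<^sub>2 + 2 k\<^sub>3 + k\<^sub>4\<close>.

Each \<open>\<alpha>\<^sub>k\<close> is an eigenvalue: back substitution in this triangular system produces a nonzero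
polynomial \<open>p\<close> with \<open>L p = \<alpha>\<^sub>k p\<close> (\<open>conj_KFP_eigenfunction\<close>), and \<open>p g\<close> is a square integrable
eigenfunction.

Conversely, a generalized eigenvalue \<open>\<mu>\<close> has a genuine eigenfunction \<open>w\<close>. Testing its equation against
polynomials times \<open>g\<close>, after a cutoff, moves the operator to the test side. The transpose is the same
kind of operator with the signs of \<open>sqrt a\<close> and \<open>b\<close> reversed (\<open>KFP_transpose\<close>), and its numbers
\<open>\<alpha>\<^sub>k\<close> form the same set. If \<open>\<mu>\<close> is none of them, the triangular recursion forces all moments of
\<open>w g\<close> to vanish (\<open>weak_eigenfunction_zero\<close>). The span of the polynomials times \<open>g\<close> is dense
(\<open>hermite_complete\<close>), so \<open>w = 0\<close>, a contradiction. Density is reduced to the Stone-Weierstrass theorem: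
multiplication by \<open>sin (\<epsilon> x\<^sub>i)\<close> preserves the vanishing of all moments, the maps
\<open>x \<mapsto> sin (\<epsilon> x) / \<epsilon>\<close> take values in a compact set, and they converge to the identity.

The statements about the matrix follow from its two blocks. The asymptotics come from an exact
algebraic relation for the real part of the square root (\<open>lam1_asymptotics\<close>).\<close>

\<comment> \<open>The dot denotes the inner product of the Euclidean space, and quantifiers over the phase space
  are not to be split into pairs.\<close>
no_notation Matrix.scalar_prod (infix "\<bullet>" 70)
declare split_paired_All [simp del] split_paired_Ex [simp del]

section \<open>The roots and the matrix\<close>

lemma lam_vieta:
  "lam1 a b + lam2 a b = 1 - \<i> * of_real b" "lam1 a b * lam2 a b = of_real a"
  "lam3 a b + lam4 a b = 1 + \<i> * of_real b" "lam3 a b * lam4 a b = of_real a"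
proof -
  define s where "s = csqrt (- (of_real b)\<^sup>2 - 2 * \<i> * of_real b - 4 * of_real a + 1)"
  have s2: "s\<^sup>2 = - (of_real b)\<^sup>2 - 2 * \<i> * of_real b - 4 * of_real a + 1"
    unfolding s_def by simp
  define t where "t = csqrt (- (of_real b)\<^sup>2 + 2 * \<i> * of_real b - 4 * of_real a + 1)"
  have t2: "t\<^sup>2 = - (of_real b)\<^sup>2 + 2 * \<i> * of_real b - 4 * of_real a + 1"
    unfolding t_def by simp
  show "lam1 a b + lam2 a b = 1 - \<i> * of_real b" "lam3 a b + lam4 a b = 1 + \<i> * of_real b"
    by (simp_all add: lam1_def lam2_def lam3_def lam4_def algebra_simps)
  have "lam1 a b * lam2 a b = ((1 - \<i> * of_real b)\<^sup>2 - s\<^sup>2) / 4"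
    unfolding lam1_def lam2_def s_def[symmetric] by (simp add: field_simps power2_eq_square)
  also have "\<dots> = of_real a"
    unfolding s2 by (simp add: field_simps power2_eq_square)
  finally show "lam1 a b * lam2 a b = of_real a" .
  have "lam3 a b * lam4 a b = ((1 + \<i> * of_real b)\<^sup>2 - t\<^sup>2) / 4"
    unfolding lam3_def lam4_def t_def[symmetric] by (simp add: field_simps power2_eq_square)
  also have "\<dots> = of_real a"
    unfolding t2 by (simp add: field_simps power2_eq_square)
  finally show "lam3 a b * lam4 a b = of_real a" .
qed

lemma lam_roots:
  "\<mu>\<^sup>2 - (1 - \<i> * of_real b) * \<mu> + of_real a = 0 \<longleftrightarrow> \<mu> = lam1 a b \<or> \<mu> = lam2 a b"
  "\<mu>\<^sup>2 - (1 + \<i> * of_real b) * \<mu> + of_real a = 0 \<longleftrightarrow> \<mu> = lam3 a b \<or> \<mu> = lam4 a b"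
proof -
  have "\<mu>\<^sup>2 - (1 - \<i> * of_real b) * \<mu> + of_real a = (\<mu> - lam1 a b) * (\<mu> - lam2 a b)"
    unfolding lam_vieta(1,2)[of a b, symmetric] by (simp add: algebra_simps power2_eq_square)
  then show "\<mu>\<^sup>2 - (1 - \<i> * of_real b) * \<mu> + of_real a = 0 \<longleftrightarrow> \<mu> = lam1 a b \<or> \<mu> = lam2 a b"
    by auto
  have "\<mu>\<^sup>2 - (1 + \<i> * of_real b) * \<mu> + of_real a = (\<mu> - lam3 a b) * (\<mu> - lam4 a b)"
    unfolding lam_vieta(3,4)[of a b, symmetric] by (simp add: algebra_simps power2_eq_square)
  then show "\<mu>\<^sup>2 - (1 + \<i> * of_real b) * \<mu> + of_real a = 0 \<longleftrightarrow> \<mu> = lam3 a b \<or> \<mu> = lam4 a b"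
    by auto
qed

lemma lam_uminus_b:
  "lam1 a (- b) = lam3 a b" "lam2 a (- b) = lam4 a b" "lam3 a (- b) = lam1 a b" "lam4 a (- b) = lam2 a b"
  by (simp_all add: lam1_def lam2_def lam3_def lam4_def)

lemma Im_lam_nonzero:
  assumes "a > 0" "b \<noteq> 0" "\<mu> \<in> {lam1 a b, lam2 a b, lam3 a b, lam4 a b}"
  shows "Im \<mu> \<noteq> 0"
proof
  assume im: "Im \<mu> = 0"
  define m where "m = Re \<mu>"
  have m: "\<mu> = of_real m" by (simp add: m_def complex_eq_iff im)
  obtain c where c: "c \<noteq> 0" "\<mu>\<^sup>2 - (1 - \<i> * of_real c) * \<mu> + of_real a = 0"
    using assms lam_roots(1)[of \<mu> b a] lam_roots(1)[of \<mu> "-b" a] unfolding lam_uminus_b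
    by (metis insertE singletonD neg_equal_0_iff_equal)
  from arg_cong[OF c(2), of Im] have "m = 0" using c(1) by (simp add: m)
  with c(2) m assms(1) show False by simp
qed

lemma mult_KFP_matrix_vec:
  assumes "v \<in> carrier_vec 4"
  shows "KFP_matrix a b *\<^sub>v v = \<mu> \<cdot>\<^sub>v v \<longleftrightarrow>
     v $ 0 + of_real b * v $ 1 + of_real (sqrt a) * v $ 2 = \<mu> * v $ 0 \<and>
     - of_real b * v $ 0 + v $ 1 + of_real (sqrt a) * v $ 3 = \<mu> * v $ 1 \<and>
     - of_real (sqrt a) * v $ 0 = \<mu> * v $ 2 \<and>
     - of_real (sqrt a) * v $ 1 = \<mu> * v $ 3"
proof -
  have all4: "(\<forall>i<4. P i) \<longleftrightarrow> P 0 \<and> P 1 \<and> P 2 \<and> P (3::nat)" for P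
    by (auto simp: numeral_eq_Suc less_Suc_eq)
  have d: "dim_vec v = 4" using assms by simp
  have set4: "{0..<4} = {0,1,2,3::nat}" by auto
  show ?thesis
    by (simp add: vec_eq_iff all4 KFP_matrix_def mat_of_rows_list_def scalar_prod_def d set4 row_def
        insert_commute add.assoc) (simp add: algebra_simps)
qed

text \<open>The matrix commutes with the rotation that acts simultaneously on the pairs of coordinates \<open>0, 1\<close> and
\<open>2, 3\<close>. On the two eigenspaces of that rotation, where \<open>j = \<plusminus>\<i>\<close>, it is a two by two block with
characteristic polynomial \<open>\<mu>\<^sup>2 - (1 - j b) \<mu> + s\<^sup>2\<close>; this is the elimination in one block.\<close>

lemma KFP_matrix_block:
  fixes p q r t s b j \<mu> :: "'a :: idom"
  assumes "p + b * q + s * r = \<mu> * p" "- b * p + q + s * t = \<mu> * q"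
       "- s * p = \<mu> * r" "- s * q = \<mu> * t" "j * j = - 1"
  shows "(\<mu> * \<mu> - (1 - j * b) * \<mu> + s * s) * (p + j * q) = 0"
proof -
  have j: "j * (j * x) = - x" for x using assms(5) by (simp flip: mult.assoc)
  have "\<mu> * (p + j * q) = \<mu> * p + j * (\<mu> * q)" by (simp add: algebra_simps)
  also have "\<dots> = (1 - j * b) * (p + j * q) + s * (r + j * t)"
    unfolding assms(1,2)[symmetric] by (simp add: algebra_simps j)
  finally have 1: "\<mu> * (p + j * q) = (1 - j * b) * (p + j * q) + s * (r + j * t)" .
  have "\<mu> * (r + j * t) = \<mu> * r + j * (\<mu> * t)" by (simp add: algebra_simps)
  also have "\<dots> = - s * (p + j * q)"
    unfolding assms(3,4)[symmetric] by (simp add: algebra_simps)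
  finally have 2: "\<mu> * (r + j * t) = - s * (p + j * q)" .
  have "\<mu> * (\<mu> * (p + j * q)) = (1 - j * b) * (\<mu> * (p + j * q)) + s * (\<mu> * (r + j * t))"
    by (subst 1) (simp add: algebra_simps)
  also have "\<dots> = (1 - j * b) * (\<mu> * (p + j * q)) - s * s * (p + j * q)"
    unfolding 2 by (simp add: algebra_simps)
  finally show ?thesis by (simp add: algebra_simps)
qed

lemma KFP_matrix_eigenvector:
  fixes s b d \<mu> :: "'a :: idom"
  assumes "\<mu>\<^sup>2 - (1 - d * b) * \<mu> + s * s = 0" "d * d = - 1"
  shows "d * \<mu> + b * \<mu> + s * (- d * s) = \<mu> * (d * \<mu>)" 
    "- b * (d * \<mu>) + \<mu> + s * - s = \<mu> * \<mu>"
proof -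
  have m: "\<mu> * \<mu> = (1 - d * b) * \<mu> - s * s"
    using assms(1) by (simp add: power2_eq_square algebra_simps)
  then show "- b * (d * \<mu>) + \<mu> + s * - s = \<mu> * \<mu>" by (simp add: algebra_simps)
  have d: "d * (d * x) = - x" for x using assms(2) by (simp flip: mult.assoc)
  have d': "x * (d * d) = - x" "x * (y * (d * d)) = - (x * y)" for x y using assms(2) by simp_all
  have "\<mu> * (d * \<mu>) = d * (\<mu> * \<mu>)" by (simp add: mult_ac)
  also have "\<dots> = d * \<mu> + b * \<mu> + s * (- d * s)" unfolding m by (simp add: algebra_simps d d')
  finally show "d * \<mu> + b * \<mu> + s * (- d * s) = \<mu> * (d * \<mu>)" by simp
qed

lemma spectrum_KFP_matrix:
  assumes "a > 0"
  shows "spectrum (KFP_matrix a b) = {lam1 a b, lam2 a b, lam3 a b, lam4 a b}"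
proof -
  define s where "s = complex_of_real (sqrt a)"
  have s0: "s \<noteq> 0" and s2: "s * s = of_real a"
    using assms by (auto simp: s_def simp flip: of_real_mult)
  have dim: "dim_row (KFP_matrix a b) = 4"
    by (simp add: KFP_matrix_def mat_of_rows_list_def)
  have fwd: "\<mu> \<in> {lam1 a b, lam2 a b, lam3 a b, lam4 a b}"
    if v: "v \<in> carrier_vec 4" "v \<noteq> 0\<^sub>v 4" "KFP_matrix a b *\<^sub>v v = \<mu> \<cdot>\<^sub>v v" for \<mu> v
  proof (rule ccontr)
    assume "\<not> ?thesis"
    then have nz: "\<mu>\<^sup>2 - (1 - \<i> * of_real b) * \<mu> + of_real a \<noteq> 0"
         "\<mu>\<^sup>2 - (1 + \<i> * of_real b) * \<mu> + of_real a \<noteq> 0"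
      using lam_roots[of \<mu> b a] by auto
    define p q r t where "p = v $ 0" "q = v $ 1" "r = v $ 2" "t = v $ 3"
    have e: "p + of_real b * q + s * r = \<mu> * p" "- of_real b * p + q + s * t = \<mu> * q"
       "- s * p = \<mu> * r" "- s * q = \<mu> * t"
      using v(3) unfolding mult_KFP_matrix_vec[OF v(1)] p_q_r_t_def s_def by auto
    have "(\<mu>\<^sup>2 - (1 - \<i> * of_real b) * \<mu> + s * s) * (p + \<i> * q) = 0"
      using e unfolding power2_eq_square by (rule KFP_matrix_block) simp_all
    with nz(1) have 1: "p + \<i> * q = 0" by (simp add: s2)
    have "(\<mu>\<^sup>2 - (1 + \<i> * of_real b) * \<mu> + s * s) * (p - \<i> * q) = 0"
      using KFP_matrix_block[OF e, of "- \<i>"] by (simp add: power2_eq_square)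
    with nz(2) have 2: "p - \<i> * q = 0" by (simp add: s2)
    from 1 2 have "p = 0" "q = 0" by (auto simp: complex_eq_iff)
    with e s0 have "r = 0" "t = 0" by auto
    have "v = 0\<^sub>v 4"
    proof (rule eq_vecI)
      fix i :: nat assume "i < dim_vec (0\<^sub>v 4 :: complex vec)"
      then have "i = 0 \<or> i = 1 \<or> i = 2 \<or> i = 3" by auto
      then show "v $ i = 0\<^sub>v 4 $ i"
        using \<open>p = 0\<close> \<open>q = 0\<close> \<open>r = 0\<close> \<open>t = 0\<close> unfolding p_q_r_t_def by auto
    qed (use v(1) in auto)
    with v(2) show False by simp
  qed
  have bwd: "\<exists>v. v \<in> carrier_vec 4 \<and> v \<noteq> 0\<^sub>v 4 \<and> KFP_matrix a b *\<^sub>v v = \<mu> \<cdot>\<^sub>v v"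
    if root: "\<mu>\<^sup>2 - (1 - \<epsilon> * \<i> * of_real b) * \<mu> + of_real a = 0" and eps: "\<epsilon> * \<epsilon> = (1::complex)" for \<mu> \<epsilon>
  proof (intro exI conjI)
    \<comment> \<open>The eigenvector lies in the block where the first pair of entries is proportional to \<open>(\<epsilon> \<i>, 1)\<close>.\<close>
    let ?v = "vec_of_list [\<epsilon> * \<i> * \<mu>, \<mu>, - \<epsilon> * \<i> * s, - s]"
    show v: "?v \<in> carrier_vec 4" by (intro carrier_vecI) simp
    have idx: "?v $ 0 = \<epsilon> * \<i> * \<mu>" "?v $ 1 = \<mu>" "?v $ 2 = - \<epsilon> * \<i> * s" "?v $ 3 = - s"
      by (simp_all add: numeral_eq_Suc)
    show "?v \<noteq> 0\<^sub>v 4"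
    proof
      assume "?v = 0\<^sub>v 4"
      then have "?v $ 3 = 0" by simp
      with idx s0 show False by simp
    qed
    have root': "\<mu>\<^sup>2 - (1 - \<epsilon> * \<i> * of_real b) * \<mu> + s * s = 0" using root s2 by simp
    show "KFP_matrix a b *\<^sub>v ?v = \<mu> \<cdot>\<^sub>v ?v"
      unfolding mult_KFP_matrix_vec[OF v] idx s_def[symmetric]
      using KFP_matrix_eigenvector[OF root'] eps by (simp add: mult_ac)
  qed
  show ?thesis
  proof (intro equalityI subsetI)
    fix \<mu> assume "\<mu> \<in> spectrum (KFP_matrix a b)"
    then show "\<mu> \<in> {lam1 a b, lam2 a b, lam3 a b, lam4 a b}"
      using fwd by (auto simp: spectrum_def eigenvalue_def eigenvector_def dim)
  next
    fix \<mu> assume "\<mu> \<in> {lam1 a b, lam2 a b, lam3 a b, lam4 a b}"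
    then have "\<mu>\<^sup>2 - (1 - \<i> * of_real b) * \<mu> + of_real a = 0 \<or> \<mu>\<^sup>2 - (1 + \<i> * of_real b) * \<mu> + of_real a = 0"
      using lam_roots[of \<mu> b a] by auto
    then have "\<exists>v. v \<in> carrier_vec 4 \<and> v \<noteq> 0\<^sub>v 4 \<and> KFP_matrix a b *\<^sub>v v = \<mu> \<cdot>\<^sub>v v"
      using bwd[of \<mu> 1] bwd[of \<mu> "-1"] by auto
    then show "\<mu> \<in> spectrum (KFP_matrix a b)"
      by (auto simp: spectrum_def eigenvalue_def eigenvector_def dim)
  qed
qed

section \<open>Asymptotics of the roots for large b\<close>

text \<open>Let \<open>p\<close> be the real part of the square root in \<open>lam1\<close>. Separating real and imaginary parts of the
square gives the exact relation \<open>(1 - p\<^sup>2) (p\<^sup>2 + b\<^sup>2) = 4 a p\<^sup>2\<close>, hence \<open>0 < p \<le> 1\<close> and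
\<open>1 - p \<le> 4 a / b\<^sup>2\<close>. Both remainders are then explicit fractions that are estimated term by term.
The constant is \<open>12 + 2\<close>, from \<open>a (12 a + 2) \<le> 14 (1 + a\<^sup>2)\<close>.\<close>

lemma lam1_asymptotics:
  assumes "a > 0" "b > 0"
  obtains r s :: real where "\<bar>r\<bar> \<le> 14 * (japanese a)\<^sup>2 / b^4" "\<bar>s\<bar> \<le> 14 * (japanese a)\<^sup>2 / b^3"
    "lam1 a b = complex_of_real (a / b\<^sup>2 + r) - \<i> * complex_of_real (- (a / b) + s)"
proof -
  define z where "z = csqrt (- (of_real b)\<^sup>2 - 2 * \<i> * of_real b - 4 * of_real a + 1)"
  define p t where "p = Re z" "t = - Im z"
  have z2: "z\<^sup>2 = - (of_real b)\<^sup>2 - 2 * \<i> * of_real b - 4 * of_real a + 1"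
    unfolding z_def by simp
  have re: "p\<^sup>2 - t\<^sup>2 = 1 - b\<^sup>2 - 4 * a" and pt: "p * t = b"
    using arg_cong[OF z2, of Re] arg_cong[OF z2, of Im] by (auto simp: p_t_def power2_eq_square mult.commute)
  have p0: "p \<ge> 0" using csqrt_principal unfolding p_t_def z_def by (metis less_eq_real_def)
  with pt assms have p: "p > 0" and t: "t > 0"
    by (auto simp: zero_less_mult_iff)
  have prod: "(1 - p\<^sup>2) * (p\<^sup>2 + b\<^sup>2) = 4 * a * p\<^sup>2"
  proof -
    have "b\<^sup>2 = p\<^sup>2 * t\<^sup>2" using pt by (simp add: power_mult_distrib flip: pt)
    also have "\<dots> = p\<^sup>2 * (p\<^sup>2 + b\<^sup>2 + 4 * a - 1)" using re by (intro arg_cong2[of _ _ _ _ "(*)"]) auto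
    finally have "b\<^sup>2 = p\<^sup>2 * (p\<^sup>2 + b\<^sup>2 + 4 * a - 1)" .
    moreover have "(1 - P) * (P + c) = 4 * a * P" if "c = P * (P + c + 4 * a - 1)" for P c :: real
    proof -
      have "(1 - P) * (P + c) = P + c - P * (P + c)" "P * (P + c + 4 * a - 1) = P * (P + c) + 4 * a * P - P"
        by (simp_all add: algebra_simps)
      then show ?thesis using that by linarith
    qed
    ultimately show ?thesis by blast
  qed
  have "1 - p\<^sup>2 \<ge> 0"
    using prod assms p by (smt (verit) mult_nonneg_nonneg mult_pos_pos mult_neg_pos zero_less_power)
  then have p1: "p \<le> 1" using p abs_square_le_1[of p] by simp
  have P1: "1 - p\<^sup>2 \<le> 4 * a / b\<^sup>2"
  proof -
    have "(1 - p\<^sup>2) * b\<^sup>2 \<le> (1 - p\<^sup>2) * (p\<^sup>2 + b\<^sup>2)"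
      using \<open>1 - p\<^sup>2 \<ge> 0\<close> by (intro mult_left_mono) auto
    also have "\<dots> \<le> 4 * a * 1" unfolding prod using assms p p1 by (intro mult_left_mono) (auto simp: power_le_one)
    finally show ?thesis using assms by (simp add: field_simps)
  qed
  have "p\<^sup>2 \<le> p" using p p1 by (simp add: power2_eq_square mult_left_le)
  then have pp: "1 - p \<le> 4 * a / b\<^sup>2" using P1 by simp
  have J: "a \<le> (japanese a)\<^sup>2" "a\<^sup>2 \<le> (japanese a)\<^sup>2" "1 \<le> (japanese a)\<^sup>2"
  proof -
    have "(a - 1)\<^sup>2 \<ge> 0" by simp
    then have "2 * a \<le> 1 + a\<^sup>2" unfolding power2_diff by simp
    then show "a \<le> (japanese a)\<^sup>2" "a\<^sup>2 \<le> (japanese a)\<^sup>2" "1 \<le> (japanese a)\<^sup>2"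
      using assms by (auto simp: japanese_def)
  qed
  \<comment> \<open>The two remainders are defined by the expansion that they have to satisfy.\<close>
  define r where "r = (1 - p) / 2 - a / b\<^sup>2"
  define s where "s = (b - t) / 2 + a / b"
  have "lam1 a b = complex_of_real ((1 - p) / 2) - \<i> * complex_of_real ((b - t) / 2)"
    unfolding lam1_def z_def[symmetric] by (simp add: complex_eq_iff p_t_def field_simps)
  then have lam: "lam1 a b = complex_of_real (a / b\<^sup>2 + r) - \<i> * complex_of_real (- (a / b) + s)"
    by (simp add: r_def s_def)
  have rb: "\<bar>r\<bar> \<le> 14 * (japanese a)\<^sup>2 / b^4"
  proof -
    define D where "D = (p\<^sup>2 + b\<^sup>2) * (1 + p) * b\<^sup>2"
    have D: "D \<ge> b^4" 
    proof -
      have "b^4 = b\<^sup>2 * 1 * b\<^sup>2" by (simp add: power4_eq_xxxx power2_eq_square)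
      also have "\<dots> \<le> D" unfolding D_def using p by (intro mult_right_mono mult_mono) auto
      finally show ?thesis .
    qed
    have D0: "D > 0" using D assms by (smt (verit) zero_less_power)
    \<comment> \<open>Inserting the relation for \<open>1 - p\<^sup>2\<close> gives \<open>r = a n / D\<close> with a numerator in which \<open>b\<^sup>2\<close> is
      multiplied by \<open>1 - p\<close>, so that \<open>n\<close> is of size \<open>a + 1\<close>.\<close>
    define n where "n = b\<^sup>2 * ((p - 1) * (2 * p + 1)) - p\<^sup>2 * (1 + p)"
    have "r * D * 2 = 2 * a * n"
    proof -
      have "r * D * 2 = b\<^sup>2 * ((1-p\<^sup>2) * (p\<^sup>2+b\<^sup>2)) - 2 * a * ((p\<^sup>2 + b\<^sup>2) * (1 + p))"
        unfolding r_def D_def using assms by (simp add: field_simps power2_eq_square)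
      also have "\<dots> = 2 * a * n" unfolding prod n_def by (simp add: field_simps power2_eq_square)
      finally show ?thesis .
    qed
    then have rD: "r = a * n / D" using D0 by (simp add: field_simps)
    have "\<bar>n\<bar> \<le> b\<^sup>2 * ((1 - p) * (2 * p + 1)) + p\<^sup>2 * (1 + p)"
    proof -
      have "\<bar>n\<bar> \<le> \<bar>b\<^sup>2 * ((p - 1) * (2 * p + 1))\<bar> + \<bar>p\<^sup>2 * (1 + p)\<bar>"
        unfolding n_def by (rule abs_triangle_ineq4)
      also have "\<dots> = b\<^sup>2 * ((1 - p) * (2 * p + 1)) + p\<^sup>2 * (1 + p)"
        using p p1 by (simp add: abs_mult abs_of_nonneg)
      finally show ?thesis .
    qed
    also have "\<dots> \<le> b\<^sup>2 * ((4 * a / b\<^sup>2) * 3) + 1 * 2"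
      using pp p p1 assms by (intro add_mono mult_mono mult_left_mono) (auto simp: power_le_one)
    also have "\<dots> = 12 * a + 2" using assms by simp
    finally have n: "\<bar>n\<bar> \<le> 12 * a + 2" .
    have "\<bar>r\<bar> = a * \<bar>n\<bar> / D" using D0 assms by (simp add: rD abs_mult)
    also have "\<dots> \<le> a * (12 * a + 2) / b^4"
      using n D D0 assms by (intro frac_le mult_left_mono) auto
    also have "\<dots> \<le> 14 * (japanese a)\<^sup>2 / b^4"
      using J assms by (intro divide_right_mono) (auto simp: field_simps power2_eq_square)
    finally show ?thesis .
  qed
  have sb: "\<bar>s\<bar> \<le> 14 * (japanese a)\<^sup>2 / b^3"
  proof -
    have tb: "t \<ge> b" using pt p p1 t by (metis mult_left_le_one_le less_imp_le)
    have "(t - b) * (t + b) = 4 * a - (1 - p\<^sup>2)" using re by (simp add: algebra_simps power2_eq_square)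
    then have tt: "t - b = (4 * a - (1 - p\<^sup>2)) / (t + b)" using t assms by (simp add: field_simps)
    have seq: "s = (2 * a * (t - b) + b * (1 - p\<^sup>2)) / (2 * b * (t + b))"
    proof -
      have "s = - (t - b) / 2 + a / b" by (simp add: s_def field_simps)
      also have "\<dots> = - ((4 * a - (1 - p\<^sup>2)) / (t + b)) / 2 + a / b" by (simp only: tt)
      finally show ?thesis using t assms by (simp add: field_simps)
    qed
    have "t - b \<le> 4 * a / (2 * b)"
      unfolding tt using tb assms \<open>1 - p\<^sup>2 \<ge> 0\<close> by (intro frac_le) auto
    then have "2 * a * (t - b) + b * (1 - p\<^sup>2) \<le> 2 * a * (4 * a / (2 * b)) + b * (4 * a / b\<^sup>2)"
      using P1 assms by (intro add_mono mult_left_mono) auto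
    then have n1: "2 * a * (t - b) + b * (1 - p\<^sup>2) \<le> 4 * (a\<^sup>2 + a) / b"
      using assms by (simp add: field_simps power2_eq_square)
    have n0: "0 \<le> 2 * a * (t - b) + b * (1 - p\<^sup>2)"
      using tb assms \<open>1 - p\<^sup>2 \<ge> 0\<close> by auto
    have d: "4 * b\<^sup>2 \<le> 2 * b * (t + b)" using tb assms by (simp add: power2_eq_square algebra_simps)
    have "\<bar>s\<bar> = (2 * a * (t - b) + b * (1 - p\<^sup>2)) / (2 * b * (t + b))"
      unfolding seq using n0 assms t by (intro abs_of_nonneg divide_nonneg_nonneg) auto
    also have "\<dots> \<le> (4 * (a\<^sup>2 + a) / b) / (4 * b\<^sup>2)"
      using n0 n1 d assms by (intro frac_le) auto
    also have "\<dots> = (a\<^sup>2 + a) / b^3" using assms by (simp add: power2_eq_square power3_eq_cube field_simps)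
    also have "\<dots> \<le> 14 * (japanese a)\<^sup>2 / b^3"
      using J assms by (intro divide_right_mono) auto
    finally show ?thesis .
  qed
  show thesis using that rb sb lam by blast
qed

text \<open>The principal root commutes with conjugation off the negative real axis, and \<open>b > 0\<close> keeps the
radicand off that axis.\<close>

lemma lam3_eq_cnj_lam1:
  assumes "b > 0" shows "lam3 a b = cnj (lam1 a b)"
proof -
  have "csqrt (- (of_real b)\<^sup>2 + 2 * \<i> * of_real b - 4 * of_real a + 1)
      = csqrt (cnj (- (of_real b)\<^sup>2 - 2 * \<i> * of_real b - 4 * of_real a + 1))"
    by simp
  also have "\<dots> = cnj (csqrt (- (of_real b)\<^sup>2 - 2 * \<i> * of_real b - 4 * of_real a + 1))"
    using assms by (subst cnj_csqrt) (auto simp: complex_nonpos_Reals_iff power2_eq_square)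
  finally show ?thesis by (simp add: lam1_def lam3_def)
qed

lemma lam_asymptotics:
  assumes "a > 0" "b > 0"
  shows "\<exists>r s :: real. \<bar>r\<bar> \<le> 14 * (japanese a)\<^sup>2 / b^4 \<and> \<bar>s\<bar> \<le> 14 * (japanese a)\<^sup>2 / b^3 \<and>
           lam1 a b = complex_of_real (a / b\<^sup>2 + r) - \<i> * complex_of_real (- (a / b) + s)"
    "\<exists>r s :: real. \<bar>r\<bar> \<le> 14 * (japanese a)\<^sup>2 / b^4 \<and> \<bar>s\<bar> \<le> 14 * (japanese a)\<^sup>2 / b^3 \<and>
           lam2 a b = complex_of_real (1 - a / b\<^sup>2 + r) - \<i> * complex_of_real (b + a / b + s)"
    "\<exists>r s :: real. \<bar>r\<bar> \<le> 14 * (japanese a)\<^sup>2 / b^4 \<and> \<bar>s\<bar> \<le> 14 * (japanese a)\<^sup>2 / b^3 \<and>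
           lam3 a b = complex_of_real (a / b\<^sup>2 + r) + \<i> * complex_of_real (- (a / b) + s)"
    "\<exists>r s :: real. \<bar>r\<bar> \<le> 14 * (japanese a)\<^sup>2 / b^4 \<and> \<bar>s\<bar> \<le> 14 * (japanese a)\<^sup>2 / b^3 \<and>
           lam4 a b = complex_of_real (1 - a / b\<^sup>2 + r) + \<i> * complex_of_real (b + a / b + s)"
proof -
  obtain r s where rs: "\<bar>r\<bar> \<le> 14 * (japanese a)\<^sup>2 / b^4" "\<bar>s\<bar> \<le> 14 * (japanese a)\<^sup>2 / b^3"
    and l1: "lam1 a b = complex_of_real (a / b\<^sup>2 + r) - \<i> * complex_of_real (- (a / b) + s)"
    using lam1_asymptotics[OF assms] by blast
  have l3: "lam3 a b = complex_of_real (a / b\<^sup>2 + r) + \<i> * complex_of_real (- (a / b) + s)"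
    unfolding lam3_eq_cnj_lam1[OF assms(2)] l1 by simp
  have "lam2 a b = 1 - \<i> * of_real b - lam1 a b"
    using lam_vieta(1)[of a b] by (simp add: algebra_simps)
  then have l2: "lam2 a b = complex_of_real (1 - a / b\<^sup>2 + - r) - \<i> * complex_of_real (b + a / b + - s)"
    unfolding l1 by (simp add: algebra_simps)
  have "lam4 a b = 1 + \<i> * of_real b - lam3 a b"
    using lam_vieta(3)[of a b] by (simp add: algebra_simps)
  then have l4: "lam4 a b = complex_of_real (1 - a / b\<^sup>2 + - r) + \<i> * complex_of_real (b + a / b + - s)"
    unfolding l3 by (simp add: algebra_simps)
  have rs': "\<bar>- r\<bar> \<le> 14 * (japanese a)\<^sup>2 / b^4" "\<bar>- s\<bar> \<le> 14 * (japanese a)\<^sup>2 / b^3" using rs by simp_all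
  show "\<exists>r s :: real. \<bar>r\<bar> \<le> 14 * (japanese a)\<^sup>2 / b^4 \<and> \<bar>s\<bar> \<le> 14 * (japanese a)\<^sup>2 / b^3 \<and>
           lam1 a b = complex_of_real (a / b\<^sup>2 + r) - \<i> * complex_of_real (- (a / b) + s)"
    using rs l1 by blast
  show "\<exists>r s :: real. \<bar>r\<bar> \<le> 14 * (japanese a)\<^sup>2 / b^4 \<and> \<bar>s\<bar> \<le> 14 * (japanese a)\<^sup>2 / b^3 \<and>
           lam3 a b = complex_of_real (a / b\<^sup>2 + r) + \<i> * complex_of_real (- (a / b) + s)"
    using rs l3 by blast
  show "\<exists>r s :: real. \<bar>r\<bar> \<le> 14 * (japanese a)\<^sup>2 / b^4 \<and> \<bar>s\<bar> \<le> 14 * (japanese a)\<^sup>2 / b^3 \<and>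
           lam2 a b = complex_of_real (1 - a / b\<^sup>2 + r) - \<i> * complex_of_real (b + a / b + s)"
    using rs' l2 by blast
  show "\<exists>r s :: real. \<bar>r\<bar> \<le> 14 * (japanese a)\<^sup>2 / b^4 \<and> \<bar>s\<bar> \<le> 14 * (japanese a)\<^sup>2 / b^3 \<and>
           lam4 a b = complex_of_real (1 - a / b\<^sup>2 + r) + \<i> * complex_of_real (b + a / b + s)"
    using rs' l4 by blast
qed

section \<open>Calculus of smooth functions\<close>

text \<open>Smoothness asks for all iterated derivatives. It suffices to place \<open>f\<close> in a family of
differentiable functions that is closed under directional derivatives; all closure properties below
are obtained by exhibiting such a family.\<close>

lemma smooth_coinduct:
  assumes "f \<in> S" "\<And>f p. f \<in> S \<Longrightarrow> f differentiable (at p)" "\<And>f e. f \<in> S \<Longrightarrow> dir_deriv e f \<in> S"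
  shows "smooth f"
proof -
  have "iter_deriv es f \<in> S" for es
    using assms by (induction es) auto
  with assms(2) show ?thesis by (auto simp: smooth_def)
qed

lemma iter_deriv_append: "iter_deriv (es @ es') f = iter_deriv es (iter_deriv es' f)"
  by (induction es) auto

lemma smooth_dir_deriv: "smooth f \<Longrightarrow> smooth (dir_deriv e f)"
  unfolding smooth_def
proof (intro allI)
  fix es p assume "\<forall>es p. iter_deriv es f differentiable at p"
  then have "iter_deriv (es @ [e]) f differentiable at p" by blast
  then show "iter_deriv es (dir_deriv e f) differentiable at p"
    by (simp add: iter_deriv_append)
qed

lemma smooth_has_derivative:
  assumes "smooth f" shows "(f has_derivative (\<lambda>e. dir_deriv e f p)) (at p)"
proof -
  have "f differentiable (at p)" using assms by (metis iter_deriv.simps(1) smooth_def)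
  then show ?thesis by (simp add: dir_deriv_def frechet_derivative_works)
qed

lemma dir_deriv_eqI: "(f has_derivative f') (at p) \<Longrightarrow> dir_deriv e f p = f' e"
  by (simp add: dir_deriv_def frechet_derivative_at[symmetric])

lemma smooth_continuous: "smooth f \<Longrightarrow> continuous_on A f"
  by (meson continuous_at_imp_continuous_on has_derivative_continuous smooth_has_derivative)

lemma smooth_measurable: "smooth f \<Longrightarrow> f \<in> borel_measurable borel"
  by (simp add: borel_measurable_continuous_onI smooth_continuous)

text \<open>The algebra generated by all smooth functions and the compositions \<open>D n \<circ> q\<close>. When \<open>D\<close> lists the
successive derivatives of a function on the line, the chain rule and the Leibniz rule keep this
algebra closed under differentiation. With \<open>D = 0\<close> it yields sums and products of smooth functions.\<close>

inductive_set comp_algebra :: "(nat \<Rightarrow> real \<Rightarrow> real) \<Rightarrow> (phase \<Rightarrow> real) \<Rightarrow> (phase \<Rightarrow> complex) set"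
  for D :: "nat \<Rightarrow> real \<Rightarrow> real" and q :: "phase \<Rightarrow> real" where
  base: "smooth f \<Longrightarrow> f \<in> comp_algebra D q"
| comp: "(\<lambda>X. of_real (D n (q X))) \<in> comp_algebra D q"
| add: "\<lbrakk>f \<in> comp_algebra D q; h \<in> comp_algebra D q\<rbrakk> \<Longrightarrow> (\<lambda>X. f X + h X) \<in> comp_algebra D q"
| mult: "\<lbrakk>f \<in> comp_algebra D q; h \<in> comp_algebra D q\<rbrakk> \<Longrightarrow> (\<lambda>X. f X * h X) \<in> comp_algebra D q"

text \<open>The directional derivative of a real function, viewed as complex valued, is again real; this is
extracted from uniqueness of the derivative.\<close>

lemma has_derivative_comp_of_real:
  assumes D: "(d has_real_derivative d') (at (q X))" and q: "smooth (\<lambda>X. of_real (q X))"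
  shows "((\<lambda>X. complex_of_real (d (q X))) has_derivative
            (\<lambda>e. of_real d' * dir_deriv e (\<lambda>X. of_real (q X)) X)) (at X)"
proof -
  define Q where "Q = (\<lambda>e. dir_deriv e (\<lambda>X. complex_of_real (q X)) X)"
  have Q: "((\<lambda>X. complex_of_real (q X)) has_derivative Q) (at X)"
    unfolding Q_def by (rule smooth_has_derivative[OF q])
  from bounded_linear.has_derivative[OF bounded_linear_Re this]
  have q': "(q has_derivative (\<lambda>e. Re (Q e))) (at X)" by simp
  then have "((\<lambda>X. complex_of_real (q X)) has_derivative (\<lambda>e. of_real (Re (Q e)))) (at X)"
    by (rule has_derivative_of_real)
  with Q have QQ: "Q = (\<lambda>e. of_real (Re (Q e)))" by (rule has_derivative_unique)
  have "((\<lambda>X. d (q X)) has_derivative (\<lambda>e. d' * Re (Q e))) (at X)"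
    using has_derivative_compose[OF q'] D unfolding has_field_derivative_def by (auto simp: mult.commute)
  from has_derivative_of_real[OF this, where 'a = complex]
  have "((\<lambda>X. complex_of_real (d (q X))) has_derivative (\<lambda>e. of_real (d' * Re (Q e)))) (at X)" .
  also have "(\<lambda>e. complex_of_real (d' * Re (Q e))) = (\<lambda>e. of_real d' * Q e)"
    by (subst (2) QQ) simp
  finally show ?thesis unfolding Q_def .
qed

lemma comp_algebra_closed:
  assumes D: "\<And>n t. (D n has_real_derivative D (Suc n) t) (at t)" and q: "smooth (\<lambda>X. of_real (q X))"
    and f: "f \<in> comp_algebra D q"
  shows "f differentiable (at p) \<and> dir_deriv e f \<in> comp_algebra D q"
  using f
proof (induction arbitrary: p e)
  case (base f)
  then show ?case
    by (meson comp_algebra.base differentiable_def smooth_dir_deriv smooth_has_derivative)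
next
  case (comp n)
  note d = has_derivative_comp_of_real[OF D q]
  have "dir_deriv e (\<lambda>X. complex_of_real (D n (q X))) =
      (\<lambda>X. of_real (D (Suc n) (q X)) * dir_deriv e (\<lambda>X. of_real (q X)) X)"
    using dir_deriv_eqI[OF d] by blast
  also have "\<dots> \<in> comp_algebra D q"
    by (intro comp_algebra.mult comp_algebra.comp comp_algebra.base smooth_dir_deriv q)
  finally show ?case using d unfolding differentiable_def by blast
next
  case (add f h)
  have d: "((\<lambda>X. f X + h X) has_derivative (\<lambda>e. dir_deriv e f p + dir_deriv e h p)) (at p)" for p
    unfolding dir_deriv_def using add.IH by (intro has_derivative_add) (simp_all flip: frechet_derivative_works)
  have "dir_deriv e (\<lambda>X. f X + h X) = (\<lambda>p. dir_deriv e f p + dir_deriv e h p)"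
    using dir_deriv_eqI[OF d] by blast
  also have "\<dots> \<in> comp_algebra D q" using add by (intro comp_algebra.add) auto
  finally show ?case using d unfolding differentiable_def by blast
next
  case (mult f h)
  have d: "((\<lambda>X. f X * h X) has_derivative (\<lambda>e. f p * dir_deriv e h p + dir_deriv e f p * h p)) (at p)" for p
    unfolding dir_deriv_def using mult.IH by (intro has_derivative_mult) (simp_all flip: frechet_derivative_works)
  have "dir_deriv e (\<lambda>X. f X * h X) = (\<lambda>p. f p * dir_deriv e h p + dir_deriv e f p * h p)"
    using dir_deriv_eqI[OF d] by blast
  also have "\<dots> \<in> comp_algebra D q"
    using mult by (intro comp_algebra.add comp_algebra.mult) auto
  finally show ?case using d unfolding differentiable_def by blast
qed

lemma smooth_compose:
  assumes "\<And>n t. (D n has_real_derivative D (Suc n) t) (at t)" "smooth (\<lambda>X. of_real (q X))"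
  shows "smooth (\<lambda>X. of_real (D n (q X)))"
  by (rule smooth_coinduct[of _ "comp_algebra D q"])
     (use comp_algebra_closed[of D q, OF assms] in \<open>auto intro: comp_algebra.comp\<close>)

lemma dir_deriv_const: "dir_deriv e (\<lambda>X. c) = (\<lambda>X. 0)"
  by (rule ext, rule dir_deriv_eqI) (rule has_derivative_const)

lemma smooth_const: "smooth (\<lambda>X. c)"
  by (rule smooth_coinduct[of _ "range (\<lambda>c X. c)"]) (auto simp: dir_deriv_const)

lemma dir_deriv_linear: "bounded_linear f \<Longrightarrow> dir_deriv e f = (\<lambda>X. f e)"
  by (rule ext, rule dir_deriv_eqI) (rule bounded_linear_imp_has_derivative)

lemma smooth_linear: "bounded_linear f \<Longrightarrow> smooth f"
  by (rule smooth_coinduct[of _ "insert f (range (\<lambda>c X. c))"])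
     (auto simp: dir_deriv_const dir_deriv_linear intro: bounded_linear_imp_differentiable)

lemma smooth_add: "smooth f \<Longrightarrow> smooth h \<Longrightarrow> smooth (\<lambda>X. f X + h X)"
  and smooth_mult: "smooth f \<Longrightarrow> smooth h \<Longrightarrow> smooth (\<lambda>X. f X * h X)"
proof -
  have q: "smooth (\<lambda>X. complex_of_real 0)" by (rule smooth_const)
  \<comment> \<open>With \<open>D = 0\<close> and \<open>q = 0\<close> the generators \<open>D n \<circ> q\<close> are zero.\<close>
  note cl = comp_algebra_closed[of "\<lambda>n t. 0" "\<lambda>X. 0", OF _ q]
  have sm: "smooth f" if "f \<in> comp_algebra (\<lambda>n t. 0) (\<lambda>X. 0)" for f
    by (rule smooth_coinduct[OF that]) (use cl in auto)
  show "smooth f \<Longrightarrow> smooth h \<Longrightarrow> smooth (\<lambda>X. f X + h X)"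
    by (rule sm, rule comp_algebra.add; rule comp_algebra.base)
  show "smooth f \<Longrightarrow> smooth h \<Longrightarrow> smooth (\<lambda>X. f X * h X)"
    by (rule sm, rule comp_algebra.mult; rule comp_algebra.base)
qed

lemma smooth_sum: "(\<And>i. i \<in> I \<Longrightarrow> smooth (f i)) \<Longrightarrow> smooth (\<lambda>X. \<Sum>i\<in>I. f i X)"
  by (induction I rule: infinite_finite_induct) (auto intro: smooth_const smooth_add)

lemma smooth_power: "smooth f \<Longrightarrow> smooth (\<lambda>X. f X ^ n)"
  by (induction n) (auto intro: smooth_const smooth_mult)

lemma smooth_minus: "smooth f \<Longrightarrow> smooth (\<lambda>X. - f X)"
  using smooth_mult[OF smooth_const[of "-1"], of f] by simp

lemma smooth_diff: "smooth f \<Longrightarrow> smooth h \<Longrightarrow> smooth (\<lambda>X. f X - h X)"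
  using smooth_add[OF _ smooth_minus, of f h] by simp

lemma dir_deriv_add:
  "smooth f \<Longrightarrow> smooth h \<Longrightarrow> dir_deriv e (\<lambda>X. f X + h X) = (\<lambda>X. dir_deriv e f X + dir_deriv e h X)"
  by (rule ext, rule dir_deriv_eqI) (intro has_derivative_add smooth_has_derivative)

lemma dir_deriv_mult:
  "smooth f \<Longrightarrow> smooth h \<Longrightarrow>
    dir_deriv e (\<lambda>X. f X * h X) = (\<lambda>X. dir_deriv e f X * h X + f X * dir_deriv e h X)"
  by (rule ext, subst add.commute, rule dir_deriv_eqI) (intro has_derivative_mult smooth_has_derivative)

lemma dir_deriv_cmult:
  "smooth f \<Longrightarrow> dir_deriv e (\<lambda>X. c * f X) = (\<lambda>X. c * dir_deriv e f X)"
  using dir_deriv_mult[OF smooth_const, of f e c] by (simp add: dir_deriv_const)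

lemma dir_deriv_minus:
  "smooth f \<Longrightarrow> dir_deriv e (\<lambda>X. - f X) = (\<lambda>X. - dir_deriv e f X)"
  using dir_deriv_cmult[of f e "-1"] by simp

lemma dir_deriv_power:
  assumes "smooth f"
  shows "dir_deriv e (\<lambda>X. f X ^ n) = (\<lambda>X. of_nat n * f X ^ (n - 1) * dir_deriv e f X)"
proof (induction n)
  case (Suc n)
  have "dir_deriv e (\<lambda>X. f X ^ Suc n) = (\<lambda>X. dir_deriv e f X * f X ^ n + f X * (of_nat n * f X ^ (n - 1) * dir_deriv e f X))"
    using dir_deriv_mult[OF assms smooth_power[OF assms], of e n] by (simp add: Suc)
  also have "\<dots> = (\<lambda>X. of_nat (Suc n) * f X ^ (Suc n - 1) * dir_deriv e f X)"
    by (cases n) (auto simp: algebra_simps)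
  finally show ?case .
qed (simp add: dir_deriv_const)

lemma dir_deriv_compose:
  assumes "\<And>t. (d has_real_derivative d' t) (at t)" "smooth (\<lambda>X. of_real (q X))"
  shows "dir_deriv e (\<lambda>X. of_real (d (q X))) = (\<lambda>X. of_real (d' (q X)) * dir_deriv e (\<lambda>X. of_real (q X)) X)"
  using dir_deriv_eqI[OF has_derivative_comp_of_real[OF assms(1) assms(2)]] by blast

lemma smooth_inner: "smooth (\<lambda>X. of_real (X \<bullet> Y))"
  by (intro smooth_linear bounded_linear_compose[OF bounded_linear_of_real] bounded_linear_inner_left)

lemma dir_deriv_inner: "dir_deriv e (\<lambda>X. of_real (X \<bullet> Y)) = (\<lambda>X. of_real (e \<bullet> Y))"
  by (intro dir_deriv_linear bounded_linear_compose[OF bounded_linear_of_real] bounded_linear_inner_left)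

lemma smooth_inner_self: "smooth (\<lambda>X. of_real (X \<bullet> X))"
proof -
  have eq: "(\<lambda>X::phase. complex_of_real (X \<bullet> X)) = (\<lambda>X. \<Sum>b\<in>Basis. of_real (X \<bullet> b) * of_real (X \<bullet> b))"
    by (subst euclidean_inner) simp
  show ?thesis unfolding eq by (intro smooth_sum smooth_mult smooth_inner)
qed

lemma dir_deriv_inner_self: "dir_deriv e (\<lambda>X. of_real (X \<bullet> X)) = (\<lambda>X. of_real (2 * (X \<bullet> e)))"
proof (rule ext, rule dir_deriv_eqI)
  fix X :: phase
  have "((\<lambda>X::phase. X \<bullet> X) has_derivative (\<lambda>e. 2 * (X \<bullet> e))) (at X)"
    by (auto intro!: derivative_eq_intros simp: inner_commute)
  then show "((\<lambda>X. complex_of_real (X \<bullet> X)) has_derivative (\<lambda>e. complex_of_real (2 * (X \<bullet> e)))) (at X)"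
    by (rule has_derivative_of_real)
qed

definition gauss :: "phase \<Rightarrow> complex" where
  "gauss X = of_real (exp (- (X \<bullet> X) / 2))"

lemma smooth_quadratic: "smooth (\<lambda>X. complex_of_real (\<alpha> + \<beta> * (X \<bullet> X)))"
  using smooth_add[OF smooth_const[of "of_real \<alpha>"] smooth_mult[OF smooth_const[of "of_real \<beta>"] smooth_inner_self]] by simp

lemma dir_deriv_quadratic:
  "dir_deriv e (\<lambda>X. complex_of_real (\<alpha> + \<beta> * (X \<bullet> X))) = (\<lambda>X. of_real (2 * \<beta> * (X \<bullet> e)))"
proof -
  have eq: "(\<lambda>X::phase. complex_of_real (\<alpha> + \<beta> * (X \<bullet> X))) = (\<lambda>X. of_real \<alpha> + of_real \<beta> * of_real (X \<bullet> X))"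
    by simp
  show ?thesis
    unfolding eq dir_deriv_add[OF smooth_const smooth_mult[OF smooth_const smooth_inner_self]]
      dir_deriv_const dir_deriv_cmult[OF smooth_inner_self] dir_deriv_inner_self by (simp add: mult_ac)
qed

lemma gauss_eq: "gauss = (\<lambda>X. complex_of_real (exp (0 + (- 1/2) * (X \<bullet> X))))"
  by (simp add: gauss_def fun_eq_iff)

lemma smooth_gauss: "smooth gauss"
  unfolding gauss_eq by (rule smooth_compose[where D = "\<lambda>n. exp", OF DERIV_exp smooth_quadratic])

lemma dir_deriv_gauss: "dir_deriv e gauss = (\<lambda>X. - of_real (X \<bullet> e) * gauss X)"
  unfolding gauss_eq dir_deriv_compose[OF DERIV_exp smooth_quadratic] dir_deriv_quadratic
  by (simp add: fun_eq_iff)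

section \<open>A smooth radial cutoff\<close>

text \<open>Functions \<open>P(1/t) exp(-1/t)\<close> extended by zero to \<open>t \<le> 0\<close>. The class is closed under
differentiation, which makes the standard flat function smooth.\<close>

definition flat_poly :: "real poly \<Rightarrow> real \<Rightarrow> real" where
  "flat_poly p t = (if t > 0 then poly p (inverse t) * exp (- inverse t) else 0)"

lemma flat_poly_tendsto_0: "(flat_poly p \<longlongrightarrow> 0) (at 0)"
proof -
  have "((\<lambda>u. \<Sum>i\<le>degree p. coeff p i * (u ^ i / exp u)) \<longlongrightarrow> (\<Sum>i\<le>degree p. coeff p i * 0)) at_top"
    by (intro tendsto_sum tendsto_mult tendsto_const tendsto_power_div_exp_0)
  then have "((\<lambda>u. poly p u * exp (- u)) \<longlongrightarrow> 0) at_top"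
    by (simp add: poly_altdef sum_distrib_right exp_minus divide_inverse mult.assoc)
  from filterlim_compose[OF this filterlim_inverse_at_top_right]
  have "((\<lambda>t. poly p (inverse t) * exp (- inverse t)) \<longlongrightarrow> 0) (at_right 0)" .
  moreover have "\<forall>\<^sub>F t in at_right 0. flat_poly p t = poly p (inverse t) * exp (- inverse t)"
    by (auto simp: eventually_at_filter flat_poly_def)
  ultimately have "(flat_poly p \<longlongrightarrow> 0) (at_right 0)" by (simp cong: filterlim_cong add: tendsto_cong)
  moreover have "\<forall>\<^sub>F t in at_left 0. flat_poly p t = 0"
    by (auto simp: eventually_at_filter flat_poly_def)
  then have "(flat_poly p \<longlongrightarrow> 0) (at_left 0)" by (simp add: tendsto_cong)
  ultimately show ?thesis by (simp add: filterlim_split_at)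
qed

text \<open>At the origin the difference quotient is again of the form \<open>flat_poly\<close>, with \<open>P\<close> multiplied by the
variable, so the derivative there is the limit computed above.\<close>

lemma flat_poly_has_derivative:
  "(flat_poly p has_real_derivative flat_poly ([:0, 0, 1:] * (p - pderiv p)) t) (at t)"
proof (cases t "0 :: real" rule: linorder_cases)
  case less
  have "((\<lambda>t. 0) has_real_derivative 0) (at t)" by simp
  then show ?thesis
    using less
    by (auto simp: flat_poly_def intro!: has_field_derivative_transform_within_open[of "\<lambda>t. 0" _ _ "{..<0}" "flat_poly p"])
next
  case greater
  have "((\<lambda>t. poly p (inverse t) * exp (- inverse t)) has_real_derivative
     flat_poly ([:0, 0, 1:] * (p - pderiv p)) t) (at t)"
    using greater
    by (auto intro!: derivative_eq_intros poly_DERIV[THEN DERIV_chain2] simp: flat_poly_def algebra_simps power2_eq_square)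
  then show ?thesis
    using greater
    by (rule_tac has_field_derivative_transform_within_open[of _ _ _ "{0<..}"]) (auto simp: flat_poly_def)
next
  case equal
  have "(\<lambda>h. (flat_poly p (0 + h) - flat_poly p 0) / h) = flat_poly ([:0, 1:] * p)"
    by (auto simp: flat_poly_def fun_eq_iff field_simps)
  then show ?thesis
    using flat_poly_tendsto_0[of "[:0,1:] * p"] by (simp add: equal DERIV_def) (simp add: flat_poly_def)
qed

lemma flat_poly_bounded: "\<exists>B. \<forall>t\<le>1. \<bar>flat_poly p t\<bar> \<le> B"
proof -
  have "compact (flat_poly p ` {0..1})"
    by (intro compact_continuous_image compact_Icc)
       (meson DERIV_isCont continuous_at_imp_continuous_on flat_poly_has_derivative)
  then obtain B where B: "\<And>t. t \<in> {0..1} \<Longrightarrow> \<bar>flat_poly p t\<bar> \<le> B"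
    using compact_imp_bounded[THEN bounded_iff[THEN iffD1]] by (metis imageI real_norm_def)
  have "\<bar>flat_poly p t\<bar> \<le> B" if "t \<le> 1" for t
    using B[of t] B[of 0] that by (cases "t \<ge> 0") (auto simp: flat_poly_def)
  then show ?thesis by blast
qed

text \<open>The constant \<open>e\<close> normalises the flat function to take the value 1 at \<open>t = 1\<close>; \<open>bump n\<close> is its
derivative of order \<open>n\<close>.\<close>

primrec bump_poly :: "nat \<Rightarrow> real poly" where
  "bump_poly 0 = [:exp 1:]"
| "bump_poly (Suc n) = [:0, 0, 1:] * (bump_poly n - pderiv (bump_poly n))"

abbreviation bump :: "nat \<Rightarrow> real \<Rightarrow> real" where
  "bump n \<equiv> flat_poly (bump_poly n)"

lemma bump_has_derivative: "(bump n has_real_derivative bump (Suc n) t) (at t)"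
  using flat_poly_has_derivative[of "bump_poly n" t] by simp

lemma bump_0_1: "bump 0 1 = 1" by (simp add: flat_poly_def exp_minus)

text \<open>A radial function supported in the ball of radius \<open>1 / sqrt \<epsilon>\<close>. It is nowhere locally constant near the
origin, but as \<open>\<epsilon>\<close> tends to 0 it tends to 1 pointwise and its derivatives tend to 0, with bounds of
polynomial growth uniform in \<open>\<epsilon> \<le> 1\<close>, which is what dominated convergence asks for.\<close>

definition cutoff :: "real \<Rightarrow> phase \<Rightarrow> complex" where
  "cutoff \<epsilon> X = of_real (bump 0 (1 + (- \<epsilon>) * (X \<bullet> X)))"

lemma smooth_cutoff: "smooth (cutoff \<epsilon>)"
  unfolding cutoff_def by (rule smooth_compose[where D = bump, OF bump_has_derivative smooth_quadratic])

lemma dir_deriv_bump: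
  "dir_deriv e (\<lambda>X. of_real (bump n (1 + (- \<epsilon>) * (X \<bullet> X)))) =
    (\<lambda>X. of_real (bump (Suc n) (1 + (- \<epsilon>) * (X \<bullet> X)) * (- 2 * \<epsilon> * (X \<bullet> e))))"
  using dir_deriv_compose[OF bump_has_derivative smooth_quadratic, of e n 1 "-\<epsilon>"] unfolding dir_deriv_quadratic by simp

section \<open>Square integrability of Gaussian weights\<close>

lemma integrable_gaussian_real:
  assumes "c > 0" shows "integrable lborel (\<lambda>x::real. exp (- (c * x\<^sup>2)))"
proof -
  \<comment> \<open>The standard deviation for which the normal density has exponent \<open>- c x\<^sup>2\<close>.\<close>
  define d where "d = sqrt (1 / (2 * c))"
  have s: "2 * d\<^sup>2 = 1 / c" using assms by (simp add: d_def)
  have "integrable lborel (\<lambda>x. sqrt (pi / c) * normal_density 0 d x)"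
    by (intro integrable_mult_right integrable_normal_density) (use assms in \<open>simp add: d_def\<close>)
  also have "(\<lambda>x. sqrt (pi / c) * normal_density 0 d x) = (\<lambda>x::real. exp (- (c * x\<^sup>2)))"
  proof
    fix x :: real
    have "2 * pi * d\<^sup>2 = pi / c" using s by (simp add: field_simps)
    then show "sqrt (pi / c) * normal_density 0 d x = exp (- (c * x\<^sup>2))"
      using assms by (simp add: normal_density_def s mult.commute)
  qed
  finally show ?thesis .
qed

text \<open>The Gaussian is a product of functions of the single coordinates.\<close>

lemma integrable_gaussian:
  assumes "c > 0" shows "integrable lborel (\<lambda>X::'a::euclidean_space. exp (- (c * (X \<bullet> X))))"
proof (rule integrableI_bounded)
  have eq: "ennreal (norm (exp (- (c * (X \<bullet> X))))) = (\<Prod>b\<in>Basis. ennreal (exp (- (c * (X \<bullet> b)\<^sup>2))))" for X :: 'a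
    by (subst euclidean_inner) (simp add: prod_ennreal exp_sum sum_distrib_left sum_negf power2_eq_square flip: exp_sum)
  have "nn_integral lborel (\<lambda>X::'a. ennreal (norm (exp (- (c * (X \<bullet> X))))))
      = (\<Prod>b\<in>(Basis::'a set). (\<integral>\<^sup>+x. ennreal (exp (- (c * x\<^sup>2))) \<partial>lborel))"
    unfolding eq by (rule nn_integral_lborel_prod) auto
  also have "\<dots> < \<infinity>"
    using integrable_gaussian_real[OF assms] 
    by (simp add: integrable_iff_bounded power_less_top_ennreal)
  finally show "nn_integral lborel (\<lambda>X::'a. ennreal (norm (exp (- (c * (X \<bullet> X)))))) < \<infinity>" .
qed auto

lemma L2_mult_integrable:
  assumes "u \<in> L2" "v \<in> L2" shows "integrable lborel (\<lambda>p. u p * v p)"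
proof (rule Bochner_Integration.integrable_bound)
  show "integrable lborel (\<lambda>p. (cmod (u p))\<^sup>2 + (cmod (v p))\<^sup>2)"
    using assms by (auto simp: L2_def)
  show "(\<lambda>p. u p * v p) \<in> borel_measurable lborel"
    using assms by (auto simp: L2_def)
  have "x * y \<le> x\<^sup>2 + y\<^sup>2" if "x \<ge> 0" "y \<ge> 0" for x y :: real
    using sum_squares_bound[of x y] mult_nonneg_nonneg[OF that] by linarith
  then show "AE p in lborel. norm (u p * v p) \<le> norm ((cmod (u p))\<^sup>2 + (cmod (v p))\<^sup>2)"
    by (auto simp: norm_mult)
qed

lemma L2_bound:
  assumes "v \<in> L2" "u \<in> borel_measurable borel" "\<And>p. cmod (u p) \<le> C * cmod (v p)"
  shows "u \<in> L2"
proof -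
  have "integrable lborel (\<lambda>p. (cmod (u p))\<^sup>2)"
  proof (rule Bochner_Integration.integrable_bound)
    show "integrable lborel (\<lambda>p. C\<^sup>2 * (cmod (v p))\<^sup>2)"
      using assms by (auto simp: L2_def)
    show "AE p in lborel. norm ((cmod (u p))\<^sup>2) \<le> norm (C\<^sup>2 * (cmod (v p))\<^sup>2)"
      using assms(3) by (auto simp flip: power_mult_distrib intro!: power_mono)
  qed (use assms in auto)
  then show ?thesis using assms by (simp add: L2_def)
qed

lemma L2_cmult: "u \<in> L2 \<Longrightarrow> (\<lambda>p. c * u p) \<in> L2"
  by (rule L2_bound[of u _ "cmod c"]) (auto simp: L2_def norm_mult)

text \<open>At most exponential growth is the class of weights used against the Gaussian: it contains the
polynomials, is closed under sums and products, and contains the majorant \<open>exp \<bar>t\<bar>\<close> of the partial sums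
of the sine series, which polynomial growth would not.\<close>

definition exp_growth :: "(phase \<Rightarrow> complex) \<Rightarrow> bool" where
  "exp_growth f \<longleftrightarrow> f \<in> borel_measurable borel \<and> (\<exists>C N. \<forall>X. cmod (f X) \<le> C * exp (N * norm X))"

lemma exp_growthE:
  assumes "exp_growth f"
  obtains C N where "C \<ge> 0" "N \<ge> 0" "\<And>X. cmod (f X) \<le> C * exp (N * norm X)"
proof -
  obtain C N where C: "\<And>X. cmod (f X) \<le> C * exp (N * norm X)"
    using assms by (auto simp: exp_growth_def)
  have "cmod (f X) \<le> max C 0 * exp (max N 0 * norm X)" for X
    by (rule order.trans[OF C]) (auto intro!: mult_mono mult_right_mono)
  then show ?thesis using that[of "max C 0" "max N 0"] by auto
qed

lemma exp_growth_measurable: "exp_growth f \<Longrightarrow> f \<in> borel_measurable borel"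
  by (simp add: exp_growth_def)

lemma exp_growth_const: "exp_growth (\<lambda>X. c)"
  unfolding exp_growth_def by (intro conjI exI[of _ "cmod c"] exI[of _ 0]) auto

lemma exp_growth_linear:
  assumes "bounded_linear f" shows "exp_growth f"
proof -
  from assms obtain K where K: "K > 0" "\<And>X. cmod (f X) \<le> norm X * K"
    using bounded_linear.pos_bounded by blast
  have "cmod (f X) \<le> K * exp (1 * norm X)" for X
  proof -
    have "cmod (f X) \<le> K * norm X" using K(2)[of X] by (simp add: mult.commute)
    also have "norm X \<le> exp (norm X)" using exp_ge_add_one_self[of "norm X"] by linarith
    finally show ?thesis using K(1) by simp
  qed
  moreover have "f \<in> borel_measurable borel"
    using assms by (simp add: borel_measurable_continuous_onI linear_continuous_on)
  ultimately show ?thesis unfolding exp_growth_def by blast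
qed

lemma exp_growth_add:
  assumes "exp_growth f" "exp_growth h" shows "exp_growth (\<lambda>X. f X + h X)"
proof -
  obtain C N where f: "C \<ge> 0" "N \<ge> 0" "\<And>X. cmod (f X) \<le> C * exp (N * norm X)" using exp_growthE[OF assms(1)] by blast
  obtain D M where h: "D \<ge> 0" "M \<ge> 0" "\<And>X. cmod (h X) \<le> D * exp (M * norm X)" using exp_growthE[OF assms(2)] by blast
  have "cmod (f X + h X) \<le> (C + D) * exp (max N M * norm X)" for X
  proof -
    have "cmod (f X + h X) \<le> C * exp (N * norm X) + D * exp (M * norm X)"
      using norm_triangle_ineq[of "f X" "h X"] f(3)[of X] h(3)[of X] by linarith
    also have "\<dots> \<le> C * exp (max N M * norm X) + D * exp (max N M * norm X)"
      using f h by (intro add_mono mult_left_mono) (auto intro!: mult_right_mono)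
    finally show ?thesis by (simp add: algebra_simps)
  qed
  then have "\<exists>C N. \<forall>X. cmod (f X + h X) \<le> C * exp (N * norm X)" by blast
  then show ?thesis using assms unfolding exp_growth_def by auto
qed

lemma exp_growth_mult:
  assumes "exp_growth f" "exp_growth h" shows "exp_growth (\<lambda>X. f X * h X)"
proof -
  obtain C N where f: "C \<ge> 0" "N \<ge> 0" "\<And>X. cmod (f X) \<le> C * exp (N * norm X)" using exp_growthE[OF assms(1)] by blast
  obtain D M where h: "D \<ge> 0" "M \<ge> 0" "\<And>X. cmod (h X) \<le> D * exp (M * norm X)" using exp_growthE[OF assms(2)] by blast
  have "cmod (f X * h X) \<le> (C * D) * exp ((N + M) * norm X)" for X
  proof -
    have "cmod (f X * h X) \<le> (C * exp (N * norm X)) * (D * exp (M * norm X))"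
      unfolding norm_mult using f(1) h(1) by (intro mult_mono f(3) h(3)) auto
    then show ?thesis by (simp add: algebra_simps exp_add)
  qed
  then have "\<exists>C N. \<forall>X. cmod (f X * h X) \<le> C * exp (N * norm X)" by blast
  then show ?thesis using assms unfolding exp_growth_def by auto
qed

lemma exp_growth_power: "exp_growth f \<Longrightarrow> exp_growth (\<lambda>X. f X ^ n)"
  by (induction n) (auto intro: exp_growth_const exp_growth_mult)

lemma gauss_measurable [measurable]: "gauss \<in> borel_measurable borel"
  by (rule smooth_measurable[OF smooth_gauss])

text \<open>Completing the square, \<open>N r - r\<^sup>2 / 2 \<le> N\<^sup>2 - r\<^sup>2 / 4\<close>.\<close>

lemma exp_growth_gauss_L2:
  assumes "exp_growth f" shows "(\<lambda>X. f X * gauss X) \<in> L2"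
proof -
  obtain C N where f: "C \<ge> 0" "N \<ge> 0" "\<And>X. cmod (f X) \<le> C * exp (N * norm X)" using exp_growthE[OF assms(1)] by blast
  \<comment> \<open>Half of the exponent is given up to absorb the exponential growth.\<close>
  define G where "G = (\<lambda>X::phase. complex_of_real (exp (- ((1/4) * (X \<bullet> X)))))"
  have "(cmod (G X))\<^sup>2 = exp (- ((1/2) * (X \<bullet> X)))" for X
    by (simp add: G_def power2_eq_square flip: exp_add)
  then have G: "G \<in> L2"
    using integrable_gaussian[of "1/2", where 'a = phase] by (simp add: L2_def) (simp add: G_def)
  have bound: "cmod (f X * gauss X) \<le> (C * exp (N\<^sup>2)) * cmod (G X)" for X
  proof -
    have "0 \<le> (norm X / 2 - N)\<^sup>2" by simp
    then have "N * norm X - (X \<bullet> X) / 2 \<le> N\<^sup>2 - (1/4) * (X \<bullet> X)"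
      by (simp add: power2_eq_square algebra_simps dot_square_norm)
    then have "exp (N * norm X - (X \<bullet> X) / 2) \<le> exp (N\<^sup>2 - (1/4) * (X \<bullet> X))" by simp
    then have "C * (exp (N * norm X) * exp (- (X \<bullet> X) / 2)) \<le> C * (exp (N\<^sup>2) * exp (- ((1/4) * (X \<bullet> X))))"
      using f(1) by (intro mult_left_mono) (simp_all flip: exp_add)
    moreover have "cmod (f X * gauss X) \<le> (C * exp (N * norm X)) * exp (- (X \<bullet> X) / 2)"
      using f(3)[of X] by (simp add: norm_mult gauss_def)
    ultimately show ?thesis by (simp add: G_def mult.assoc)
  qed
  from G _ bound show ?thesis
    by (rule L2_bound) (use exp_growth_measurable[OF assms] in auto)
qed

section \<open>Test functions and integration by parts\<close>

lemma test_functionI: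
  assumes "smooth \<phi>" "bounded {p. \<phi> p \<noteq> 0}" shows "\<phi> \<in> test_functions"
  using assms by (simp add: test_functions_def compact_closure)

lemma test_function_smooth: "\<phi> \<in> test_functions \<Longrightarrow> smooth \<phi>"
  by (simp add: test_functions_def)

lemma test_function_supp:
  assumes "\<phi> \<in> test_functions" obtains R :: real where "R > 0" "\<And>p. norm p > R \<Longrightarrow> \<phi> p = 0"
proof -
  have "bounded {p. \<phi> p \<noteq> 0}"
    using assms by (simp add: test_functions_def compact_closure)
  then obtain R where "R > 0" "\<And>p. \<phi> p \<noteq> 0 \<Longrightarrow> norm p \<le> R"
    unfolding bounded_pos by blast
  then show ?thesis using that by (metis not_less)
qed

text \<open>Outside a ball the function vanishes on an open set, and so does its derivative.\<close>

lemma test_function_dir_deriv: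
  assumes "\<phi> \<in> test_functions" shows "dir_deriv e \<phi> \<in> test_functions"
proof (rule test_functionI)
  show "smooth (dir_deriv e \<phi>)" using assms by (intro smooth_dir_deriv test_function_smooth)
  obtain R where R: "R > 0" "\<And>p. norm p > R \<Longrightarrow> \<phi> p = 0" using test_function_supp[OF assms] by blast
  have out: "dir_deriv e \<phi> p = 0" if "norm p > R" for p
  proof -
    have "open {p::phase. norm p > R}" by (intro open_Collect_less continuous_intros)
    then have "(\<phi> has_derivative (\<lambda>_. 0)) (at p)"
      by (rule has_derivative_transform_within_open[OF has_derivative_const])
         (use that R(2) in auto)
    then show ?thesis by (rule dir_deriv_eqI)
  qed
  then show "bounded {p. dir_deriv e \<phi> p \<noteq> 0}"
    unfolding bounded_iff using out by (metis (mono_tags, lifting) mem_Collect_eq not_less)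
qed

lemma test_function_mult:
  assumes "smooth f" "\<phi> \<in> test_functions" shows "(\<lambda>p. f p * \<phi> p) \<in> test_functions"
proof (rule test_functionI)
  show "smooth (\<lambda>p. f p * \<phi> p)" using assms by (simp add: smooth_mult test_function_smooth)
  have "bounded {p. \<phi> p \<noteq> 0}"
    using assms by (simp add: test_functions_def compact_closure)
  then show "bounded {p. f p * \<phi> p \<noteq> 0}" by (rule bounded_subset) auto
qed

lemma test_function_add:
  assumes "f \<in> test_functions" "\<phi> \<in> test_functions" shows "(\<lambda>p. f p + \<phi> p) \<in> test_functions"
proof (rule test_functionI)
  show "smooth (\<lambda>p. f p + \<phi> p)" using assms by (intro smooth_add test_function_smooth)
  have "bounded ({p. \<phi> p \<noteq> 0} \<union> {p. f p \<noteq> 0})"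
    using assms by (simp add: test_functions_def compact_closure)
  then show "bounded {p. f p + \<phi> p \<noteq> 0}" by (rule bounded_subset) auto
qed

lemma compact_support_integrable:
  fixes f :: "phase \<Rightarrow> 'b::{banach, second_countable_topology}"
  assumes "continuous_on UNIV f" "\<And>p. norm p > R \<Longrightarrow> f p = 0"
  shows "integrable lborel f"
proof -
  have "integrable lborel (\<lambda>p. indicator (cball 0 R) p *\<^sub>R f p)"
    using assms(1) by (intro borel_integrable_compact compact_cball) (auto intro: continuous_on_subset)
  also have "(\<lambda>p. indicator (cball 0 R) p *\<^sub>R f p) = f"
    using assms(2) by (auto simp: fun_eq_iff indicator_def not_le)
  finally show ?thesis .
qed

lemma test_function_integrable:
  assumes "\<phi> \<in> test_functions" shows "integrable lborel \<phi>"
  by (rule test_function_supp[OF assms], rule compact_support_integrable)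
     (use assms in \<open>auto intro!: smooth_continuous test_function_smooth\<close>)

lemma test_function_L2:
  assumes "\<phi> \<in> test_functions" shows "\<phi> \<in> L2"
proof -
  have "integrable lborel (\<lambda>p. (cmod (\<phi> p))\<^sup>2)"
    by (rule test_function_supp[OF assms], rule compact_support_integrable)
     (use assms in \<open>auto intro!: continuous_intros smooth_continuous test_function_smooth\<close>)
  then show ?thesis
    using smooth_measurable[OF test_function_smooth[OF assms]] by (simp add: L2_def)
qed

text \<open>By translation invariance all difference quotients of \<open>\<phi>\<close> have integral zero. They are bounded by
the supremum of the derivative and supported in a common ball, so the limit may be taken under the
integral.\<close>

lemma integral_dir_deriv_test_function:
  assumes "\<phi> \<in> test_functions" shows "(\<integral>p. dir_deriv e \<phi> p \<partial>lborel) = 0"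
proof -
  obtain R where R: "R > 0" "\<And>p. norm p > R \<Longrightarrow> \<phi> p = 0" using test_function_supp[OF assms] by blast
  define t where "t = (\<lambda>n. inverse (real (Suc n)))"
  define g where "g = (\<lambda>n p. (\<phi> (t n *\<^sub>R e + p) - \<phi> p) /\<^sub>R t n)"
  have smooth: "smooth \<phi>" by (rule test_function_smooth[OF assms])
  have meas [measurable]: "\<phi> \<in> borel_measurable borel" "dir_deriv e \<phi> \<in> borel_measurable borel"
    by (intro smooth_measurable smooth smooth_dir_deriv)+
  have t: "t n > 0" "t n \<le> 1" for n by (auto simp: t_def field_simps)
  have t0: "t \<longlonglongrightarrow> 0" unfolding t_def by (rule LIMSEQ_inverse_real_of_nat)
  have line: "((\<lambda>h. \<phi> (h *\<^sub>R e + p)) has_derivative (\<lambda>s. s *\<^sub>R dir_deriv e \<phi> (h *\<^sub>R e + p))) (at h)" for p h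
  proof -
    have "((\<lambda>h. \<phi> (h *\<^sub>R e + p)) has_derivative (\<lambda>s. dir_deriv (s *\<^sub>R e) \<phi> (h *\<^sub>R e + p))) (at h)"
      by (rule has_derivative_compose[OF _ smooth_has_derivative[OF smooth]])
         (auto intro!: derivative_eq_intros)
    moreover have "dir_deriv (s *\<^sub>R e) \<phi> q = s *\<^sub>R dir_deriv e \<phi> q" for s q
      using has_derivative_linear[OF smooth_has_derivative[OF smooth]] linear_scale by blast
    ultimately show ?thesis by simp
  qed
  obtain R' where R': "\<And>p. norm p > R' \<Longrightarrow> dir_deriv e \<phi> p = 0"
    using test_function_supp[OF test_function_dir_deriv[OF assms]] by blast
  have "compact (dir_deriv e \<phi> ` cball 0 R')"
    by (intro compact_continuous_image smooth_continuous smooth_dir_deriv smooth compact_cball)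
  then obtain B where B: "\<And>p. norm p \<le> R' \<Longrightarrow> cmod (dir_deriv e \<phi> p) \<le> B"
    using compact_imp_bounded[THEN bounded_iff[THEN iffD1]] by (metis imageI mem_cball_0)
  have B': "cmod (dir_deriv e \<phi> p) \<le> \<bar>B\<bar>" for p
    using B[of p] R'[of p] by (cases "norm p \<le> R'") auto
  have bound: "cmod (g n p) \<le> \<bar>B\<bar>" for n p
  proof -
    have "norm (\<phi> (t n *\<^sub>R e + p) - \<phi> (0 *\<^sub>R e + p)) \<le> \<bar>B\<bar> * norm (t n - 0)"
      by (rule differentiable_bound[OF convex_UNIV line onorm_bound])
         (auto simp: mult.commute intro!: mult_left_mono B')
    moreover have "cmod (g n p) = norm (\<phi> (t n *\<^sub>R e + p) - \<phi> p) / t n"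
      using t[of n] by (simp add: g_def divide_inverse mult.commute)
    ultimately show ?thesis using t[of n] by (simp add: divide_le_eq)
  qed
  have supp: "g n p = 0" if "norm p > R + norm e" for n p
  proof -
    have "norm (t n *\<^sub>R e) \<le> norm e" using t[of n] by (simp add: mult_left_le_one_le)
    moreover have "norm p \<le> norm (t n *\<^sub>R e + p) + norm (t n *\<^sub>R e)"
      using norm_triangle_ineq4[of "t n *\<^sub>R e + p" "t n *\<^sub>R e"] by simp
    ultimately have "norm (t n *\<^sub>R e + p) > R" using that by linarith
    moreover have "norm p > R" using that norm_ge_zero[of e] by linarith
    ultimately show ?thesis using R(2) by (simp add: g_def)
  qed
  have lim: "(\<lambda>n. \<integral>p. g n p \<partial>lborel) \<longlonglongrightarrow> (\<integral>p. dir_deriv e \<phi> p \<partial>lborel)"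
  proof (rule integral_dominated_convergence)
    show "integrable lborel (\<lambda>p. indicator (cball 0 (R + norm e)) p *\<^sub>R \<bar>B\<bar>)"
      by (intro borel_integrable_compact compact_cball continuous_intros)
    show "AE p in lborel. (\<lambda>n. g n p) \<longlonglongrightarrow> dir_deriv e \<phi> p"
    proof (rule AE_I2)
      fix p
      have "((\<lambda>h. (1 / \<bar>h\<bar>) *\<^sub>R (\<phi> (h *\<^sub>R e + p) - (\<phi> p + h *\<^sub>R dir_deriv e \<phi> p))) \<longlongrightarrow> 0) (at 0)"
        using line[of p 0] by (simp add: has_derivative_at2)
      then have lim0: "((\<lambda>h. cmod ((1 / \<bar>h\<bar>) *\<^sub>R (\<phi> (h *\<^sub>R e + p) - (\<phi> p + h *\<^sub>R dir_deriv e \<phi> p)))) \<longlongrightarrow> 0) (at 0)"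
        by (rule tendsto_norm_zero)
      have "((\<lambda>h. cmod ((\<phi> (h *\<^sub>R e + p) - \<phi> p) /\<^sub>R h - dir_deriv e \<phi> p)) \<longlongrightarrow> 0) (at 0)"
      proof (rule Lim_transform_eventually[OF lim0])
        have "cmod ((1 / \<bar>h\<bar>) *\<^sub>R (\<phi> (h *\<^sub>R e + p) - (\<phi> p + h *\<^sub>R dir_deriv e \<phi> p)))
            = cmod ((\<phi> (h *\<^sub>R e + p) - \<phi> p) /\<^sub>R h - dir_deriv e \<phi> p)" if "h \<noteq> 0" for h
        proof -
          have "(\<phi> (h *\<^sub>R e + p) - \<phi> p) /\<^sub>R h - dir_deriv e \<phi> p
              = inverse h *\<^sub>R (\<phi> (h *\<^sub>R e + p) - (\<phi> p + h *\<^sub>R dir_deriv e \<phi> p))"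
            using that by (simp add: algebra_simps)
          then show ?thesis by (simp only: norm_scaleR) (simp add: inverse_eq_divide)
        qed
        then show "\<forall>\<^sub>F h in at 0. cmod ((1 / \<bar>h\<bar>) *\<^sub>R (\<phi> (h *\<^sub>R e + p) - (\<phi> p + h *\<^sub>R dir_deriv e \<phi> p)))
            = cmod ((\<phi> (h *\<^sub>R e + p) - \<phi> p) /\<^sub>R h - dir_deriv e \<phi> p)"
          by (simp add: eventually_at_filter)
      qed
      then have "((\<lambda>h. (\<phi> (h *\<^sub>R e + p) - \<phi> p) /\<^sub>R h) \<longlongrightarrow> dir_deriv e \<phi> p) (at 0)"
        by (rule LIM_zero_cancel[OF tendsto_norm_zero_cancel])
      moreover have "filterlim t (at 0) sequentially"
        using t0 t(1) by (intro filterlim_atI always_eventually allI) (auto simp: less_le)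
      ultimately show "(\<lambda>n. g n p) \<longlonglongrightarrow> dir_deriv e \<phi> p"
        unfolding g_def by (rule filterlim_compose)
    qed
    show "AE p in lborel. norm (g n p) \<le> indicator (cball 0 (R + norm e)) p *\<^sub>R \<bar>B\<bar>" for n
      using bound supp by (auto simp: indicator_def not_le)
  qed (auto simp: g_def)
  have "(\<integral>p. g n p \<partial>lborel) = 0" for n
  proof -
    have int: "integrable lborel \<phi>" by (rule test_function_integrable[OF assms])
    have "integrable (distr lborel borel ((+) (t n *\<^sub>R e))) \<phi>" using int by (simp add: lborel_distr_plus)
    then have int': "integrable lborel (\<lambda>p. \<phi> (t n *\<^sub>R e + p))"
      by (subst (asm) integrable_distr_eq) auto
    have "(\<integral>p. \<phi> p \<partial>lborel) = (\<integral>p. \<phi> p \<partial>(distr lborel borel ((+) (t n *\<^sub>R e))))"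
      by (simp add: lborel_distr_plus)
    also have "\<dots> = (\<integral>p. \<phi> (t n *\<^sub>R e + p) \<partial>lborel)"
      by (subst integral_distr) auto
    finally show ?thesis using int int' by (simp add: g_def)
  qed
  with lim show ?thesis by (simp add: LIMSEQ_const_iff)
qed

lemma integral_by_parts:
  assumes "smooth u" "\<phi> \<in> test_functions"
  shows "(\<integral>p. u p * dir_deriv e \<phi> p \<partial>lborel) = - (\<integral>p. dir_deriv e u p * \<phi> p \<partial>lborel)"
proof -
  have "0 = (\<integral>p. dir_deriv e (\<lambda>p. u p * \<phi> p) p \<partial>lborel)"
    by (rule integral_dir_deriv_test_function[OF test_function_mult[OF assms], symmetric])
  also have "\<dots> = (\<integral>p. dir_deriv e u p * \<phi> p + u p * dir_deriv e \<phi> p \<partial>lborel)"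
    using assms by (simp add: dir_deriv_mult test_function_smooth)
  also have "\<dots> = (\<integral>p. dir_deriv e u p * \<phi> p \<partial>lborel) + (\<integral>p. u p * dir_deriv e \<phi> p \<partial>lborel)"
    using assms by (intro Bochner_Integration.integral_add test_function_integrable test_function_mult
        test_function_dir_deriv smooth_dir_deriv)
  finally show ?thesis by (simp add: eq_neg_iff_add_eq_0 add.commute)
qed

section \<open>The operator on smooth functions and its transpose\<close>

abbreviation xdir :: "2 \<Rightarrow> phase" where "xdir j \<equiv> (axis j 1, 0)"
abbreviation vdir :: "2 \<Rightarrow> phase" where "vdir j \<equiv> (0, axis j 1)"

lemma smooth_xc: "smooth (\<lambda>X. of_real (xc j X))" and smooth_vc: "smooth (\<lambda>X. of_real (vc j X))"
  and dir_deriv_xc: "dir_deriv e (\<lambda>X. of_real (xc j X)) = (\<lambda>X. of_real (xc j e))"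
  and dir_deriv_vc: "dir_deriv e (\<lambda>X. of_real (vc j X)) = (\<lambda>X. of_real (vc j e))"
  and inner_xdir: "X \<bullet> xdir j = xc j X" and inner_vdir: "X \<bullet> vdir j = vc j X"
proof -
  show i: "X \<bullet> xdir j = xc j X" "X \<bullet> vdir j = vc j X" for X j
    by (simp_all add: xc_def vc_def inner_prod_def inner_axis)
  show "smooth (\<lambda>X. of_real (xc j X))" "smooth (\<lambda>X. of_real (vc j X))"
    "dir_deriv e (\<lambda>X. of_real (xc j X)) = (\<lambda>X. of_real (xc j e))"
    "dir_deriv e (\<lambda>X. of_real (vc j X)) = (\<lambda>X. of_real (vc j e))"
    unfolding i[symmetric] by (rule smooth_inner dir_deriv_inner)+
qed

text \<open>The operator acting on smooth functions, with an arbitrary real \<open>s\<close> in place of \<open>sqrt a\<close>: negative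
values are needed because the transpose of the operator has parameters \<open>- sqrt a\<close> and \<open>- b\<close>. The
product of the two first-order factors is expanded using the commutator \<open>[d/dv, v] = 1\<close>.\<close>

definition KFP_fun :: "real \<Rightarrow> real \<Rightarrow> (phase \<Rightarrow> complex) \<Rightarrow> phase \<Rightarrow> complex" where
  "KFP_fun s b u X =
     (\<Sum>j\<in>UNIV. - dir_deriv (vdir j) (dir_deriv (vdir j) u) X - u X + of_real (vc j X) * (of_real (vc j X) * u X)) / 2
     + of_real s * (\<Sum>j\<in>UNIV. of_real (vc j X) * dir_deriv (xdir j) u X - of_real (xc j X) * dir_deriv (vdir j) u X)
     + of_real b * (of_real (vc 1 X) * dir_deriv (vdir 2) u X - of_real (vc 2 X) * dir_deriv (vdir 1) u X)"

lemma smooth_KFP_fun: "smooth u \<Longrightarrow> smooth (KFP_fun s b u)"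
  unfolding KFP_fun_def[abs_def] divide_inverse
  by (intro smooth_add smooth_diff smooth_mult smooth_sum smooth_const smooth_minus smooth_dir_deriv smooth_xc smooth_vc)

lemma test_function_cmult: "\<phi> \<in> test_functions \<Longrightarrow> (\<lambda>X. c * \<phi> X) \<in> test_functions"
  by (rule test_function_mult[OF smooth_const])

lemma test_function_diff:
  "f \<in> test_functions \<Longrightarrow> \<phi> \<in> test_functions \<Longrightarrow> (\<lambda>p. f p - \<phi> p) \<in> test_functions"
  using test_function_add[OF _ test_function_cmult, of f \<phi> "-1"] by simp

lemma test_function_vc: "\<phi> \<in> test_functions \<Longrightarrow> (\<lambda>X. of_real (vc j X) * \<phi> X) \<in> test_functions"
  by (rule test_function_mult[OF smooth_vc])

lemma test_function_xc: "\<phi> \<in> test_functions \<Longrightarrow> (\<lambda>X. of_real (xc j X) * \<phi> X) \<in> test_functions"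
  by (rule test_function_mult[OF smooth_xc])

lemmas test_function_intros = test_function_vc test_function_xc test_function_dir_deriv
  test_function_add test_function_diff test_function_cmult

lemma dist_of_ddiff:
  assumes "smooth u" "\<phi> \<in> test_functions"
  shows "ddiff e (dist_of u) \<phi> = dist_of (dir_deriv e u) \<phi>"
  using integral_by_parts[OF assms] by (simp add: ddiff_def dist_of_def)

lemma dist_of_dmult: "dmult g (dist_of u) \<phi> = dist_of (\<lambda>X. of_real (g X) * u X) \<phi>"
  by (simp add: dmult_def dist_of_def mult_ac)

lemma dist_of_left_add:
  assumes "smooth u" "smooth w" "\<phi> \<in> test_functions"
  shows "dist_of (\<lambda>X. u X + w X) \<phi> = dist_of u \<phi> + dist_of w \<phi>"
  using assms by (simp add: dist_of_def ring_distribs test_function_integrable test_function_mult)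

lemma dist_of_left_cmult: "dist_of (\<lambda>X. c * u X) \<phi> = c * dist_of u \<phi>"
  by (simp add: dist_of_def mult.assoc)

lemma dist_of_left_diff:
  assumes "smooth u" "smooth w" "\<phi> \<in> test_functions"
  shows "dist_of (\<lambda>X. u X - w X) \<phi> = dist_of u \<phi> - dist_of w \<phi>"
  using assms by (simp add: dist_of_def ring_distribs test_function_integrable test_function_mult)

lemma dist_of_annihil:
  assumes "smooth u" "\<phi> \<in> test_functions"
  shows "annihil j (dist_of u) \<phi> = dist_of (\<lambda>X. dir_deriv (vdir j) u X + of_real (vc j X) * u X) \<phi>"
  unfolding annihil_def d_v_def dist_of_ddiff[OF assms] dist_of_dmult
  by (intro dist_of_left_add[symmetric] smooth_mult smooth_vc smooth_dir_deriv assms)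

lemma dist_of_creat_annihil:
  assumes u: "smooth u" and \<phi>: "\<phi> \<in> test_functions"
  shows "creat j (annihil j (dist_of u)) \<phi> =
    dist_of (\<lambda>X. - dir_deriv (vdir j) (dir_deriv (vdir j) u) X - u X + of_real (vc j X) * (of_real (vc j X) * u X)) \<phi>"
proof -
  define w where "w = (\<lambda>X. dir_deriv (vdir j) u X + of_real (vc j X) * u X)"
  have w: "smooth w" unfolding w_def by (intro smooth_add smooth_mult smooth_vc smooth_dir_deriv u)
  have "dir_deriv (vdir j) w = (\<lambda>X. dir_deriv (vdir j) (dir_deriv (vdir j) u) X + (of_real (vc j (vdir j)) * u X + of_real (vc j X) * dir_deriv (vdir j) u X))"
    unfolding w_def
    by (simp add: dir_deriv_add dir_deriv_mult dir_deriv_vc smooth_mult smooth_vc smooth_dir_deriv u del: of_real_1)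
  then have dw: "dir_deriv (vdir j) w = (\<lambda>X. dir_deriv (vdir j) (dir_deriv (vdir j) u) X + (u X + of_real (vc j X) * dir_deriv (vdir j) u X))"
    by (simp add: vc_def)
  have "creat j (annihil j (dist_of u)) \<phi> =
      annihil j (dist_of u) (dir_deriv (vdir j) \<phi>) + annihil j (dist_of u) (\<lambda>X. of_real (vc j X) * \<phi> X)"
    by (simp add: creat_def d_v_def ddiff_def dmult_def)
  also have "\<dots> = dist_of w (dir_deriv (vdir j) \<phi>) + dist_of w (\<lambda>X. of_real (vc j X) * \<phi> X)"
    using dist_of_annihil[OF u] \<phi> by (simp add: w_def test_function_intros)
  also have "\<dots> = - dist_of (dir_deriv (vdir j) w) \<phi> + dist_of (\<lambda>X. of_real (vc j X) * w X) \<phi>"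
    using integral_by_parts[OF w \<phi>, of "vdir j"] dist_of_dmult[of "vc j" w \<phi>]
    by (simp only: dist_of_def dmult_def)
  also have "\<dots> = dist_of (\<lambda>X. of_real (vc j X) * w X - dir_deriv (vdir j) w X) \<phi>"
    using w \<phi> by (simp add: dist_of_left_diff smooth_mult smooth_vc smooth_dir_deriv)
  finally show ?thesis unfolding dw by (simp add: w_def algebra_simps)
qed

text \<open>On smooth functions the distributional operator is the classical one. Each derivative is moved by
integration by parts, which is available at every stage because derivatives of test functions and
their products with coordinates are again test functions.\<close>

lemma dist_of_KFP:
  assumes u: "smooth u" and \<phi>: "\<phi> \<in> test_functions"
  shows "KFP a b (dist_of u) \<phi> = dist_of (KFP_fun (sqrt a) b u) \<phi>"
proof -
  note S = smooth_add smooth_diff smooth_mult smooth_sum smooth_const smooth_minus smooth_dir_deriv smooth_xc smooth_vc u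
  have *: "dmult g (ddiff e (dist_of u)) \<phi> = dist_of (\<lambda>X. of_real (g X) * dir_deriv e u X) \<phi>"
    if "smooth (\<lambda>X. of_real (g X))" for g e
    using dist_of_ddiff[OF u test_function_mult[OF that \<phi>], of e] dist_of_dmult[of g "dir_deriv e u" \<phi>]
    by (simp add: dmult_def)
  define f where "f = (\<lambda>j X. - dir_deriv (vdir j) (dir_deriv (vdir j) u) X - u X + of_real (vc j X) * (of_real (vc j X) * u X))"
  define g where "g = (\<lambda>j X. of_real (vc j X) * dir_deriv (xdir j) u X - of_real (xc j X) * dir_deriv (vdir j) u X)"
  define h where "h = (\<lambda>X. of_real (vc 1 X) * dir_deriv (vdir 2) u X - of_real (vc 2 X) * dir_deriv (vdir 1) u X)"
  have sm: "smooth (f j)" "smooth (g j)" "smooth h" for j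
    unfolding f_def g_def h_def by (intro S)+
  have f: "creat j (annihil j (dist_of u)) \<phi> = dist_of (f j) \<phi>" for j
    unfolding f_def by (rule dist_of_creat_annihil[OF u \<phi>])
  have g: "dmult (vc j) (d_x j (dist_of u)) \<phi> - dmult (xc j) (d_v j (dist_of u)) \<phi> = dist_of (g j) \<phi>" for j
    unfolding g_def d_x_def d_v_def *[OF smooth_vc] *[OF smooth_xc]
    by (intro dist_of_left_diff[symmetric] S \<phi>)
  have h: "dmult (vc 1) (d_v 2 (dist_of u)) \<phi> - dmult (vc 2) (d_v 1 (dist_of u)) \<phi> = dist_of h \<phi>"
    unfolding h_def d_v_def *[OF smooth_vc] by (intro dist_of_left_diff[symmetric] S \<phi>)
  have eq: "KFP_fun (sqrt a) b u = (\<lambda>X. inverse 2 * (f 1 X + f 2 X)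
      + of_real (sqrt a) * (g 1 X + g 2 X) + of_real b * h X)"
    unfolding KFP_fun_def[abs_def] f_def g_def h_def sum_2 by (simp add: fun_eq_iff field_simps)
  have "dist_of (KFP_fun (sqrt a) b u) \<phi> = inverse 2 * (dist_of (f 1) \<phi> + dist_of (f 2) \<phi>)
      + of_real (sqrt a) * (dist_of (g 1) \<phi> + dist_of (g 2) \<phi>) + of_real b * dist_of h \<phi>"
    unfolding eq by (simp only: dist_of_left_add dist_of_left_cmult sm \<phi> smooth_add smooth_mult smooth_const)
  moreover have "KFP a b (dist_of u) \<phi> = 1 / 2 * ((dist_of (f 1) \<phi> + dist_of (f 2) \<phi>)
      + 2 * of_real (sqrt a) * (dist_of (g 1) \<phi> + dist_of (g 2) \<phi>) + 2 * of_real b * dist_of h \<phi>)"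
    unfolding KFP_def sum_2 f g h by simp
  ultimately show ?thesis by (simp add: algebra_simps)
qed

lemma dist_of_right:
  assumes w: "w \<in> L2" and fg: "f \<in> test_functions" "h \<in> test_functions"
  shows "dist_of w (\<lambda>X. f X + h X) = dist_of w f + dist_of w h"
    "dist_of w (\<lambda>X. f X - h X) = dist_of w f - dist_of w h"
proof -
  have i: "integrable lborel (\<lambda>p. w p * f p)" "integrable lborel (\<lambda>p. w p * h p)"
    by (rule L2_mult_integrable[OF w test_function_L2], rule fg)+
  show "dist_of w (\<lambda>X. f X + h X) = dist_of w f + dist_of w h"
    unfolding dist_of_def distrib_left by (rule Bochner_Integration.integral_add[OF i])
  show "dist_of w (\<lambda>X. f X - h X) = dist_of w f - dist_of w h"
    unfolding dist_of_def right_diff_distrib by (rule Bochner_Integration.integral_diff[OF i])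
qed

lemma dist_of_right_cmult: "dist_of w (\<lambda>X. c * f X) = c * dist_of w f"
  by (simp add: dist_of_def mult.left_commute)

text \<open>The harmonic oscillator part is symmetric for the bilinear pairing, while the transport part and
the rotation are antisymmetric because their coefficients do not depend on the variable that is
differentiated. Hence both parameters change sign.\<close>

lemma KFP_transpose:
  assumes w: "w \<in> L2" and \<phi>: "\<phi> \<in> test_functions"
  shows "KFP a b (dist_of w) \<phi> = dist_of w (KFP_fun (- sqrt a) (- b) \<phi>)"
proof -
  note T = test_function_intros \<phi>
  have sm: "smooth \<phi>" by (rule test_function_smooth[OF \<phi>])
  have dv: "dir_deriv (vdir j) (\<lambda>X. of_real (vc j X) * \<phi> X) = (\<lambda>X. \<phi> X + of_real (vc j X) * dir_deriv (vdir j) \<phi> X)" for j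
    by (simp add: dir_deriv_mult smooth_vc sm dir_deriv_vc) (simp add: vc_def)
  have mixed: "dir_deriv (xdir j) (\<lambda>X. of_real (vc k X) * \<phi> X) = (\<lambda>X. of_real (vc k X) * dir_deriv (xdir j) \<phi> X)"
    "dir_deriv (vdir j) (\<lambda>X. of_real (xc k X) * \<phi> X) = (\<lambda>X. of_real (xc k X) * dir_deriv (vdir j) \<phi> X)"
    "j \<noteq> k \<Longrightarrow> dir_deriv (vdir j) (\<lambda>X. of_real (vc k X) * \<phi> X) = (\<lambda>X. of_real (vc k X) * dir_deriv (vdir j) \<phi> X)" for j k
    by (simp_all add: dir_deriv_mult smooth_vc smooth_xc sm dir_deriv_vc dir_deriv_xc) (simp_all add: vc_def xc_def axis_def)
  have ca: "creat j (annihil j (dist_of w)) \<phi> =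
     dist_of w (\<lambda>X. of_real (vc j X) * (of_real (vc j X) * \<phi> X)) - dist_of w (dir_deriv (vdir j) (dir_deriv (vdir j) \<phi>)) - dist_of w \<phi>" for j
    by (simp add: creat_def annihil_def d_v_def ddiff_def dmult_def dv dist_of_right w T)
  define f where "f = (\<lambda>j X. of_real (vc j X) * (of_real (vc j X) * \<phi> X) - dir_deriv (vdir j) (dir_deriv (vdir j) \<phi>) X - \<phi> X)"
  define g where "g = (\<lambda>j X. of_real (vc j X) * dir_deriv (xdir j) \<phi> X - of_real (xc j X) * dir_deriv (vdir j) \<phi> X)"
  define h where "h = (\<lambda>X. of_real (vc 1 X) * dir_deriv (vdir 2) \<phi> X - of_real (vc 2 X) * dir_deriv (vdir 1) \<phi> X)"
  have test: "f j \<in> test_functions" "g j \<in> test_functions" "h \<in> test_functions" for j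
    unfolding f_def g_def h_def by (intro T)+
  have f: "creat j (annihil j (dist_of w)) \<phi> = dist_of w (f j)" for j
    unfolding ca f_def by (simp add: dist_of_right w T)
  have g: "dmult (vc j) (d_x j (dist_of w)) \<phi> - dmult (xc j) (d_v j (dist_of w)) \<phi> = - dist_of w (g j)" for j
    unfolding g_def by (simp add: dist_of_right w T d_x_def d_v_def ddiff_def dmult_def mixed)
  have h: "dmult (vc 1) (d_v 2 (dist_of w)) \<phi> - dmult (vc 2) (d_v 1 (dist_of w)) \<phi> = - dist_of w h"
    unfolding h_def by (simp add: dist_of_right w T d_x_def d_v_def ddiff_def dmult_def mixed)
  have eq: "KFP_fun (- sqrt a) (- b) \<phi> = (\<lambda>X. inverse 2 * (f 1 X + f 2 X)
      + of_real (- sqrt a) * (g 1 X + g 2 X) + of_real (- b) * h X)"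
    unfolding KFP_fun_def[abs_def] f_def g_def h_def sum_2 by (simp add: fun_eq_iff field_simps)
  have A: "dist_of w (KFP_fun (- sqrt a) (- b) \<phi>) = inverse 2 * (dist_of w (f 1) + dist_of w (f 2))
      + of_real (- sqrt a) * (dist_of w (g 1) + dist_of w (g 2)) + of_real (- b) * dist_of w h"
    unfolding eq by (simp only: dist_of_right dist_of_right_cmult w test test_function_intros)
  have B: "KFP a b (dist_of w) \<phi> = 1 / 2 * ((dist_of w (f 1) + dist_of w (f 2))
      + 2 * of_real (sqrt a) * (- dist_of w (g 1) + - dist_of w (g 2)) + 2 * of_real b * (- dist_of w h))"
    unfolding KFP_def sum_2 f g h by simp
  show ?thesis unfolding A B by (simp add: algebra_simps)
qed

section \<open>Conjugation by the Gaussian\<close>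

text \<open>What remains of \<open>KFP_fun\<close> when a factor \<open>gauss\<close> is pulled out. It maps polynomials to polynomials
without raising the degree, and it annihilates constants because the Gaussian is the ground state.\<close>

definition conj_KFP :: "real \<Rightarrow> real \<Rightarrow> (phase \<Rightarrow> complex) \<Rightarrow> phase \<Rightarrow> complex" where
  "conj_KFP s b p X =
     (\<Sum>j\<in>UNIV. of_real (vc j X) * dir_deriv (vdir j) p X - dir_deriv (vdir j) (dir_deriv (vdir j) p) X / 2)
     + of_real s * (\<Sum>j\<in>UNIV. of_real (vc j X) * dir_deriv (xdir j) p X - of_real (xc j X) * dir_deriv (vdir j) p X)
     + of_real b * (of_real (vc 1 X) * dir_deriv (vdir 2) p X - of_real (vc 2 X) * dir_deriv (vdir 1) p X)"

lemma KFP_fun_mult_gauss: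
  assumes p: "smooth p"
  shows "KFP_fun s b (\<lambda>X. p X * gauss X) = (\<lambda>X. conj_KFP s b p X * gauss X)"
proof -
  have d: "dir_deriv e (\<lambda>X. p X * gauss X) = (\<lambda>X. (dir_deriv e p X - of_real (X \<bullet> e) * p X) * gauss X)"
    if "smooth p" for e p
    using that by (simp add: dir_deriv_mult smooth_gauss dir_deriv_gauss fun_eq_iff algebra_simps)
  have dv: "dir_deriv (vdir j) (\<lambda>X. dir_deriv (vdir j) p X - of_real (vc j X) * p X) =
     (\<lambda>X. dir_deriv (vdir j) (dir_deriv (vdir j) p) X - (p X + of_real (vc j X) * dir_deriv (vdir j) p X))" for j
  proof -
    have "(\<lambda>X. dir_deriv (vdir j) p X - of_real (vc j X) * p X) = (\<lambda>X. dir_deriv (vdir j) p X + - (of_real (vc j X) * p X))"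
      by simp
    then show ?thesis
      by (simp only: dir_deriv_add dir_deriv_minus dir_deriv_mult smooth_mult smooth_vc smooth_dir_deriv smooth_minus p dir_deriv_vc)
         (simp add: vc_def algebra_simps)
  qed
  have s': "smooth (\<lambda>X. dir_deriv (vdir j) p X - of_real (vc j X) * p X)" for j
    by (intro smooth_diff smooth_mult smooth_vc smooth_dir_deriv p)
  show ?thesis
    unfolding KFP_fun_def[abs_def] conj_KFP_def[abs_def] d[OF p] inner_xdir inner_vdir d[OF s'] dv sum_2
    by (rule ext) (simp add: field_simps)
qed

lemma dir_deriv_cutoff:
  "dir_deriv e (cutoff \<epsilon>) = (\<lambda>X. of_real (bump 1 (1 + (- \<epsilon>) * (X \<bullet> X)) * (- 2 * \<epsilon> * (X \<bullet> e))))"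
  unfolding cutoff_def[abs_def] dir_deriv_bump by simp

lemma dir_deriv_dir_deriv_cutoff:
  "dir_deriv e (dir_deriv e (cutoff \<epsilon>)) = (\<lambda>X. of_real (
     bump 2 (1 + (- \<epsilon>) * (X \<bullet> X)) * (- 2 * \<epsilon> * (X \<bullet> e))\<^sup>2 - bump 1 (1 + (- \<epsilon>) * (X \<bullet> X)) * (2 * \<epsilon> * (e \<bullet> e))))"
proof -
  have eq: "dir_deriv e (cutoff \<epsilon>) = (\<lambda>X. of_real (bump 1 (1 + (- \<epsilon>) * (X \<bullet> X))) * (of_real (- 2 * \<epsilon>) * of_real (X \<bullet> e)))"
    unfolding dir_deriv_cutoff by simp
  have sm: "smooth (\<lambda>X. complex_of_real (bump 1 (1 + (- \<epsilon>) * (X \<bullet> X))))"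
    by (rule smooth_compose[where D = bump, OF bump_has_derivative smooth_quadratic])
  have sm2: "smooth (\<lambda>X. complex_of_real (- 2 * \<epsilon>) * of_real (X \<bullet> e))"
    by (intro smooth_mult smooth_const smooth_inner)
  show ?thesis
    unfolding eq dir_deriv_mult[OF sm sm2] dir_deriv_bump dir_deriv_cmult[OF smooth_inner] dir_deriv_inner
    by (simp add: numeral_2_eq_2 power2_eq_square algebra_simps)
qed

text \<open>The transport part and the rotation annihilate radial functions, so the commutator with the cutoff
only involves derivatives in the velocity variables.\<close>

lemma KFP_fun_cutoff:
  assumes u: "smooth u"
  shows "KFP_fun s b (\<lambda>X. cutoff \<epsilon> X * u X) = (\<lambda>X. cutoff \<epsilon> X * KFP_fun s b u X
     - (\<Sum>j\<in>UNIV. dir_deriv (vdir j) (cutoff \<epsilon>) X * dir_deriv (vdir j) u X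
         + dir_deriv (vdir j) (dir_deriv (vdir j) (cutoff \<epsilon>)) X * u X / 2))"
proof -
  note S = smooth_mult smooth_dir_deriv smooth_cutoff u
  have d: "dir_deriv e (\<lambda>X. cutoff \<epsilon> X * u X) = (\<lambda>X. dir_deriv e (cutoff \<epsilon>) X * u X + cutoff \<epsilon> X * dir_deriv e u X)" for e
    by (simp add: dir_deriv_mult S)
  have d2: "dir_deriv e (\<lambda>X. dir_deriv e (cutoff \<epsilon>) X * u X + cutoff \<epsilon> X * dir_deriv e u X) =
    (\<lambda>X. dir_deriv e (dir_deriv e (cutoff \<epsilon>)) X * u X + 2 * (dir_deriv e (cutoff \<epsilon>) X * dir_deriv e u X) + cutoff \<epsilon> X * dir_deriv e (dir_deriv e u) X)" for e
    by (simp add: dir_deriv_add dir_deriv_mult S fun_eq_iff algebra_simps)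
  define c where "c = (\<lambda>X::phase. complex_of_real (bump 1 (1 + (- \<epsilon>) * (X \<bullet> X)) * (- 2 * \<epsilon>)))"
  have c: "dir_deriv (xdir j) (cutoff \<epsilon>) X = c X * of_real (xc j X)" "dir_deriv (vdir j) (cutoff \<epsilon>) X = c X * of_real (vc j X)" for j X
    unfolding dir_deriv_cutoff c_def inner_xdir inner_vdir by simp_all
  define E where "E = (\<lambda>j. dir_deriv (vdir j) (dir_deriv (vdir j) (cutoff \<epsilon>)))"
  have E: "dir_deriv (vdir j) (dir_deriv (vdir j) (cutoff \<epsilon>)) = E j" for j by (simp add: E_def)
  show ?thesis
    unfolding KFP_fun_def[abs_def] d d2 sum_2 E unfolding c by (rule ext) (simp add: field_simps)
qed

section \<open>Triangular form on polynomials\<close>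

text \<open>For \<open>\<sigma> = \<plusminus>1\<close> the functions \<open>zx \<sigma>\<close> and \<open>zv \<sigma>\<close> are the complex coordinates in the position and the
velocity plane that diagonalise the rotation.\<close>

definition zx :: "complex \<Rightarrow> phase \<Rightarrow> complex" where
  "zx \<sigma> X = of_real (xc 1 X) + \<sigma> * \<i> * of_real (xc 2 X)"
definition zv :: "complex \<Rightarrow> phase \<Rightarrow> complex" where
  "zv \<sigma> X = of_real (vc 1 X) + \<sigma> * \<i> * of_real (vc 2 X)"

text \<open>The first-order part of the conjugated operator maps linear forms to linear forms. The forms below
bring it to triangular shape with diagonal \<open>lam1\<close>, \<open>lam2\<close>, \<open>lam3\<close>, \<open>lam4\<close>. Only \<open>eig2\<close> and \<open>eig4\<close> are
eigenvectors; \<open>eig1\<close> and \<open>eig3\<close> are chosen so that the four forms remain independent when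
\<open>lam1 = lam2\<close> or \<open>lam3 = lam4\<close>, where the matrix is not diagonalisable.\<close>

definition eig1 :: "phase \<Rightarrow> complex" where "eig1 = zx (- 1)"
definition eig2 :: "real \<Rightarrow> real \<Rightarrow> phase \<Rightarrow> complex" where
  "eig2 s b X = of_real s * zv (- 1) X - lam1 (s\<^sup>2) b * zx (- 1) X"
definition eig3 :: "phase \<Rightarrow> complex" where "eig3 = zx 1"
definition eig4 :: "real \<Rightarrow> real \<Rightarrow> phase \<Rightarrow> complex" where
  "eig4 s b X = of_real s * zv 1 X - lam3 (s\<^sup>2) b * zx 1 X"

text \<open>Monomials in the four forms; every computation with polynomials is done in this basis.\<close>

definition emono :: "real \<Rightarrow> real \<Rightarrow> nat \<Rightarrow> nat \<Rightarrow> nat \<Rightarrow> nat \<Rightarrow> phase \<Rightarrow> complex" where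
  "emono s b k1 k2 k3 k4 X = eig1 X ^ k1 * eig2 s b X ^ k2 * eig3 X ^ k3 * eig4 s b X ^ k4"

definition alpha :: "real \<Rightarrow> real \<Rightarrow> nat \<Rightarrow> nat \<Rightarrow> nat \<Rightarrow> nat \<Rightarrow> complex" where
  "alpha a b k1 k2 k3 k4 = lam1 a b * of_nat k1 + lam2 a b * of_nat k2 + lam3 a b * of_nat k3 + lam4 a b * of_nat k4"

lemma bounded_linear_xc: "bounded_linear (\<lambda>X. complex_of_real (xc j X))"
  and bounded_linear_vc: "bounded_linear (\<lambda>X. complex_of_real (vc j X))"
  unfolding inner_xdir[symmetric] inner_vdir[symmetric]
  by (rule bounded_linear_compose[OF bounded_linear_of_real bounded_linear_inner_left])+

lemma bounded_linear_eig:
  "bounded_linear eig1" "bounded_linear (eig2 s b)" "bounded_linear eig3" "bounded_linear (eig4 s b)"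
  unfolding eig1_def eig2_def[abs_def] eig3_def eig4_def[abs_def] zx_def[abs_def] zv_def[abs_def]
  by (intro bounded_linear_add bounded_linear_sub bounded_linear_const_mult bounded_linear_xc bounded_linear_vc)+

lemmas smooth_eig = bounded_linear_eig[THEN smooth_linear]

lemma smooth_emono: "smooth (emono s b k1 k2 k3 k4)"
  unfolding emono_def[abs_def] by (intro smooth_mult smooth_power smooth_eig)

lemma exp_growth_emono: "exp_growth (emono s b k1 k2 k3 k4)"
  unfolding emono_def[abs_def]
  by (intro exp_growth_mult exp_growth_power exp_growth_linear bounded_linear_eig)

lemma dir_deriv_emono:
  "dir_deriv e (emono s b k1 k2 k3 k4) = (\<lambda>X.
     eig1 e * (of_nat k1 * emono s b (k1 - 1) k2 k3 k4 X) +
     eig2 s b e * (of_nat k2 * emono s b k1 (k2 - 1) k3 k4 X) +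
     eig3 e * (of_nat k3 * emono s b k1 k2 (k3 - 1) k4 X) +
     eig4 s b e * (of_nat k4 * emono s b k1 k2 k3 (k4 - 1) X))"
proof -
  note S = smooth_mult smooth_power smooth_eig
  note L = bounded_linear_eig[THEN dir_deriv_linear]
  show ?thesis
    unfolding emono_def[abs_def]
    by (simp add: dir_deriv_mult dir_deriv_power S L fun_eq_iff algebra_simps)
qed

lemma eig_vdir:
  "eig1 (vdir j) = 0" "eig3 (vdir j) = 0"
  "eig2 s b (vdir 1) = of_real s" "eig2 s b (vdir 2) = - \<i> * of_real s"
  "eig4 s b (vdir 1) = of_real s" "eig4 s b (vdir 2) = \<i> * of_real s"
  by (simp_all add: eig1_def eig2_def eig3_def eig4_def zx_def zv_def xc_def vc_def axis_def)

lemma eig_xdir: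
  "eig1 (xdir 1) = 1" "eig1 (xdir 2) = - \<i>" "eig3 (xdir 1) = 1" "eig3 (xdir 2) = \<i>"
  "eig2 s b (xdir 1) = - lam1 (s\<^sup>2) b" "eig2 s b (xdir 2) = \<i> * lam1 (s\<^sup>2) b"
  "eig4 s b (xdir 1) = - lam3 (s\<^sup>2) b" "eig4 s b (xdir 2) = - \<i> * lam3 (s\<^sup>2) b"
  by (simp_all add: eig1_def eig2_def eig3_def eig4_def zx_def zv_def xc_def vc_def axis_def)

text \<open>The velocity gradients of \<open>eig2\<close> and of \<open>eig4\<close> are isotropic for the complex bilinear form, so only
the mixed product of the two contributes to the velocity Laplacian.\<close>

lemma emono_laplace:
  "(\<Sum>j\<in>UNIV. dir_deriv (vdir j) (dir_deriv (vdir j) (emono s b k1 k2 k3 k4)) X) =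
    4 * (of_real s)\<^sup>2 * (of_nat k2 * of_nat k4) * emono s b k1 (k2 - 1) k3 (k4 - 1) X"
proof -
  note S = smooth_mult smooth_const smooth_emono
  have d: "dir_deriv (vdir j) (emono s b k1 k2 k3 k4) = (\<lambda>X.
     (eig2 s b (vdir j) * of_nat k2) * emono s b k1 (k2 - 1) k3 k4 X +
     (eig4 s b (vdir j) * of_nat k4) * emono s b k1 k2 k3 (k4 - 1) X)" for j k1 k2 k3 k4
    by (simp add: dir_deriv_emono eig_vdir fun_eq_iff)
  have dd: "dir_deriv (vdir j) (dir_deriv (vdir j) (emono s b k1 k2 k3 k4)) X =
     (eig2 s b (vdir j) * of_nat k2) * ((eig2 s b (vdir j) * of_nat (k2 - 1)) * emono s b k1 (k2 - 1 - 1) k3 k4 X +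
     (eig4 s b (vdir j) * of_nat k4) * emono s b k1 (k2 - 1) k3 (k4 - 1) X) +
     (eig4 s b (vdir j) * of_nat k4) * ((eig2 s b (vdir j) * of_nat k2) * emono s b k1 (k2 - 1) k3 (k4 - 1) X +
     (eig4 s b (vdir j) * of_nat (k4 - 1)) * emono s b k1 k2 k3 (k4 - 1 - 1) X)" for j
    unfolding d[of j k1 k2 k3 k4]
    by (simp only: dir_deriv_add dir_deriv_cmult S) (simp only: d)
  show ?thesis
    unfolding sum_2 dd eig_vdir by (simp add: algebra_simps power2_eq_square)
qed

text \<open>The first-order part of the conjugated operator as a vector field; \<open>f e\<close> stands for the derivative
in direction \<open>e\<close> at \<open>X\<close>.\<close>

definition drift :: "real \<Rightarrow> real \<Rightarrow> (phase \<Rightarrow> complex) \<Rightarrow> phase \<Rightarrow> complex" where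
  "drift s b f X = (\<Sum>j\<in>UNIV. complex_of_real (vc j X) * f (vdir j))
     + of_real s * (\<Sum>j\<in>UNIV. of_real (vc j X) * f (xdir j) - of_real (xc j X) * f (vdir j))
     + of_real b * (of_real (vc 1 X) * f (vdir 2) - of_real (vc 2 X) * f (vdir 1))"

text \<open>The identities for \<open>eig2\<close> and \<open>eig4\<close> reduce to the sum and the product of the two roots belonging to
the same block.\<close>

lemma drift_eig:
  shows "drift s b eig1 X = lam1 (s\<^sup>2) b * eig1 X + eig2 s b X" 
    "drift s b (eig2 s b) X = lam2 (s\<^sup>2) b * eig2 s b X"
    "drift s b eig3 X = lam3 (s\<^sup>2) b * eig3 X + eig4 s b X"
    "drift s b (eig4 s b) X = lam4 (s\<^sup>2) b * eig4 s b X"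
proof -
  show "drift s b eig1 X = lam1 (s\<^sup>2) b * eig1 X + eig2 s b X" 
    unfolding drift_def sum_2 eig_vdir eig_xdir unfolding eig2_def eig1_def zx_def zv_def by (simp add: algebra_simps)
  show "drift s b eig3 X = lam3 (s\<^sup>2) b * eig3 X + eig4 s b X"
    unfolding drift_def sum_2 eig_vdir eig_xdir unfolding eig4_def eig3_def zx_def zv_def by (simp add: algebra_simps)
  define S L where "S = complex_of_real s" "L = lam1 (s\<^sup>2) b"
  have l2: "lam2 (s\<^sup>2) b = 1 - \<i> * of_real b - L"
    using lam_vieta(1)[of "s\<^sup>2" b] by (simp add: S_L_def algebra_simps)
  have "L * lam2 (s\<^sup>2) b = S * S"
    using lam_vieta(2)[of "s\<^sup>2" b] by (simp add: S_L_def power2_eq_square)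
  then have p: "L * L = L - \<i> * of_real b * L - S * S"
    unfolding l2 by (simp add: algebra_simps)
  then have p': "L * (L * z) = L * z - \<i> * of_real b * L * z - S * S * z" for z
    unfolding mult.assoc[symmetric] left_diff_distrib[symmetric] by simp
  have ii: "\<i> * (\<i> * z) = - z" for z by (simp flip: mult.assoc)
  show "drift s b (eig2 s b) X = lam2 (s\<^sup>2) b * eig2 s b X"
    unfolding drift_def sum_2 eig_vdir eig_xdir l2 unfolding eig2_def zx_def zv_def S_L_def[symmetric]
    by (simp add: algebra_simps ii p')
  define M where "M = lam3 (s\<^sup>2) b"
  have l4: "lam4 (s\<^sup>2) b = 1 + \<i> * of_real b - M"
    using lam_vieta(3)[of "s\<^sup>2" b] by (simp add: M_def algebra_simps)
  have "M * lam4 (s\<^sup>2) b = S * S"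
    using lam_vieta(4)[of "s\<^sup>2" b] by (simp add: S_L_def M_def power2_eq_square)
  then have q: "M * M = M + \<i> * of_real b * M - S * S"
    unfolding l4 by (simp add: algebra_simps)
  then have q': "M * (M * z) = M * z + \<i> * of_real b * M * z - S * S * z" for z
    unfolding mult.assoc[symmetric] left_diff_distrib[symmetric] distrib_right[symmetric] by simp
  show "drift s b (eig4 s b) X = lam4 (s\<^sup>2) b * eig4 s b X"
    unfolding drift_def sum_2 eig_vdir eig_xdir l4 unfolding eig4_def zx_def zv_def S_L_def(1)[symmetric] M_def[symmetric]
    by (simp add: algebra_simps ii q')
qed

lemma emono_step:
  "of_nat k1 * emono s b (k1 - 1) k2 k3 k4 X * eig1 X = of_nat k1 * emono s b k1 k2 k3 k4 X"
  "of_nat k2 * emono s b k1 (k2 - 1) k3 k4 X * eig2 s b X = of_nat k2 * emono s b k1 k2 k3 k4 X"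
  "of_nat k3 * emono s b k1 k2 (k3 - 1) k4 X * eig3 X = of_nat k3 * emono s b k1 k2 k3 k4 X"
  "of_nat k4 * emono s b k1 k2 k3 (k4 - 1) X * eig4 s b X = of_nat k4 * emono s b k1 k2 k3 k4 X"
  by (cases k1; simp add: emono_def) (cases k2; simp add: emono_def; fail | cases k3; simp add: emono_def; fail | cases k4; simp add: emono_def)+

lemma emono_Suc:
  "emono s b (Suc k1) k2 k3 k4 X = eig1 X * emono s b k1 k2 k3 k4 X"
  "emono s b k1 (Suc k2) k3 k4 X = eig2 s b X * emono s b k1 k2 k3 k4 X"
  "emono s b k1 k2 (Suc k3) k4 X = eig3 X * emono s b k1 k2 k3 k4 X"
  "emono s b k1 k2 k3 (Suc k4) X = eig4 s b X * emono s b k1 k2 k3 k4 X"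
  by (simp_all add: emono_def)

text \<open>Triangularity: the diagonal entry is \<open>alpha\<close>, and each of the other three monomials has smaller
\<open>weight\<close> below. This is the fact on which both inclusions between the generalized eigenvalues and
the numbers \<open>alpha\<close> rest.\<close>

lemma conj_KFP_emono:
  "conj_KFP s b (emono s b k1 k2 k3 k4) X =
     alpha (s\<^sup>2) b k1 k2 k3 k4 * emono s b k1 k2 k3 k4 X
     + of_nat k1 * emono s b (k1 - 1) (Suc k2) k3 k4 X
     + of_nat k3 * emono s b k1 k2 (k3 - 1) (Suc k4) X
     - 2 * (of_real s)\<^sup>2 * (of_nat k2 * of_nat k4) * emono s b k1 (k2 - 1) k3 (k4 - 1) X"
proof -
  define m1 m2 m3 m4 where "m1 = of_nat k1 * emono s b (k1 - 1) k2 k3 k4 X" "m2 = of_nat k2 * emono s b k1 (k2 - 1) k3 k4 X"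
    "m3 = of_nat k3 * emono s b k1 k2 (k3 - 1) k4 X" "m4 = of_nat k4 * emono s b k1 k2 k3 (k4 - 1) X"
  have "conj_KFP s b (emono s b k1 k2 k3 k4) X = drift s b (\<lambda>e. dir_deriv e (emono s b k1 k2 k3 k4) X) X
      - (\<Sum>j\<in>UNIV. dir_deriv (vdir j) (dir_deriv (vdir j) (emono s b k1 k2 k3 k4)) X) / 2"
    unfolding conj_KFP_def drift_def by (simp add: sum_subtractf sum_divide_distrib)
  also have "drift s b (\<lambda>e. dir_deriv e (emono s b k1 k2 k3 k4) X) X
      = drift s b eig1 X * m1 + drift s b (eig2 s b) X * m2 + drift s b eig3 X * m3 + drift s b (eig4 s b) X * m4"
    unfolding drift_def dir_deriv_emono m1_m2_m3_m4_def[symmetric] sum_2 by (simp add: algebra_simps)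
  also have "\<dots> = lam1 (s\<^sup>2) b * (m1 * eig1 X) + eig2 s b X * m1 + lam2 (s\<^sup>2) b * (m2 * eig2 s b X)
      + lam3 (s\<^sup>2) b * (m3 * eig3 X) + eig4 s b X * m3 + lam4 (s\<^sup>2) b * (m4 * eig4 s b X)"
    unfolding drift_eig by (simp add: algebra_simps)
  also have "\<dots> = alpha (s\<^sup>2) b k1 k2 k3 k4 * emono s b k1 k2 k3 k4 X
     + of_nat k1 * emono s b (k1 - 1) (Suc k2) k3 k4 X
     + of_nat k3 * emono s b k1 k2 (k3 - 1) (Suc k4) X"
    unfolding m1_m2_m3_m4_def emono_step alpha_def emono_Suc by (simp add: algebra_simps)
  finally show ?thesis unfolding emono_laplace by simp
qed

section \<open>Back substitution\<close>

lemma conj_KFP_add: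
  assumes "smooth f" "smooth h"
  shows "conj_KFP s b (\<lambda>X. f X + h X) X = conj_KFP s b f X + conj_KFP s b h X"
  using assms by (simp add: conj_KFP_def sum_2 dir_deriv_add smooth_dir_deriv field_simps)

lemma conj_KFP_cmult:
  assumes "smooth f"
  shows "conj_KFP s b (\<lambda>X. c * f X) X = c * conj_KFP s b f X"
  using assms by (simp add: conj_KFP_def sum_2 dir_deriv_cmult smooth_dir_deriv field_simps)

text \<open>The indices of the non-eigenvectors \<open>eig1\<close> and \<open>eig3\<close> count twice, so that replacing one of them by
\<open>eig2\<close> or \<open>eig4\<close> lowers the weight.\<close>

abbreviation weight :: "nat \<Rightarrow> nat \<Rightarrow> nat \<Rightarrow> nat \<Rightarrow> nat" where
  "weight k1 k2 k3 k4 \<equiv> 2 * k1 + k2 + 2 * k3 + k4"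

text \<open>The linear span of the monomials of weight less than \<open>n\<close>, generated by adding one term at a time so
that statements about it are proved by rule induction.\<close>

inductive lower_span :: "real \<Rightarrow> real \<Rightarrow> nat \<Rightarrow> (phase \<Rightarrow> complex) \<Rightarrow> bool" for s b n where
  zero: "lower_span s b n (\<lambda>X. 0)"
| step: "lower_span s b n f \<Longrightarrow> weight k1 k2 k3 k4 < n \<Longrightarrow> lower_span s b n (\<lambda>X. f X + c * emono s b k1 k2 k3 k4 X)"

lemma lower_span_smooth: "lower_span s b n f \<Longrightarrow> smooth f"
  by (induction rule: lower_span.induct) (simp_all add: smooth_const smooth_add smooth_mult smooth_emono)

lemma lower_span_exp_growth: "lower_span s b n f \<Longrightarrow> exp_growth f"
  by (induction rule: lower_span.induct) (simp_all add: exp_growth_const exp_growth_add exp_growth_mult exp_growth_emono)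

lemma lower_span_mono: "lower_span s b n f \<Longrightarrow> n \<le> m \<Longrightarrow> lower_span s b m f"
  by (induction rule: lower_span.induct) (auto intro: lower_span.intros)

lemma lower_span_add: "lower_span s b n h \<Longrightarrow> lower_span s b n f \<Longrightarrow> lower_span s b n (\<lambda>X. f X + h X)"
proof (induction rule: lower_span.induct)
  case (step h k1 k2 k3 k4 c)
  from lower_span.step[OF step.IH[OF step.prems] step.hyps(2), of c] show ?case by (simp add: add.assoc)
qed simp

lemma lower_span_cmult: "lower_span s b n f \<Longrightarrow> lower_span s b n (\<lambda>X. d * f X)"
proof (induction rule: lower_span.induct)
  case (step f k1 k2 k3 k4 c)
  from lower_span.step[OF step.IH step.hyps(2), of "d * c"] show ?case by (simp add: algebra_simps)
qed (simp add: lower_span.zero)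

lemma lower_span_emono: "c = 0 \<or> weight k1 k2 k3 k4 < n \<Longrightarrow> lower_span s b n (\<lambda>X. c * emono s b k1 k2 k3 k4 X)"
  using lower_span.step[OF lower_span.zero, of k1 k2 k3 k4 n s b c] lower_span.zero by auto

lemma conj_KFP_emono_lower_span:
  obtains q where "lower_span s b (weight k1 k2 k3 k4) q"
    "\<And>X. conj_KFP s b (emono s b k1 k2 k3 k4) X = alpha (s\<^sup>2) b k1 k2 k3 k4 * emono s b k1 k2 k3 k4 X + q X"
proof
  let ?q = "\<lambda>X. (of_nat k1 * emono s b (k1 - 1) (Suc k2) k3 k4 X
     + of_nat k3 * emono s b k1 k2 (k3 - 1) (Suc k4) X)
     + (- 2 * (of_real s)\<^sup>2 * (of_nat k2 * of_nat k4)) * emono s b k1 (k2 - 1) k3 (k4 - 1) X"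
  show "lower_span s b (weight k1 k2 k3 k4) ?q"
    by (intro lower_span_add lower_span_emono) auto
  show "conj_KFP s b (emono s b k1 k2 k3 k4) X = alpha (s\<^sup>2) b k1 k2 k3 k4 * emono s b k1 k2 k3 k4 X + ?q X" for X
    unfolding conj_KFP_emono by (simp add: algebra_simps)
qed

text \<open>A triangular operator whose diagonal avoids \<open>\<mu>\<close> can be inverted by back substitution: a monomial
\<open>Y\<close> with \<open>L Y = \<alpha> Y + q\<close> is the image under \<open>L - \<mu>\<close> of \<open>(Y - t) / (\<alpha> - \<mu>)\<close>, where \<open>t\<close> is a preimage of \<open>q\<close> in
the span of smaller weight.\<close>

lemma conj_KFP_lower_span_surjective:
  assumes "\<And>k1 k2 k3 k4. weight k1 k2 k3 k4 < n \<Longrightarrow> alpha (s\<^sup>2) b k1 k2 k3 k4 \<noteq> \<mu>" "lower_span s b n f"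
  shows "\<exists>r. lower_span s b n r \<and> (\<forall>X. conj_KFP s b r X - \<mu> * r X = f X)"
  using assms
proof (induction n arbitrary: f rule: less_induct)
  case (less n)
  from less.prems(2) show ?case
  proof (induction rule: lower_span.induct)
    case zero
    have "conj_KFP s b (\<lambda>X. 0) X = 0" for X
      using conj_KFP_cmult[OF smooth_const[of 0], of s b 0 X] by simp
    then show ?case by (intro exI[of _ "\<lambda>X. 0"]) (simp add: lower_span.zero)
  next
    case (step f k1 k2 k3 k4 c)
    obtain r where r: "lower_span s b n r" "\<And>X. conj_KFP s b r X - \<mu> * r X = f X"
      using step.IH by blast
    obtain q where q: "lower_span s b (weight k1 k2 k3 k4) q"
      "\<And>X. conj_KFP s b (emono s b k1 k2 k3 k4) X = alpha (s\<^sup>2) b k1 k2 k3 k4 * emono s b k1 k2 k3 k4 X + q X"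
      using conj_KFP_emono_lower_span by blast
    have "\<exists>r. lower_span s b (weight k1 k2 k3 k4) r \<and> (\<forall>X. conj_KFP s b r X - \<mu> * r X = q X)"
      by (rule less.IH[OF step.hyps(2) _ q(1)], rule less.prems(1)) (use step.hyps(2) in linarith)
    then obtain t where t: "lower_span s b (weight k1 k2 k3 k4) t" "\<And>X. conj_KFP s b t X - \<mu> * t X = q X" by blast
    define d where "d = alpha (s\<^sup>2) b k1 k2 k3 k4 - \<mu>"
    have d: "d \<noteq> 0" using less.prems(1)[OF step.hyps(2)] by (simp add: d_def)
    define Y where "Y = emono s b k1 k2 k3 k4"
    define R where "R = (\<lambda>X. r X + (c / d) * (1 * Y X + (-1) * t X))"
    have "lower_span s b n R"
      unfolding R_def Y_def
      by (intro lower_span_add lower_span_cmult lower_span_emono r lower_span_mono[OF t(1)] disjI2 less_imp_le step.hyps)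
    moreover have "conj_KFP s b R X - \<mu> * R X = f X + c * Y X" for X
    proof -
      note S = smooth_add smooth_mult smooth_const lower_span_smooth[OF r(1)] lower_span_smooth[OF t(1)] smooth_emono[of s b k1 k2 k3 k4, folded Y_def]
      have "conj_KFP s b R X = conj_KFP s b r X + c / d * (1 * conj_KFP s b Y X + (-1) * conj_KFP s b t X)"
        unfolding R_def by (simp only: conj_KFP_add conj_KFP_cmult S)
      then have "conj_KFP s b R X - \<mu> * R X = (conj_KFP s b r X - \<mu> * r X)
          + c / d * ((conj_KFP s b Y X - \<mu> * Y X) - (conj_KFP s b t X - \<mu> * t X))"
        unfolding R_def by (simp add: algebra_simps)
      also have "conj_KFP s b Y X - \<mu> * Y X = d * Y X + q X"
        unfolding d_def q(2)[of X, folded Y_def] by (simp add: algebra_simps)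
      finally show ?thesis unfolding r(2) t(2) using d by simp
    qed
    ultimately show ?case unfolding Y_def by blast
  qed
qed

section \<open>Polynomial eigenfunctions\<close>

text \<open>Derivatives in complex directions are needed to differentiate with respect to the complex forms
\<open>eig1\<close>, \<open>eig2\<close>, \<open>eig3\<close>, \<open>eig4\<close>.\<close>

definition cderiv :: "complex \<Rightarrow> complex \<Rightarrow> complex \<Rightarrow> complex \<Rightarrow> (phase \<Rightarrow> complex) \<Rightarrow> phase \<Rightarrow> complex" where
  "cderiv \<gamma>1 \<gamma>2 \<gamma>3 \<gamma>4 f X = \<gamma>1 * dir_deriv (xdir 1) f X + \<gamma>2 * dir_deriv (xdir 2) f X
     + \<gamma>3 * dir_deriv (vdir 1) f X + \<gamma>4 * dir_deriv (vdir 2) f X"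

lemma smooth_cderiv: "smooth f \<Longrightarrow> smooth (cderiv \<gamma>1 \<gamma>2 \<gamma>3 \<gamma>4 f)"
  unfolding cderiv_def[abs_def] by (intro smooth_add smooth_mult smooth_const smooth_dir_deriv)

definition lin_functional :: "((phase \<Rightarrow> complex) \<Rightarrow> complex) \<Rightarrow> bool" where
  "lin_functional \<Xi> \<longleftrightarrow> (\<forall>f h c. smooth f \<longrightarrow> smooth h \<longrightarrow> \<Xi> (\<lambda>X. f X + c * h X) = \<Xi> f + c * \<Xi> h)"

lemma lin_functional_cderiv:
  assumes "lin_functional \<Xi>" shows "lin_functional (\<lambda>f. \<Xi> (cderiv \<gamma>1 \<gamma>2 \<gamma>3 \<gamma>4 f))"
  unfolding lin_functional_def
proof (intro allI impI)
  fix f h :: "phase \<Rightarrow> complex" and c assume S: "smooth f" "smooth h"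
  have "cderiv \<gamma>1 \<gamma>2 \<gamma>3 \<gamma>4 (\<lambda>X. f X + c * h X) = (\<lambda>X. cderiv \<gamma>1 \<gamma>2 \<gamma>3 \<gamma>4 f X + c * cderiv \<gamma>1 \<gamma>2 \<gamma>3 \<gamma>4 h X)"
    using S by (simp add: cderiv_def fun_eq_iff dir_deriv_add dir_deriv_cmult smooth_mult smooth_const algebra_simps)
  then show "\<Xi> (cderiv \<gamma>1 \<gamma>2 \<gamma>3 \<gamma>4 (\<lambda>X. f X + c * h X)) = \<Xi> (cderiv \<gamma>1 \<gamma>2 \<gamma>3 \<gamma>4 f) + c * \<Xi> (cderiv \<gamma>1 \<gamma>2 \<gamma>3 \<gamma>4 h)"
    using assms S unfolding lin_functional_def by (simp add: smooth_cderiv)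
qed

text \<open>The four forms are independent, so they have a dual basis of complex directions; the coefficients
given in the proof are those of \<open>d / d eig1\<close> up to \<open>d / d eig4\<close>.\<close>

lemma cderiv_emono:
  assumes "s \<noteq> 0"
  shows
  "\<exists>\<gamma>1 \<gamma>2 \<gamma>3 \<gamma>4. \<forall>k1 k2 k3 k4. cderiv \<gamma>1 \<gamma>2 \<gamma>3 \<gamma>4 (emono s b k1 k2 k3 k4) = (\<lambda>X. of_nat k1 * emono s b (k1 - 1) k2 k3 k4 X)"
  "\<exists>\<gamma>1 \<gamma>2 \<gamma>3 \<gamma>4. \<forall>k1 k2 k3 k4. cderiv \<gamma>1 \<gamma>2 \<gamma>3 \<gamma>4 (emono s b k1 k2 k3 k4) = (\<lambda>X. of_nat k2 * emono s b k1 (k2 - 1) k3 k4 X)"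
  "\<exists>\<gamma>1 \<gamma>2 \<gamma>3 \<gamma>4. \<forall>k1 k2 k3 k4. cderiv \<gamma>1 \<gamma>2 \<gamma>3 \<gamma>4 (emono s b k1 k2 k3 k4) = (\<lambda>X. of_nat k3 * emono s b k1 k2 (k3 - 1) k4 X)"
  "\<exists>\<gamma>1 \<gamma>2 \<gamma>3 \<gamma>4. \<forall>k1 k2 k3 k4. cderiv \<gamma>1 \<gamma>2 \<gamma>3 \<gamma>4 (emono s b k1 k2 k3 k4) = (\<lambda>X. of_nat k4 * emono s b k1 k2 k3 (k4 - 1) X)"
proof -
  have *: "cderiv \<gamma>1 \<gamma>2 \<gamma>3 \<gamma>4 (emono s b k1 k2 k3 k4) = (\<lambda>X.
     (\<gamma>1 - \<i> * \<gamma>2) * (of_nat k1 * emono s b (k1 - 1) k2 k3 k4 X) +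
     (- lam1 (s\<^sup>2) b * (\<gamma>1 - \<i> * \<gamma>2) + of_real s * (\<gamma>3 - \<i> * \<gamma>4)) * (of_nat k2 * emono s b k1 (k2 - 1) k3 k4 X) +
     (\<gamma>1 + \<i> * \<gamma>2) * (of_nat k3 * emono s b k1 k2 (k3 - 1) k4 X) +
     (- lam3 (s\<^sup>2) b * (\<gamma>1 + \<i> * \<gamma>2) + of_real s * (\<gamma>3 + \<i> * \<gamma>4)) * (of_nat k4 * emono s b k1 k2 k3 (k4 - 1) X))" 
    for \<gamma>1 \<gamma>2 \<gamma>3 \<gamma>4 k1 k2 k3 k4
    unfolding cderiv_def[abs_def] dir_deriv_emono eig_xdir eig_vdir by (simp add: algebra_simps)
  have ii: "\<i> * (\<i> * z) = - z" for z by (simp flip: mult.assoc)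
  define S where "S = complex_of_real s"
  have S: "S \<noteq> 0" using assms by (simp add: S_def)
  show "\<exists>\<gamma>1 \<gamma>2 \<gamma>3 \<gamma>4. \<forall>k1 k2 k3 k4. cderiv \<gamma>1 \<gamma>2 \<gamma>3 \<gamma>4 (emono s b k1 k2 k3 k4) = (\<lambda>X. of_nat k1 * emono s b (k1 - 1) k2 k3 k4 X)"
    by (rule exI[of _ "1/2"], rule exI[of _ "\<i>/2"], rule exI[of _ "lam1 (s\<^sup>2) b / (2 * S)"], rule exI[of _ "\<i> * lam1 (s\<^sup>2) b / (2 * S)"])
       (use S in \<open>simp add: * S_def[symmetric] field_simps ii\<close>)
  show "\<exists>\<gamma>1 \<gamma>2 \<gamma>3 \<gamma>4. \<forall>k1 k2 k3 k4. cderiv \<gamma>1 \<gamma>2 \<gamma>3 \<gamma>4 (emono s b k1 k2 k3 k4) = (\<lambda>X. of_nat k2 * emono s b k1 (k2 - 1) k3 k4 X)"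
    by (rule exI[of _ 0], rule exI[of _ 0], rule exI[of _ "1 / (2 * S)"], rule exI[of _ "\<i> / (2 * S)"])
       (use S in \<open>simp add: * S_def[symmetric] field_simps ii\<close>)
  show "\<exists>\<gamma>1 \<gamma>2 \<gamma>3 \<gamma>4. \<forall>k1 k2 k3 k4. cderiv \<gamma>1 \<gamma>2 \<gamma>3 \<gamma>4 (emono s b k1 k2 k3 k4) = (\<lambda>X. of_nat k3 * emono s b k1 k2 (k3 - 1) k4 X)"
    by (rule exI[of _ "1/2"], rule exI[of _ "-\<i>/2"], rule exI[of _ "lam3 (s\<^sup>2) b / (2 * S)"], rule exI[of _ "- \<i> * lam3 (s\<^sup>2) b / (2 * S)"])
       (use S in \<open>simp add: * S_def[symmetric] field_simps ii\<close>)
  show "\<exists>\<gamma>1 \<gamma>2 \<gamma>3 \<gamma>4. \<forall>k1 k2 k3 k4. cderiv \<gamma>1 \<gamma>2 \<gamma>3 \<gamma>4 (emono s b k1 k2 k3 k4) = (\<lambda>X. of_nat k4 * emono s b k1 k2 k3 (k4 - 1) X)"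
    by (rule exI[of _ 0], rule exI[of _ 0], rule exI[of _ "1 / (2 * S)"], rule exI[of _ "- \<i> / (2 * S)"])
       (use S in \<open>simp add: * S_def[symmetric] field_simps ii\<close>)
qed

text \<open>Differentiating \<open>k1\<close>, \<open>k2\<close>, \<open>k3\<close>, \<open>k4\<close> times in the dual directions and evaluating at the origin
extracts one coefficient of a polynomial, up to a product of factorials. In particular the monomials
are linearly independent as functions.\<close>

lemma coefficient_functional:
  assumes s: "s \<noteq> 0"
  shows "\<exists>\<Xi>. lin_functional \<Xi> \<and> (\<forall>j1 j2 j3 j4. \<Xi> (emono s b j1 j2 j3 j4) \<noteq> 0 \<longleftrightarrow> j1 = k1 \<and> j2 = k2 \<and> j3 = k3 \<and> j4 = k4)"
    (is "\<exists>\<Xi>. _ \<and> ?P \<Xi> k1 k2 k3 k4")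
proof -
  have scale: "\<Xi> (\<lambda>X. c * emono s b j1 j2 j3 j4 X) = c * \<Xi> (emono s b j1 j2 j3 j4)" if "lin_functional \<Xi>" for \<Xi> c j1 j2 j3 j4
  proof -
    have "\<Xi> (\<lambda>X. 0 + c * emono s b j1 j2 j3 j4 X) = \<Xi> (\<lambda>X. 0) + c * \<Xi> (emono s b j1 j2 j3 j4)"
      "\<Xi> (\<lambda>X. 0 + 1 * 0) = \<Xi> (\<lambda>X. 0) + 1 * \<Xi> (\<lambda>X. 0)"
      using that smooth_const[of 0] smooth_emono unfolding lin_functional_def by blast+
    then show ?thesis by simp
  qed
  define Q where "Q = (\<lambda>k1 k2 k3 k4. \<exists>\<Xi>. lin_functional \<Xi> \<and> ?P \<Xi> k1 k2 k3 k4)"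
  have base: "Q 0 0 0 0"
    unfolding Q_def
  proof (intro exI[of _ "\<lambda>f. f 0"] conjI)
    have "eig1 0 = 0" "eig2 s b 0 = 0" "eig3 0 = 0" "eig4 s b 0 = 0"
      using bounded_linear_eig[THEN bounded_linear.linear, THEN linear_0] by auto
    then show "\<forall>j1 j2 j3 j4. emono s b j1 j2 j3 j4 0 \<noteq> 0 \<longleftrightarrow> j1 = 0 \<and> j2 = 0 \<and> j3 = 0 \<and> j4 = 0"
      by (auto simp: emono_def)
  qed (simp add: lin_functional_def)
  note step = lin_functional_cderiv scale
  have 1: "Q (Suc k1) k2 k3 k4" if Q: "Q k1 k2 k3 k4" for k1 k2 k3 k4
  proof -
    from Q obtain \<Xi> where X: "lin_functional \<Xi>" "?P \<Xi> k1 k2 k3 k4" unfolding Q_def by blast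
    from cderiv_emono(1)[OF s, of b] obtain \<gamma>1 \<gamma>2 \<gamma>3 \<gamma>4 where 
     g: "\<And>k1 k2 k3 k4. cderiv \<gamma>1 \<gamma>2 \<gamma>3 \<gamma>4 (emono s b k1 k2 k3 k4) = (\<lambda>X. of_nat k1 * emono s b (k1 - 1) k2 k3 k4 X)"
      by blast
    show ?thesis unfolding Q_def
      by (rule exI[of _ "\<lambda>f. \<Xi> (cderiv \<gamma>1 \<gamma>2 \<gamma>3 \<gamma>4 f)"]) (use X in \<open>auto simp: g step\<close>)
  qed
  have 2: "Q k1 (Suc k2) k3 k4" if Q: "Q k1 k2 k3 k4" for k1 k2 k3 k4
  proof -
    from Q obtain \<Xi> where X: "lin_functional \<Xi>" "?P \<Xi> k1 k2 k3 k4" unfolding Q_def by blast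
    from cderiv_emono(2)[OF s, of b] obtain \<gamma>1 \<gamma>2 \<gamma>3 \<gamma>4 where 
     g: "\<And>k1 k2 k3 k4. cderiv \<gamma>1 \<gamma>2 \<gamma>3 \<gamma>4 (emono s b k1 k2 k3 k4) = (\<lambda>X. of_nat k2 * emono s b k1 (k2 - 1) k3 k4 X)"
      by blast
    show ?thesis unfolding Q_def
      by (rule exI[of _ "\<lambda>f. \<Xi> (cderiv \<gamma>1 \<gamma>2 \<gamma>3 \<gamma>4 f)"]) (use X in \<open>auto simp: g step\<close>)
  qed
  have 3: "Q k1 k2 (Suc k3) k4" if Q: "Q k1 k2 k3 k4" for k1 k2 k3 k4
  proof -
    from Q obtain \<Xi> where X: "lin_functional \<Xi>" "?P \<Xi> k1 k2 k3 k4" unfolding Q_def by blast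
    from cderiv_emono(3)[OF s, of b] obtain \<gamma>1 \<gamma>2 \<gamma>3 \<gamma>4 where 
     g: "\<And>k1 k2 k3 k4. cderiv \<gamma>1 \<gamma>2 \<gamma>3 \<gamma>4 (emono s b k1 k2 k3 k4) = (\<lambda>X. of_nat k3 * emono s b k1 k2 (k3 - 1) k4 X)"
      by blast
    show ?thesis unfolding Q_def
      by (rule exI[of _ "\<lambda>f. \<Xi> (cderiv \<gamma>1 \<gamma>2 \<gamma>3 \<gamma>4 f)"]) (use X in \<open>auto simp: g step\<close>)
  qed
  have 4: "Q k1 k2 k3 (Suc k4)" if Q: "Q k1 k2 k3 k4" for k1 k2 k3 k4
  proof -
    from Q obtain \<Xi> where X: "lin_functional \<Xi>" "?P \<Xi> k1 k2 k3 k4" unfolding Q_def by blast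
    from cderiv_emono(4)[OF s, of b] obtain \<gamma>1 \<gamma>2 \<gamma>3 \<gamma>4 where 
     g: "\<And>k1 k2 k3 k4. cderiv \<gamma>1 \<gamma>2 \<gamma>3 \<gamma>4 (emono s b k1 k2 k3 k4) = (\<lambda>X. of_nat k4 * emono s b k1 k2 k3 (k4 - 1) X)"
      by blast
    show ?thesis unfolding Q_def
      by (rule exI[of _ "\<lambda>f. \<Xi> (cderiv \<gamma>1 \<gamma>2 \<gamma>3 \<gamma>4 f)"]) (use X in \<open>auto simp: g step\<close>)
  qed
  have "Q k1 0 0 0" for k1 by (induction k1) (auto intro: base 1)
  then have "Q k1 k2 0 0" for k1 k2 by (induction k2) (auto intro: 2)
  then have "Q k1 k2 k3 0" for k1 k2 k3 by (induction k3) (auto intro: 3)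
  then have "Q k1 k2 k3 k4" for k1 k2 k3 k4 by (induction k4) (auto intro: 4)
  then show ?thesis unfolding Q_def by blast
qed

lemma emono_notin_lower_span:
  assumes s: "s \<noteq> 0" shows "\<not> lower_span s b (weight k1 k2 k3 k4) (emono s b k1 k2 k3 k4)"
proof
  assume lower_span: "lower_span s b (weight k1 k2 k3 k4) (emono s b k1 k2 k3 k4)"
  obtain \<Xi> where X: "lin_functional \<Xi>" 
    "\<And>j1 j2 j3 j4. \<Xi> (emono s b j1 j2 j3 j4) \<noteq> 0 \<longleftrightarrow> j1 = k1 \<and> j2 = k2 \<and> j3 = k3 \<and> j4 = k4"
    using coefficient_functional[OF s] by blast
  have "\<Xi> f = 0" if "lower_span s b (weight k1 k2 k3 k4) f" for f
    using that
  proof (induction rule: lower_span.induct)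
    case zero
    have "\<Xi> (\<lambda>X. 0 + 1 * 0) = \<Xi> (\<lambda>X. 0) + 1 * \<Xi> (\<lambda>X. 0)"
      using X(1) smooth_const[of 0] unfolding lin_functional_def by blast
    then show ?case by simp
  next
    case (step f j1 j2 j3 j4 c)
    have "\<Xi> (emono s b j1 j2 j3 j4) = 0" using step.hyps(2) X(2)[of j1 j2 j3 j4] by fastforce
    then show ?case
      using X(1) lower_span_smooth[OF step.hyps(1)] smooth_emono step.IH unfolding lin_functional_def by simp
  qed
  from this[OF lower_span] X(2)[of k1 k2 k3 k4] show False by simp
qed

text \<open>Among the indices with the same value of \<open>alpha\<close> choose one of least weight, with monomial \<open>Y\<close>. On
the span of smaller weight \<open>L - \<mu>\<close> is surjective, so \<open>(L - \<mu>) Y\<close>, which lies in that span, equals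
\<open>(L - \<mu>) r\<close> for some \<open>r\<close> in it. Then \<open>Y - r\<close> is an eigenfunction, and it is nonzero because \<open>Y\<close> is not in the span.
The choice of least weight handles resonances between the numbers \<open>alpha\<close>.\<close>

lemma conj_KFP_eigenfunction:
  assumes s: "s \<noteq> 0"
  obtains p x where "smooth p" "exp_growth p" "p x \<noteq> 0" "\<And>X. conj_KFP s b p X = alpha (s\<^sup>2) b k1 k2 k3 k4 * p X"
proof -
  define \<mu> where "\<mu> = alpha (s\<^sup>2) b k1 k2 k3 k4"
  \<comment> \<open>Least weight, so that \<open>\<mu>\<close> is not a diagonal entry in smaller weight.\<close>
  define n where "n = (LEAST n. \<exists>j1 j2 j3 j4. weight j1 j2 j3 j4 = n \<and> alpha (s\<^sup>2) b j1 j2 j3 j4 = \<mu>)"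
  have "\<exists>j1 j2 j3 j4. weight j1 j2 j3 j4 = n \<and> alpha (s\<^sup>2) b j1 j2 j3 j4 = \<mu>"
    unfolding n_def by (rule LeastI[of _ "weight k1 k2 k3 k4"]) (use \<mu>_def in blast)
  then obtain j1 j2 j3 j4 where j: "weight j1 j2 j3 j4 = n" "alpha (s\<^sup>2) b j1 j2 j3 j4 = \<mu>" by blast
  have least: "alpha (s\<^sup>2) b i1 i2 i3 i4 \<noteq> \<mu>" if "weight i1 i2 i3 i4 < n" for i1 i2 i3 i4
    using not_less_Least[OF that[unfolded n_def]] by blast
  define Y where "Y = emono s b j1 j2 j3 j4"
  obtain q where q: "lower_span s b n q" "\<And>X. conj_KFP s b Y X = \<mu> * Y X + q X"
    using conj_KFP_emono_lower_span[of s b j1 j2 j3 j4] unfolding j Y_def by blast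
  obtain r where r: "lower_span s b n r" "\<And>X. conj_KFP s b r X - \<mu> * r X = q X"
    using conj_KFP_lower_span_surjective[OF least q(1)] by blast
  define p where "p = (\<lambda>X. Y X + (- 1) * r X)"
  note S = smooth_emono[of s b j1 j2 j3 j4, folded Y_def] lower_span_smooth[OF r(1)] smooth_mult smooth_const
  have "smooth p" unfolding p_def by (intro smooth_add S)
  moreover have "exp_growth p" unfolding p_def Y_def
    by (intro exp_growth_add exp_growth_mult exp_growth_const exp_growth_emono lower_span_exp_growth[OF r(1)])
  moreover have "conj_KFP s b p X = \<mu> * p X" for X
  proof -
    have "conj_KFP s b p X = conj_KFP s b Y X + (- 1) * conj_KFP s b r X"
      unfolding p_def by (simp only: conj_KFP_add conj_KFP_cmult S)
    then show ?thesis using q(2)[of X] r(2)[of X] by (simp add: p_def algebra_simps)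
  qed
  moreover have "\<exists>x. p x \<noteq> 0"
  proof (rule ccontr)
    assume "\<nexists>x. p x \<noteq> 0"
    then have "Y = r" by (auto simp: p_def fun_eq_iff)
    with r(1) j(1) emono_notin_lower_span[OF s] show False unfolding Y_def by metis
  qed
  ultimately show thesis using that \<mu>_def by blast
qed

lemma continuous_AE_zero:
  fixes f :: "'a::euclidean_space \<Rightarrow> 'b::real_normed_vector"
  assumes "continuous_on UNIV f" "AE x in lborel. f x = 0" shows "f x = 0"
proof (rule ccontr)
  assume "f x \<noteq> 0"
  have "open {x. f x \<noteq> 0}" by (intro open_Collect_neq assms continuous_intros)
  moreover have "{x. f x \<noteq> 0} \<in> null_sets lborel"
    using assms(2) borel_open[OF \<open>open {x. f x \<noteq> 0}\<close>] AE_iff_null[of lborel "\<lambda>x. f x = 0"] by simp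
  then have "negligible {x. f x \<noteq> 0}"
    by (simp add: negligible_iff_null_sets null_sets_completionI)
  ultimately show False using open_not_negligible \<open>f x \<noteq> 0\<close> by blast
qed

lemma alpha_generalized_eigenvalue:
  assumes "a > 0" shows "generalized_eigenvalue a b (alpha a b k1 k2 k3 k4)"
proof -
  define \<mu> where "\<mu> = alpha a b k1 k2 k3 k4"
  have "sqrt a \<noteq> 0" using assms by simp
  then obtain p x where p: "smooth p" "exp_growth p" "p x \<noteq> 0" "\<And>X. conj_KFP (sqrt a) b p X = alpha ((sqrt a)\<^sup>2) b k1 k2 k3 k4 * p X"
    using conj_KFP_eigenfunction by blast
  define u where "u = (\<lambda>X. p X * gauss X)"
  have u: "u \<in> L2" unfolding u_def by (rule exp_growth_gauss_L2[OF p(2)])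
  have su: "smooth u" unfolding u_def by (intro smooth_mult smooth_gauss p)
  have "KFP_fun (sqrt a) b u = (\<lambda>X. \<mu> * u X)"
    unfolding u_def KFP_fun_mult_gauss[OF p(1)] p(4) \<mu>_def using assms by (simp add: mult.assoc)
  then have "KFP a b (dist_of u) \<phi> = dist_of (\<lambda>X. \<mu> * u X) \<phi>" if "\<phi> \<in> test_functions" for \<phi>
    using dist_of_KFP[OF su that] by simp
  then have graph: "(u, \<lambda>X. \<mu> * u X) \<in> KFP_graph a b"
    using u L2_cmult[OF u] by (simp add: KFP_graph_def)
  have "\<not> (AE X in lborel. u X = 0)"
    using continuous_AE_zero[OF smooth_continuous[OF su], of x] p(3) by (auto simp: u_def gauss_def)
  moreover have "(u, \<lambda>X. 0) \<in> KFP_shift_graph a b \<mu>"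
    unfolding KFP_shift_graph_def using graph by (intro CollectI exI[of _ u] exI[of _ "\<lambda>X. \<mu> * u X"]) simp
  moreover have "u \<in> Domain (KFP_graph a b)" using graph by blast
  ultimately show ?thesis
    unfolding generalized_eigenvalue_def \<mu>_def[symmetric] by (intro exI[of _ 1]) auto
qed

section \<open>Completeness of the Hermite functions\<close>

lemma L2_gauss_integrable:
  assumes "w \<in> L2" "exp_growth F"
  shows "integrable lborel (\<lambda>X. w X * (F X * gauss X))"
  by (rule L2_mult_integrable[OF assms(1) exp_growth_gauss_L2[OF assms(2)]])

lemma L2_measurable: "w \<in> L2 \<Longrightarrow> w \<in> borel_measurable borel"
  by (simp add: L2_def)

lemma gauss_dominated_convergence:
  assumes w: "w \<in> L2" and F: "exp_growth F" and G: "exp_growth G"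
    and c: "\<And>n. c n \<in> borel_measurable borel" "\<And>n X. cmod (c n X) \<le> cmod (G X)"
    and lim: "\<And>X. (\<lambda>n. c n X) \<longlonglongrightarrow> d X"
  shows "(\<lambda>n. \<integral>X. w X * (c n X * F X * gauss X) \<partial>lborel) \<longlonglongrightarrow> (\<integral>X. w X * (d X * F X * gauss X) \<partial>lborel)"
proof (rule integral_dominated_convergence)
  note [measurable] = L2_measurable[OF w] exp_growth_measurable[OF F] c(1)
  have d [measurable]: "d \<in> borel_measurable borel"
    by (rule borel_measurable_LIMSEQ_metric[OF c(1) lim])
  show "(\<lambda>X. w X * (d X * F X * gauss X)) \<in> borel_measurable lborel" by simp
  show "(\<lambda>X. w X * (c n X * F X * gauss X)) \<in> borel_measurable lborel" for n by simp
  show "integrable lborel (\<lambda>X. cmod (w X * (G X * F X * gauss X)))"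
    by (intro integrable_norm L2_gauss_integrable w exp_growth_mult F G)
  show "AE X in lborel. (\<lambda>n. w X * (c n X * F X * gauss X)) \<longlonglongrightarrow> w X * (d X * F X * gauss X)"
    by (intro AE_I2 tendsto_intros lim)
  show "AE X in lborel. norm (w X * (c n X * F X * gauss X)) \<le> cmod (w X * (G X * F X * gauss X))" for n
    by (intro AE_I2) (auto simp: norm_mult intro!: mult_left_mono mult_right_mono c(2))
qed

text \<open>Functions \<open>h\<close> such that \<open>w h g\<close> is orthogonal to all polynomials, where \<open>g\<close> is the Gaussian. Asking
this for all monomials, and not only for \<open>h\<close> itself, makes the set stable under multiplication by
polynomials.\<close>

definition annihilated :: "real \<Rightarrow> real \<Rightarrow> (phase \<Rightarrow> complex) \<Rightarrow> (phase \<Rightarrow> complex) \<Rightarrow> bool" where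
  "annihilated s b w h \<longleftrightarrow> exp_growth h \<and>
     (\<forall>k1 k2 k3 k4. (\<integral>X. w X * ((h X * emono s b k1 k2 k3 k4 X) * gauss X) \<partial>lborel) = 0)"

lemma annihilated_integrable:
  assumes "w \<in> L2" "annihilated s b w h"
  shows "integrable lborel (\<lambda>X. w X * ((h X * emono s b k1 k2 k3 k4 X) * gauss X))"
  using assms by (intro L2_gauss_integrable exp_growth_mult exp_growth_emono) (auto simp: annihilated_def)

lemma annihilated_add:
  assumes w: "w \<in> L2" and "annihilated s b w f" "annihilated s b w h"
  shows "annihilated s b w (\<lambda>X. f X + h X)"
  unfolding annihilated_def
proof (intro conjI allI)
  show "exp_growth (\<lambda>X. f X + h X)" using assms by (intro exp_growth_add) (auto simp: annihilated_def)
  fix k1 k2 k3 k4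
  have "(\<integral>X. w X * (((f X + h X) * emono s b k1 k2 k3 k4 X) * gauss X) \<partial>lborel) =
    (\<integral>X. w X * ((f X * emono s b k1 k2 k3 k4 X) * gauss X) + w X * ((h X * emono s b k1 k2 k3 k4 X) * gauss X) \<partial>lborel)"
    by (simp add: algebra_simps)
  also have "\<dots> = (\<integral>X. w X * ((f X * emono s b k1 k2 k3 k4 X) * gauss X) \<partial>lborel) + (\<integral>X. w X * ((h X * emono s b k1 k2 k3 k4 X) * gauss X) \<partial>lborel)"
    by (rule Bochner_Integration.integral_add[OF annihilated_integrable annihilated_integrable]) (use assms in auto)
  finally show "(\<integral>X. w X * (((f X + h X) * emono s b k1 k2 k3 k4 X) * gauss X) \<partial>lborel) = 0"
    using assms by (simp add: annihilated_def)
qed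

lemma annihilated_cmult:
  assumes "annihilated s b w h"
  shows "annihilated s b w (\<lambda>X. c * h X)"
  unfolding annihilated_def
proof (intro conjI allI)
  show "exp_growth (\<lambda>X. c * h X)"
    using assms by (intro exp_growth_mult exp_growth_const) (auto simp: annihilated_def)
  fix k1 k2 k3 k4
  have "(\<integral>X. w X * (((c * h X) * emono s b k1 k2 k3 k4 X) * gauss X) \<partial>lborel) =
    (\<integral>X. c * (w X * ((h X * emono s b k1 k2 k3 k4 X) * gauss X)) \<partial>lborel)"
    by (simp add: mult_ac)
  then show "(\<integral>X. w X * (((c * h X) * emono s b k1 k2 k3 k4 X) * gauss X) \<partial>lborel) = 0"
    using assms by (simp add: annihilated_def)
qed

lemma annihilated_sum:
  assumes "w \<in> L2" "\<And>i. i \<in> I \<Longrightarrow> annihilated s b w (f i)"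
  shows "annihilated s b w (\<lambda>X. \<Sum>i\<in>I. f i X)"
proof -
  have "annihilated s b w (\<lambda>X. 0)" by (simp add: annihilated_def exp_growth_const)
  then show ?thesis
    using assms(2) by (induction I rule: infinite_finite_induct) (simp_all add: annihilated_add assms(1))
qed

lemma annihilated_eig:
  assumes "annihilated s b w h"
  shows "annihilated s b w (\<lambda>X. eig1 X * h X)" "annihilated s b w (\<lambda>X. eig2 s b X * h X)"
    "annihilated s b w (\<lambda>X. eig3 X * h X)" "annihilated s b w (\<lambda>X. eig4 s b X * h X)"
proof -
  have h: "exp_growth h" using assms by (simp add: annihilated_def)
  have z: "(\<integral>X. w X * ((h X * emono s b k1 k2 k3 k4 X) * gauss X) \<partial>lborel) = 0" for k1 k2 k3 k4
    using assms by (simp add: annihilated_def)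
  note E = bounded_linear_eig[THEN exp_growth_linear]
  show "annihilated s b w (\<lambda>X. eig1 X * h X)"
    using z[of "Suc _"] by (auto simp: annihilated_def emono_Suc mult_ac intro: exp_growth_mult E h)
  show "annihilated s b w (\<lambda>X. eig2 s b X * h X)"
    using z[of _ "Suc _"] by (auto simp: annihilated_def emono_Suc mult_ac intro: exp_growth_mult E h)
  show "annihilated s b w (\<lambda>X. eig3 X * h X)"
    using z[of _ _ "Suc _"] by (auto simp: annihilated_def emono_Suc mult_ac intro: exp_growth_mult E h)
  show "annihilated s b w (\<lambda>X. eig4 s b X * h X)"
    using z[of _ _ _ "Suc _"] by (auto simp: annihilated_def emono_Suc mult_ac intro: exp_growth_mult E h)
qed

lemma Basis_phase:
  assumes "e \<in> (Basis :: phase set)" obtains j where "e = xdir j" | j where "e = vdir j"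
  using assms by (auto simp: Basis_prod_def Basis_vec_def)

text \<open>Each real coordinate is a linear combination of the four forms, with coefficients found by inverting
the change of variables.\<close>

lemma annihilated_coordinate:
  assumes w: "w \<in> L2" and s: "s \<noteq> 0" and h: "annihilated s b w h" and e: "e \<in> Basis"
  shows "annihilated s b w (\<lambda>X. of_real (X \<bullet> e) * h X)"
proof -
  define E1 E2 E3 E4 where "E1 = (\<lambda>X. eig1 X * h X)" "E2 = (\<lambda>X. eig2 s b X * h X)"
    "E3 = (\<lambda>X. eig3 X * h X)" "E4 = (\<lambda>X. eig4 s b X * h X)"
  note E = annihilated_eig[OF h, folded E1_E2_E3_E4_def]
  define \<sigma> where "\<sigma> = complex_of_real s"
  have \<sigma>: "\<sigma> \<noteq> 0" using s by (simp add: \<sigma>_def)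
  define l1 l3 where "l1 = lam1 (s\<^sup>2) b" "l3 = lam3 (s\<^sup>2) b"
  note defs = E1_E2_E3_E4_def eig1_def eig3_def eig2_def eig4_def zx_def zv_def \<sigma>_def[symmetric] l1_l3_def[symmetric]
  have two: "(i::2) = 1 \<or> i = 2" for i using exhaust_2 by blast
  have x1: "(\<lambda>X. of_real (xc 1 X) * h X) = (\<lambda>X. 1/2 * E1 X + 1/2 * E3 X)"
    unfolding defs by (simp add: fun_eq_iff field_simps)
  have x2: "(\<lambda>X. of_real (xc 2 X) * h X) = (\<lambda>X. \<i>/2 * E1 X + (-\<i>/2) * E3 X)"
    unfolding defs by (simp add: fun_eq_iff field_simps)
  have v1: "(\<lambda>X. of_real (vc 1 X) * h X) = (\<lambda>X. (1/(2*\<sigma>) * E2 X + 1/(2*\<sigma>) * E4 X) + (l1/(2*\<sigma>) * E1 X + l3/(2*\<sigma>) * E3 X))"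
    unfolding defs using \<sigma> by (simp add: fun_eq_iff field_simps)
  have v2: "(\<lambda>X. of_real (vc 2 X) * h X) = (\<lambda>X. (\<i>/(2*\<sigma>) * E2 X + (-\<i>/(2*\<sigma>)) * E4 X) + (\<i>*l1/(2*\<sigma>) * E1 X + (-\<i>*l3/(2*\<sigma>)) * E3 X))"
    unfolding defs using \<sigma> by (simp add: fun_eq_iff field_simps)
  have "annihilated s b w (\<lambda>X. of_real (xc j X) * h X)" "annihilated s b w (\<lambda>X. of_real (vc j X) * h X)" for j
    using two[of j] by (auto simp only: x1 x2 v1 v2 intro!: annihilated_add[OF w] annihilated_cmult E)
  then show ?thesis by (cases rule: Basis_phase[OF e]) (auto simp only: inner_xdir inner_vdir)
qed

lemma annihilated_coordinate_power:
  assumes "w \<in> L2" "s \<noteq> 0" "annihilated s b w h" "e \<in> Basis"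
  shows "annihilated s b w (\<lambda>X. of_real (X \<bullet> e) ^ n * h X)"
proof (induction n)
  case (Suc n)
  from annihilated_coordinate[OF assms(1,2) Suc assms(4)] show ?case by (simp add: mult.assoc)
qed (use assms in simp)

lemma sin_partial_sum_bound: "\<bar>\<Sum>n<N. sin_coeff n * x ^ n\<bar> \<le> exp \<bar>x\<bar>"
proof -
  have "\<bar>\<Sum>n<N. sin_coeff n * x ^ n\<bar> \<le> (\<Sum>n<N. \<bar>sin_coeff n * x ^ n\<bar>)" by (rule sum_abs)
  also have "\<dots> \<le> (\<Sum>n<N. \<bar>x\<bar> ^ n /\<^sub>R fact n)"
    by (intro sum_mono) (auto simp: sin_coeff_def abs_mult power_abs divide_simps)
  also have "\<dots> \<le> (\<Sum>n. \<bar>x\<bar> ^ n /\<^sub>R fact n)"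
    using exp_converges[of "\<bar>x\<bar>"] by (intro sum_le_suminf) (auto simp: sums_iff)
  also have "\<dots> = exp \<bar>x\<bar>" using exp_converges[of "\<bar>x\<bar>"] by (simp add: sums_iff)
  finally show ?thesis .
qed

text \<open>The sine is the limit of its Taylor polynomials, which are majorised by an exponential, and the
Gaussian absorbs that exponential.\<close>

lemma annihilated_sin:
  assumes w: "w \<in> L2" and s: "s \<noteq> 0" and h: "annihilated s b w h" and e: "e \<in> Basis"
  shows "annihilated s b w (\<lambda>X. of_real (sin (\<epsilon> * (X \<bullet> e))) * h X)"
  unfolding annihilated_def
proof (intro conjI allI)
  have hg: "exp_growth h" using h by (simp add: annihilated_def)
  have [measurable]: "(\<lambda>X::phase. X \<bullet> e) \<in> borel_measurable borel" by simp
  have bnd: "exp \<bar>\<epsilon> * (X \<bullet> e)\<bar> \<le> 1 * exp (\<bar>\<epsilon>\<bar> * norm X)" for X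
    using Basis_le_norm[OF e, of X] by (auto simp: abs_mult intro!: mult_left_mono)
  have G: "exp_growth (\<lambda>X. of_real (exp \<bar>\<epsilon> * (X \<bullet> e)\<bar>))"
    unfolding exp_growth_def using bnd by (intro conjI exI[of _ 1] exI[of _ "\<bar>\<epsilon>\<bar>"]) auto
  have "exp_growth (\<lambda>X. of_real (sin (\<epsilon> * (X \<bullet> e))))"
    unfolding exp_growth_def by (intro conjI exI[of _ 1] exI[of _ 0]) auto
  then show "exp_growth (\<lambda>X. of_real (sin (\<epsilon> * (X \<bullet> e))) * h X)" by (rule exp_growth_mult[OF _ hg])
  fix k1 k2 k3 k4
  define c where "c = (\<lambda>N X. complex_of_real (\<Sum>n<N. sin_coeff n * (\<epsilon> * (X \<bullet> e)) ^ n))"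
  have ann: "annihilated s b w (\<lambda>X. c N X * h X)" for N
  proof -
    have "(\<lambda>X. c N X * h X) = (\<lambda>X. \<Sum>n<N. of_real (sin_coeff n * \<epsilon> ^ n) * (of_real (X \<bullet> e) ^ n * h X))"
      unfolding c_def by (simp add: fun_eq_iff sum_distrib_left power_mult_distrib mult_ac)
    then show ?thesis
      by (simp only:) (intro annihilated_sum annihilated_cmult annihilated_coordinate_power assms)
  qed
  have "(\<lambda>N. \<integral>X. w X * (c N X * (h X * emono s b k1 k2 k3 k4 X) * gauss X) \<partial>lborel)
     \<longlonglongrightarrow> (\<integral>X. w X * (of_real (sin (\<epsilon> * (X \<bullet> e))) * (h X * emono s b k1 k2 k3 k4 X) * gauss X) \<partial>lborel)"
  proof (rule gauss_dominated_convergence[OF w _ G])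
    show "exp_growth (\<lambda>X. h X * emono s b k1 k2 k3 k4 X)" by (intro exp_growth_mult hg exp_growth_emono)
    show "c N \<in> borel_measurable borel" for N unfolding c_def by simp
    show "cmod (c N X) \<le> cmod (of_real (exp \<bar>\<epsilon> * (X \<bullet> e)\<bar>))" for N X
      unfolding c_def norm_of_real using sin_partial_sum_bound[where N = N and x = "\<epsilon> * (X \<bullet> e)"] by simp
    show "(\<lambda>N. c N X) \<longlonglongrightarrow> of_real (sin (\<epsilon> * (X \<bullet> e)))" for X
      unfolding c_def using sin_converges[of "\<epsilon> * (X \<bullet> e)"]
      by (intro tendsto_of_real) (simp add: sums_def)
  qed
  moreover have "(\<integral>X. w X * (c N X * (h X * emono s b k1 k2 k3 k4 X) * gauss X) \<partial>lborel) = 0" for N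
    using ann[of N] by (simp add: annihilated_def mult.assoc)
  ultimately show "(\<integral>X. w X * (of_real (sin (\<epsilon> * (X \<bullet> e))) * h X * emono s b k1 k2 k3 k4 X * gauss X) \<partial>lborel) = 0"
    by (simp add: LIMSEQ_const_iff mult.assoc)
qed

text \<open>A bounded substitute for the identity: its range is relatively compact, so that continuous functions
of it can be approximated uniformly by polynomials, and it converges to the identity as \<open>\<epsilon>\<close> tends to
0.\<close>

definition sin_map :: "real \<Rightarrow> phase \<Rightarrow> phase" where
  "sin_map \<epsilon> X = (\<Sum>e\<in>Basis. (sin (\<epsilon> * (X \<bullet> e)) / \<epsilon>) *\<^sub>R e)"

lemma annihilated_polynomial_sin:
  assumes w: "w \<in> L2" and s: "s \<noteq> 0" and q: "real_polynomial_function q" and h: "annihilated s b w h"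
  shows "annihilated s b w (\<lambda>X. of_real (q (sin_map \<epsilon> X)) * h X)"
  using q h
proof (induction arbitrary: h)
  case (linear f)
  have "(\<lambda>X. of_real (f (sin_map \<epsilon> X)) * h X) =
      (\<lambda>X. \<Sum>e\<in>Basis. of_real (f e / \<epsilon>) * (of_real (sin (\<epsilon> * (X \<bullet> e))) * h X))"
    using linear(1) by (simp add: sin_map_def fun_eq_iff sum_distrib_right bounded_linear.linear linear_sum linear_scale mult_ac divide_inverse)
  then show ?case
    by (simp only:) (intro annihilated_sum annihilated_cmult annihilated_sin w s linear)
next
  case (const c)
  then show ?case by (intro annihilated_cmult)
next
  case (add f g)
  from annihilated_add[OF w add.IH(1)[OF add.prems] add.IH(2)[OF add.prems]] show ?case
    by (simp add: algebra_simps)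
next
  case (mult f g)
  from mult.IH(1)[OF mult.IH(2)[OF mult.prems]] show ?case by (simp add: mult.assoc)
qed

lemma continuous_sin_map: "continuous_on A (sin_map \<epsilon>)"
  unfolding sin_map_def divide_inverse by (intro continuous_intros)

text \<open>The Stone-Weierstrass theorem on a ball containing the range of \<open>sin_map \<epsilon>\<close> gives the vanishing of
the integral with \<open>\<Phi> \<circ> sin_map \<epsilon>\<close>, and then \<open>\<epsilon>\<close> tends to 0.\<close>

lemma annihilated_continuous:
  assumes w: "w \<in> L2" and s: "s \<noteq> 0" and one: "annihilated s b w (\<lambda>X. 1)"
    and \<Phi>: "continuous_on UNIV \<Phi>" "\<And>X. \<bar>\<Phi> X\<bar> \<le> (B::real)"
  shows "(\<integral>X. w X * (of_real (\<Phi> X) * gauss X) \<partial>lborel) = 0"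
proof -
  define I where "I = (\<integral>X. cmod (w X * (1 * gauss X)) \<partial>lborel)"
  have int1: "integrable lborel (\<lambda>X. w X * (1 * gauss X))" by (rule L2_gauss_integrable[OF w exp_growth_const])
  have meas: "(\<lambda>X. complex_of_real (\<Phi> (sin_map \<epsilon> X))) \<in> borel_measurable borel" for \<epsilon>
    by (rule borel_measurable_continuous_onI, rule continuous_on_of_real,
        rule continuous_on_compose2[OF \<Phi>(1) continuous_sin_map]) auto
  have zero: "(\<integral>X. w X * (of_real (\<Phi> (sin_map \<epsilon> X)) * gauss X) \<partial>lborel) = 0" if eps: "\<epsilon> > 0" for \<epsilon>
  proof -
    \<comment> \<open>The sine is bounded by 1, so each coordinate of \<open>sin_map \<epsilon> X\<close> is at most \<open>1 / \<epsilon>\<close>.\<close>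
    define K :: "phase set" where "K = cball 0 (\<Sum>e\<in>(Basis::phase set). 1 / \<epsilon>)"
    have inK: "sin_map \<epsilon> X \<in> K" for X
    proof -
      have "norm (sin_map \<epsilon> X) \<le> (\<Sum>e\<in>(Basis::phase set). 1 / \<epsilon>)"
        unfolding sin_map_def by (rule sum_norm_le) (use eps in \<open>auto simp: divide_simps\<close>)
      then show ?thesis by (simp add: K_def)
    qed
    have gphi: "exp_growth (\<lambda>X. of_real (\<Phi> (sin_map \<epsilon> X)))"
      unfolding exp_growth_def using meas \<Phi>(2) by (intro conjI exI[of _ B] exI[of _ 0]) auto
    have small: "cmod (\<integral>X. w X * (of_real (\<Phi> (sin_map \<epsilon> X)) * gauss X) \<partial>lborel) \<le> \<delta> * I" if "\<delta> > 0" for \<delta>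
    proof -
      obtain q where q: "real_polynomial_function q" "\<And>X. X \<in> K \<Longrightarrow> \<bar>\<Phi> X - q X\<bar> < \<delta>"
        by (rule Stone_Weierstrass_real_polynomial_function[of K \<Phi> \<delta>])
           (use \<open>\<delta> > 0\<close> continuous_on_subset[OF \<Phi>(1)] in \<open>simp_all add: K_def\<close>)
      have ann: "annihilated s b w (\<lambda>X. of_real (q (sin_map \<epsilon> X)) * 1)"
        by (rule annihilated_polynomial_sin[OF w s q(1) one])
      then have gq: "exp_growth (\<lambda>X. of_real (q (sin_map \<epsilon> X)))" by (simp add: annihilated_def)
      have zq: "(\<integral>X. w X * (of_real (q (sin_map \<epsilon> X)) * gauss X) \<partial>lborel) = 0"
      proof -
        have "(\<integral>X. w X * ((of_real (q (sin_map \<epsilon> X)) * 1) * emono s b 0 0 0 0 X * gauss X) \<partial>lborel) = 0"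
          using ann unfolding annihilated_def by blast
        then show ?thesis by (simp add: emono_def)
      qed
      have "(\<integral>X. w X * (of_real (\<Phi> (sin_map \<epsilon> X)) * gauss X) \<partial>lborel)
         = (\<integral>X. w X * (of_real (\<Phi> (sin_map \<epsilon> X)) * gauss X) - w X * (of_real (q (sin_map \<epsilon> X)) * gauss X) \<partial>lborel)"
        by (subst Bochner_Integration.integral_diff[OF L2_gauss_integrable[OF w gphi] L2_gauss_integrable[OF w gq]])
           (simp add: zq)
      also have "\<dots> = (\<integral>X. of_real (\<Phi> (sin_map \<epsilon> X) - q (sin_map \<epsilon> X)) * (w X * (1 * gauss X)) \<partial>lborel)"
        by (simp add: algebra_simps)
      also have "cmod \<dots> \<le> (\<integral>X. \<delta> * cmod (w X * (1 * gauss X)) \<partial>lborel)"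
      proof (rule Bochner_Integration.integral_norm_bound_integral)
        have "integrable lborel (\<lambda>X. w X * (of_real (\<Phi> (sin_map \<epsilon> X)) * gauss X) - w X * (of_real (q (sin_map \<epsilon> X)) * gauss X))"
          by (intro Bochner_Integration.integrable_diff L2_gauss_integrable w gphi gq)
        then show "integrable lborel (\<lambda>X. of_real (\<Phi> (sin_map \<epsilon> X) - q (sin_map \<epsilon> X)) * (w X * (1 * gauss X)))"
          by (simp add: algebra_simps)
        show "integrable lborel (\<lambda>X. \<delta> * cmod (w X * (1 * gauss X)))"
          by (intro integrable_mult_right integrable_norm int1)
        show "cmod (of_real (\<Phi> (sin_map \<epsilon> X) - q (sin_map \<epsilon> X)) * (w X * (1 * gauss X))) \<le> \<delta> * cmod (w X * (1 * gauss X))" for X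
          unfolding norm_mult[of "of_real _"] norm_of_real
          by (rule mult_right_mono[OF less_imp_le[OF q(2)[OF inK]]]) simp
      qed
      also have "\<dots> = \<delta> * I" by (simp add: I_def)
      finally show ?thesis .
    qed
    have I0: "I \<ge> 0" unfolding I_def by simp
    have "cmod (\<integral>X. w X * (of_real (\<Phi> (sin_map \<epsilon> X)) * gauss X) \<partial>lborel) \<le> 0"
    proof (rule field_le_epsilon)
      fix r :: real assume "r > 0"
      have "r / (I + 1) * I \<le> r" using \<open>r > 0\<close> I0 by (simp add: divide_simps mult_left_mono)
      then show "cmod (\<integral>X. w X * (of_real (\<Phi> (sin_map \<epsilon> X)) * gauss X) \<partial>lborel) \<le> 0 + r"
        using small[of "r / (I + 1)"] \<open>r > 0\<close> I0 by simp
    qed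
    then show ?thesis by simp
  qed
  define \<epsilon> where "\<epsilon> = (\<lambda>n. inverse (real (Suc n)))"
  have eps0: "\<epsilon> \<longlonglongrightarrow> 0" unfolding \<epsilon>_def by (rule LIMSEQ_inverse_real_of_nat)
  have epos: "\<epsilon> n > 0" for n by (simp add: \<epsilon>_def)
  have "(\<lambda>n. \<integral>X. w X * (of_real (\<Phi> (sin_map (\<epsilon> n) X)) * 1 * gauss X) \<partial>lborel)
      \<longlonglongrightarrow> (\<integral>X. w X * (of_real (\<Phi> X) * 1 * gauss X) \<partial>lborel)"
  proof (rule gauss_dominated_convergence[OF w exp_growth_const exp_growth_const])
    show "(\<lambda>X. complex_of_real (\<Phi> (sin_map (\<epsilon> n) X))) \<in> borel_measurable borel" for n
      by (rule meas)
    show "cmod (complex_of_real (\<Phi> (sin_map (\<epsilon> n) X))) \<le> cmod (of_real B)" for n X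
      using \<Phi>(2)[of "sin_map (\<epsilon> n) X"] by simp
    show "(\<lambda>n. complex_of_real (\<Phi> (sin_map (\<epsilon> n) X))) \<longlonglongrightarrow> of_real (\<Phi> X)" for X
    proof (intro tendsto_of_real)
      have "(\<lambda>n. sin (\<epsilon> n * t) / \<epsilon> n) \<longlonglongrightarrow> t" for t
      proof -
        have "((\<lambda>h. (sin (0 + h * t) - sin 0) / h) \<longlongrightarrow> t) (at 0)"
        proof -
          have "((\<lambda>h. sin (h * t)) has_real_derivative t) (at 0)"
            by (auto intro!: derivative_eq_intros)
          then show ?thesis by (simp add: DERIV_def)
        qed
        moreover have "filterlim \<epsilon> (at 0) sequentially"
          using eps0 epos by (intro filterlim_atI always_eventually allI) (auto simp: less_le)
        ultimately show ?thesis using filterlim_compose by fastforce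
      qed
      then have "(\<lambda>n. sin_map (\<epsilon> n) X) \<longlonglongrightarrow> (\<Sum>e\<in>Basis. (X \<bullet> e) *\<^sub>R e)"
        unfolding sin_map_def by (intro tendsto_sum tendsto_scaleR tendsto_const)
      then have "(\<lambda>n. sin_map (\<epsilon> n) X) \<longlonglongrightarrow> X" by (simp add: euclidean_representation)
      then show "(\<lambda>n. \<Phi> (sin_map (\<epsilon> n) X)) \<longlonglongrightarrow> \<Phi> X"
        using \<Phi>(1) by (auto intro: continuous_on_tendsto_compose)
    qed
  qed
  then show ?thesis using zero[OF epos] by (simp add: LIMSEQ_const_iff)
qed

text \<open>Continuous functions of the distance approximate indicators of closed sets, and these form an
intersection-stable generator of the Borel sets.\<close>

lemma AE_zero_of_integral_continuous:
  fixes f :: "'a::euclidean_space \<Rightarrow> real"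
  assumes f: "integrable lborel f"
    and z: "\<And>\<Phi> B. continuous_on UNIV \<Phi> \<Longrightarrow> (\<And>x. \<bar>\<Phi> x\<bar> \<le> (B::real)) \<Longrightarrow> (\<integral>x. \<Phi> x * f x \<partial>lborel) = 0"
  shows "AE x in lborel. f x = 0"
proof -
  have [measurable]: "f \<in> borel_measurable borel" using f by auto
  have int: "integrable lborel (\<lambda>x. indicator A x * f x)" if "A \<in> sets borel" for A
    using integrable_mult_indicator[OF _ f, of A] that by simp
  have closed: "(\<integral>x. indicator C x * f x \<partial>lborel) = 0" if C: "closed C" for C
  proof (cases "C = {}")
    case False
    define \<Phi> where "\<Phi> = (\<lambda>n x. max 0 (1 - real n * infdist x C))"
    have cont: "continuous_on UNIV (\<Phi> n)" for n unfolding \<Phi>_def by (intro continuous_intros)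
    have bound: "\<bar>\<Phi> n x\<bar> \<le> 1" for n x unfolding \<Phi>_def by (auto simp: infdist_nonneg)
    have "(\<lambda>n. \<integral>x. \<Phi> n x * f x \<partial>lborel) \<longlonglongrightarrow> (\<integral>x. indicator C x * f x \<partial>lborel)"
    proof (rule integral_dominated_convergence)
      show "integrable lborel (\<lambda>x. \<bar>f x\<bar>)" using f by simp
      show "(\<lambda>x. indicator C x * f x) \<in> borel_measurable lborel" using C by (simp add: borel_closed)
      show "(\<lambda>x. \<Phi> n x * f x) \<in> borel_measurable lborel" for n
        using borel_measurable_continuous_onI[OF cont] by simp
      show "AE x in lborel. norm (\<Phi> n x * f x) \<le> \<bar>f x\<bar>" for n
        using bound by (auto simp: abs_mult intro!: mult_left_le_one_le)
      have "(\<lambda>n. \<Phi> n x) \<longlonglongrightarrow> indicator C x" for x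
      proof (cases "x \<in> C")
        case True
        then show ?thesis by (simp add: \<Phi>_def)
      next
        case x: False
        then have d: "infdist x C > 0"
          using C False in_closed_iff_infdist_zero[of C x] infdist_nonneg[of x C] by fastforce
        obtain N :: nat where N: "real N * infdist x C > 1"
          using reals_Archimedean3[OF d] by blast
        have "\<Phi> n x = 0" if "n \<ge> N" for n
        proof -
          have "real N * infdist x C \<le> real n * infdist x C" using that d by (intro mult_right_mono) auto
          then show ?thesis using N by (simp add: \<Phi>_def)
        qed
        then have "\<forall>\<^sub>F n in sequentially. \<Phi> n x = indicator C x"
          using x by (auto simp: eventually_sequentially)
        then show ?thesis by (rule tendsto_eventually)
      qed
      then show "AE x in lborel. (\<lambda>n. \<Phi> n x * f x) \<longlonglongrightarrow> indicator C x * f x"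
        by (intro AE_I2 tendsto_intros)
    qed
    then show ?thesis using z[OF cont bound] by (simp add: LIMSEQ_const_iff)
  qed simp
  have borel: "(\<integral>x. indicator A x * f x \<partial>lborel) = 0" if "A \<in> sets borel" for A
  proof -
    have "Int_stable (Collect closed :: 'a set set)" by (auto simp: Int_stable_def)
    moreover have "(Collect closed :: 'a set set) \<subseteq> Pow UNIV" by simp
    moreover have "A \<in> sigma_sets UNIV (Collect closed)" using that by (simp add: borel_eq_closed)
    ultimately show ?thesis
    proof (induction rule: sigma_sets_induct_disjoint)
      case (basic A)
      then show ?case using closed by simp
    next
      case empty
      then show ?case by simp
    next
      case (compl A)
      have A: "A \<in> sets borel" using compl(1) by (simp add: borel_eq_closed)
      have "(\<integral>x. indicator (UNIV - A) x * f x \<partial>lborel) = (\<integral>x. indicator UNIV x * f x - indicator A x * f x \<partial>lborel)"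
        by (intro Bochner_Integration.integral_cong) (auto simp: indicator_def)
      also have "\<dots> = (\<integral>x. indicator UNIV x * f x \<partial>lborel) - (\<integral>x. indicator A x * f x \<partial>lborel)"
        by (intro Bochner_Integration.integral_diff int A) simp
      finally show ?case using compl(2) closed[of UNIV] by simp
    next
      case (union A)
      have A: "A i \<in> sets borel" for i using union(2) by (auto simp: borel_eq_closed)
      have "(\<integral>x\<in>(\<Union>i. A i). f x \<partial>lborel) = (\<Sum>i. (\<integral>x\<in>A i. f x \<partial>lborel))"
        using union(1) A f int[of "\<Union>i. A i"]
        by (intro lebesgue_integral_countable_add) (auto simp: disjoint_family_on_def set_integrable_def)
      then show ?case using union(3) by (simp add: set_lebesgue_integral_def)
    qed
  qed
  have "AE x in lborel. f x = (\<lambda>x. 0) x"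
    by (rule density_unique_real[OF f]) (use borel in \<open>auto simp: set_lebesgue_integral_def\<close>)
  then show ?thesis by simp
qed

text \<open>The real and imaginary parts of \<open>w\<close> times the Gaussian integrate to zero against every bounded
continuous function, and the Gaussian has no zeros.\<close>

lemma hermite_complete:
  assumes w: "w \<in> L2" and s: "s \<noteq> 0"
    and z: "\<And>k1 k2 k3 k4. (\<integral>X. w X * (emono s b k1 k2 k3 k4 X * gauss X) \<partial>lborel) = 0"
  shows "AE X in lborel. w X = 0"
proof -
  have one: "annihilated s b w (\<lambda>X. 1)" using z by (simp add: annihilated_def exp_growth_const)
  define f where "f = (\<lambda>X. w X * (1 * gauss X))"
  have f: "integrable lborel f" unfolding f_def by (rule L2_gauss_integrable[OF w exp_growth_const])
  have phi: "(\<integral>X. of_real (\<Phi> X) * f X \<partial>lborel) = 0" "integrable lborel (\<lambda>X. of_real (\<Phi> X) * f X)"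
    if "continuous_on UNIV \<Phi>" "\<And>X. \<bar>\<Phi> X\<bar> \<le> (B::real)" for \<Phi> B
  proof -
    show "(\<integral>X. of_real (\<Phi> X) * f X \<partial>lborel) = 0"
      using annihilated_continuous[OF w s one that] by (simp add: f_def mult_ac)
    have "exp_growth (\<lambda>X. of_real (\<Phi> X))"
      unfolding exp_growth_def using that(2) borel_measurable_continuous_onI[OF continuous_on_of_real[OF that(1)]]
      by (intro conjI exI[of _ B] exI[of _ 0]) auto
    from L2_gauss_integrable[OF w this] show "integrable lborel (\<lambda>X. of_real (\<Phi> X) * f X)"
      by (simp add: f_def mult_ac)
  qed
  have "AE X in lborel. Re (f X) = 0"
  proof (rule AE_zero_of_integral_continuous)
    show "integrable lborel (\<lambda>X. Re (f X))" using f by simp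
    fix \<Phi> :: "phase \<Rightarrow> real" and B assume "continuous_on UNIV \<Phi>" "\<And>X. \<bar>\<Phi> X\<bar> \<le> B"
    note p = phi[OF this]
    have "(\<integral>X. \<Phi> X * Re (f X) \<partial>lborel) = (\<integral>X. Re (of_real (\<Phi> X) * f X) \<partial>lborel)" by simp
    also have "\<dots> = Re (\<integral>X. of_real (\<Phi> X) * f X \<partial>lborel)" by (rule integral_Re[OF p(2)])
    finally show "(\<integral>X. \<Phi> X * Re (f X) \<partial>lborel) = 0" using p(1) by simp
  qed
  moreover have "AE X in lborel. Im (f X) = 0"
  proof (rule AE_zero_of_integral_continuous)
    show "integrable lborel (\<lambda>X. Im (f X))" using f by simp
    fix \<Phi> :: "phase \<Rightarrow> real" and B assume "continuous_on UNIV \<Phi>" "\<And>X. \<bar>\<Phi> X\<bar> \<le> B"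
    note p = phi[OF this]
    have "(\<integral>X. \<Phi> X * Im (f X) \<partial>lborel) = (\<integral>X. Im (of_real (\<Phi> X) * f X) \<partial>lborel)" by simp
    also have "\<dots> = Im (\<integral>X. of_real (\<Phi> X) * f X \<partial>lborel)" by (rule integral_Im[OF p(2)])
    finally show "(\<integral>X. \<Phi> X * Im (f X) \<partial>lborel) = 0" using p(1) by simp
  qed
  ultimately show ?thesis
  proof eventually_elim
    case (elim X)
    then have "f X = 0" by (simp add: complex_eq_iff)
    then show ?case by (simp add: f_def gauss_def)
  qed
qed

section \<open>All generalized eigenvalues\<close>

lemma exp_growth_vc: "exp_growth (\<lambda>X. of_real (vc j X))"
  by (rule exp_growth_linear[OF bounded_linear_vc])

lemma exp_growth_dir_deriv_emono: "exp_growth (dir_deriv e (emono s b k1 k2 k3 k4))"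
  unfolding dir_deriv_emono by (intro exp_growth_add exp_growth_mult exp_growth_const exp_growth_emono)

lemma exp_growth_conj_KFP_emono: "exp_growth (conj_KFP s b (emono s b k1 k2 k3 k4))"
proof -
  have "conj_KFP s b (emono s b k1 k2 k3 k4) = (\<lambda>X.
     alpha (s\<^sup>2) b k1 k2 k3 k4 * emono s b k1 k2 k3 k4 X
     + of_nat k1 * emono s b (k1 - 1) (Suc k2) k3 k4 X
     + of_nat k3 * emono s b k1 k2 (k3 - 1) (Suc k4) X
     + (- (2 * (of_real s)\<^sup>2 * (of_nat k2 * of_nat k4))) * emono s b k1 (k2 - 1) k3 (k4 - 1) X)"
    by (simp add: fun_eq_iff conj_KFP_emono)
  then show ?thesis
    by (simp only:) (intro exp_growth_add exp_growth_mult exp_growth_const exp_growth_emono)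
qed

lemma test_function_cutoff_mult:
  assumes "\<epsilon> > 0" "smooth u" shows "(\<lambda>X. cutoff \<epsilon> X * u X) \<in> test_functions"
proof (rule test_functionI)
  show "smooth (\<lambda>X. cutoff \<epsilon> X * u X)" by (intro smooth_mult smooth_cutoff assms)
  have "norm X \<le> sqrt (1 / \<epsilon>)" if "cutoff \<epsilon> X * u X \<noteq> 0" for X
  proof -
    have "1 - \<epsilon> * (X \<bullet> X) > 0" using that by (auto simp: cutoff_def flat_poly_def split: if_splits)
    then have "(norm X)\<^sup>2 \<le> 1 / \<epsilon>" using assms(1) by (simp add: field_simps dot_square_norm)
    then show ?thesis by (rule real_le_rsqrt)
  qed
  then show "bounded {X. cutoff \<epsilon> X * u X \<noteq> 0}" unfolding bounded_iff by blast
qed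

text \<open>Polynomials times the Gaussian are not test functions. They are multiplied by the cutoff, and the
commutator terms, which contain derivatives of the cutoff, disappear in the limit.\<close>

lemma weak_eigenfunction_gauss:
  assumes w: "w \<in> L2" 
    and eig: "\<And>\<phi>. \<phi> \<in> test_functions \<Longrightarrow> dist_of w (KFP_fun s b \<phi>) = \<mu> * dist_of w \<phi>"
    and p: "smooth p" "exp_growth p" "\<And>e. exp_growth (dir_deriv e p)" "exp_growth (conj_KFP s b p)"
  shows "(\<integral>X. w X * (conj_KFP s b p X * gauss X) \<partial>lborel) = \<mu> * (\<integral>X. w X * (p X * gauss X) \<partial>lborel)"
proof -
  define \<epsilon> where "\<epsilon> = (\<lambda>n. inverse (real (Suc n)))"
  have eps0: "\<epsilon> \<longlonglongrightarrow> 0" unfolding \<epsilon>_def by (rule LIMSEQ_inverse_real_of_nat)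
  have epos: "\<epsilon> n > 0" "\<epsilon> n \<le> 1" for n by (auto simp: \<epsilon>_def field_simps)
  define u where "u = (\<lambda>X. p X * gauss X)"
  have su: "smooth u" unfolding u_def by (intro smooth_mult smooth_gauss p)
  have Ku: "KFP_fun s b u = (\<lambda>X. conj_KFP s b p X * gauss X)" unfolding u_def by (rule KFP_fun_mult_gauss[OF p(1)])
  \<comment> \<open>The velocity derivative of \<open>u\<close> is \<open>q j\<close> times the Gaussian.\<close>
  define q where "q = (\<lambda>j X. dir_deriv (vdir j) p X + (- 1) * (of_real (vc j X) * p X))"
  have du: "dir_deriv (vdir j) u = (\<lambda>X. q j X * gauss X)" for j
    unfolding u_def q_def
    by (simp add: dir_deriv_mult smooth_gauss dir_deriv_gauss p(1) inner_vdir fun_eq_iff algebra_simps)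
  have q: "exp_growth (q j)" for j
    unfolding q_def by (intro exp_growth_add exp_growth_mult exp_growth_const exp_growth_vc p)
  have "\<forall>n. \<exists>B. \<forall>t\<le>1. \<bar>bump n t\<bar> \<le> B" using flat_poly_bounded by blast
  from choice[OF this] obtain B where B: "\<And>n t. t \<le> 1 \<Longrightarrow> \<bar>bump n t\<bar> \<le> B n" by blast
  define arg where "arg = (\<lambda>n (X::phase). 1 + (- \<epsilon> n) * (X \<bullet> X))"
  have arg: "arg n X \<le> 1" for n X using epos[of n] by (simp add: arg_def)
  have bump_lim: "(\<lambda>n. bump m (arg n X)) \<longlonglongrightarrow> bump m 1" for m X
  proof -
    have "(\<lambda>n. arg n X) \<longlonglongrightarrow> 1 + (- 0) * (X \<bullet> X)"
      unfolding arg_def by (intro tendsto_intros eps0)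
    then show ?thesis
      using isCont_tendsto_compose[OF DERIV_isCont[OF bump_has_derivative]] by fastforce
  qed
  \<comment> \<open>Cutoff, first and second velocity derivative; they tend to 1, 0 and 0.\<close>
  define c0 where "c0 = (\<lambda>n. cutoff (\<epsilon> n))"
  define c1 where "c1 = (\<lambda>j n. dir_deriv (vdir j) (cutoff (\<epsilon> n)))"
  define c2 where "c2 = (\<lambda>j n. dir_deriv (vdir j) (dir_deriv (vdir j) (cutoff (\<epsilon> n))))"
  have c0: "c0 n X = of_real (bump 0 (arg n X))" for n X
    by (simp add: c0_def cutoff_def arg_def)
  have c1: "c1 j n X = of_real (bump 1 (arg n X) * (- 2 * \<epsilon> n * vc j X))" for j n X
    unfolding c1_def dir_deriv_cutoff arg_def inner_vdir by simp
  have c2: "c2 j n X = of_real (bump 2 (arg n X) * (- 2 * \<epsilon> n * vc j X)\<^sup>2 - bump 1 (arg n X) * (2 * \<epsilon> n))" for j n X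
    unfolding c2_def dir_deriv_dir_deriv_cutoff arg_def inner_vdir by (simp add: inner_vdir) (simp add: vc_def)
  have meas: "c0 n \<in> borel_measurable borel" "c1 j n \<in> borel_measurable borel" "c2 j n \<in> borel_measurable borel" for j n
    unfolding c0_def c1_def c2_def by (intro smooth_measurable smooth_dir_deriv smooth_cutoff)+
  have lim0: "(\<lambda>n. \<integral>X. w X * (c0 n X * F X * gauss X) \<partial>lborel) \<longlonglongrightarrow> (\<integral>X. w X * (1 * F X * gauss X) \<partial>lborel)"
    if F: "exp_growth F" for F
  proof (rule gauss_dominated_convergence[OF w F exp_growth_const meas(1)])
    show "cmod (c0 n X) \<le> cmod (of_real (B 0))" for n X
      using B[OF arg, of 0 n X] unfolding c0 norm_of_real by simp
    show "(\<lambda>n. c0 n X) \<longlonglongrightarrow> 1" for X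
      using tendsto_of_real[OF bump_lim[of 0 X]] unfolding c0 bump_0_1 by simp
  qed
  have B0: "0 \<le> B n" for n using B[of 1 n] by linarith
  have lim1: "(\<lambda>n. \<integral>X. w X * (c1 j n X * F X * gauss X) \<partial>lborel) \<longlonglongrightarrow> (\<integral>X. w X * (0 * F X * gauss X) \<partial>lborel)"
    if F: "exp_growth F" for F j
  proof (rule gauss_dominated_convergence[OF w F _ meas(2)])
    show "exp_growth (\<lambda>X. of_real (2 * B 1) * of_real (vc j X))"
      by (intro exp_growth_mult exp_growth_const exp_growth_vc)
    show "cmod (c1 j n X) \<le> cmod (of_real (2 * B 1) * of_real (vc j X))" for n X
    proof -
      have "\<bar>bump 1 (arg n X)\<bar> * (2 * \<epsilon> n * \<bar>vc j X\<bar>) \<le> B 1 * (2 * 1 * \<bar>vc j X\<bar>)"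
        using B[OF arg, of 1 n X] epos[of n] B0[of 1] by (intro mult_mono) auto
      then show ?thesis using epos[of n] B0[of 1] unfolding c1 norm_mult norm_of_real by (simp add: abs_mult)
    qed
    show "(\<lambda>n. c1 j n X) \<longlonglongrightarrow> 0" for X
    proof -
      have "(\<lambda>n. bump 1 (arg n X) * (- 2 * \<epsilon> n * vc j X)) \<longlonglongrightarrow> bump 1 1 * (- 2 * 0 * vc j X)"
        by (intro tendsto_mult tendsto_const bump_lim eps0)
      from tendsto_of_real[OF this] show ?thesis unfolding c1 by simp
    qed
  qed
  have lim2: "(\<lambda>n. \<integral>X. w X * (c2 j n X * F X * gauss X) \<partial>lborel) \<longlonglongrightarrow> (\<integral>X. w X * (0 * F X * gauss X) \<partial>lborel)"
    if F: "exp_growth F" for F j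
  proof (rule gauss_dominated_convergence[OF w F _ meas(3)])
    show "exp_growth (\<lambda>X. of_real (4 * B 2) * (of_real (vc j X))\<^sup>2 + of_real (2 * B 1))"
      by (intro exp_growth_add exp_growth_mult exp_growth_const exp_growth_vc exp_growth_power)
    show "cmod (c2 j n X) \<le> cmod (of_real (4 * B 2) * (of_real (vc j X))\<^sup>2 + of_real (2 * B 1))" for n X
    proof -
      have e2: "(\<epsilon> n)\<^sup>2 \<le> 1" using epos[of n] by (simp add: power_le_one)
      have "\<bar>bump 2 (arg n X)\<bar> * (4 * (\<epsilon> n)\<^sup>2 * (vc j X)\<^sup>2) \<le> B 2 * (4 * 1 * (vc j X)\<^sup>2)"
        using B[OF arg, of 2 n X] e2 B0[of 2] by (intro mult_mono mult_right_mono) auto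
      moreover have "\<bar>bump 1 (arg n X)\<bar> * (2 * \<epsilon> n) \<le> B 1 * (2 * 1)"
        using B[OF arg, of 1 n X] epos[of n] B0[of 1] by (intro mult_mono) auto
      moreover have "\<bar>bump 2 (arg n X) * (- 2 * \<epsilon> n * vc j X)\<^sup>2 - bump 1 (arg n X) * (2 * \<epsilon> n)\<bar>
         \<le> \<bar>bump 2 (arg n X)\<bar> * (4 * (\<epsilon> n)\<^sup>2 * (vc j X)\<^sup>2) + \<bar>bump 1 (arg n X)\<bar> * (2 * \<epsilon> n)"
        using epos[of n] by (rule_tac order.trans[OF abs_triangle_ineq4]) (simp add: abs_mult power_mult_distrib)
      ultimately have "cmod (c2 j n X) \<le> 4 * B 2 * (vc j X)\<^sup>2 + 2 * B 1"
        unfolding c2 norm_of_real by linarith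
      also have "\<dots> \<le> \<bar>4 * B 2 * (vc j X)\<^sup>2 + 2 * B 1\<bar>" by simp
      also have "\<dots> = cmod (of_real (4 * B 2 * (vc j X)\<^sup>2 + 2 * B 1))" by (simp only: norm_of_real)
      finally show ?thesis by simp
    qed
    show "(\<lambda>n. c2 j n X) \<longlonglongrightarrow> 0" for X
    proof -
      have "(\<lambda>n. bump 2 (arg n X) * (- 2 * \<epsilon> n * vc j X)\<^sup>2 - bump 1 (arg n X) * (2 * \<epsilon> n))
         \<longlonglongrightarrow> bump 2 1 * (- 2 * 0 * vc j X)\<^sup>2 - bump 1 1 * (2 * 0)"
        by (intro tendsto_mult tendsto_const tendsto_diff tendsto_power bump_lim eps0)
      from tendsto_of_real[OF this] show ?thesis unfolding c2 by simp
    qed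
  qed
  define W where "W = (\<lambda>F. \<integral>X. w X * (F X * gauss X) \<partial>lborel)"
  have main: "W (\<lambda>X. c0 n X * conj_KFP s b p X) - ((W (\<lambda>X. c1 1 n X * q 1 X) + W (\<lambda>X. c2 1 n X * p X) / 2)
      + (W (\<lambda>X. c1 2 n X * q 2 X) + W (\<lambda>X. c2 2 n X * p X) / 2)) = \<mu> * W (\<lambda>X. c0 n X * p X)" for n
  proof -
    have t: "(\<lambda>X. c0 n X * h X) \<in> test_functions" if "smooth h" for h
      unfolding c0_def by (rule test_function_cutoff_mult[OF epos(1) that])
    have t1: "(\<lambda>X. c1 j n X * h X) \<in> test_functions" "(\<lambda>X. c2 j n X * h X) \<in> test_functions" if h: "smooth h" for j h
    proof -
      have "bounded {X. cutoff (\<epsilon> n) X \<noteq> 0}"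
        using test_function_cutoff_mult[OF epos(1) smooth_const[of 1], of n] by (simp add: test_functions_def compact_closure)
      then have "cutoff (\<epsilon> n) \<in> test_functions" by (rule test_functionI[OF smooth_cutoff])
      then have "c1 j n \<in> test_functions" "c2 j n \<in> test_functions"
        by (simp_all add: c1_def c2_def test_function_dir_deriv)
      from this[THEN test_function_mult[OF h]]
      show "(\<lambda>X. c1 j n X * h X) \<in> test_functions" "(\<lambda>X. c2 j n X * h X) \<in> test_functions"
        by (simp_all add: mult.commute)
    qed
    have "dist_of w (KFP_fun s b (\<lambda>X. c0 n X * u X)) = \<mu> * dist_of w (\<lambda>X. c0 n X * u X)"
      by (rule eig[OF t[OF su]])
    also have "KFP_fun s b (\<lambda>X. c0 n X * u X) = (\<lambda>X. c0 n X * KFP_fun s b u X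
       - ((c1 1 n X * dir_deriv (vdir 1) u X + 1/2 * (c2 1 n X * u X)) + (c1 2 n X * dir_deriv (vdir 2) u X + 1/2 * (c2 2 n X * u X))))"
      unfolding c0_def c1_def c2_def KFP_fun_cutoff[OF su] sum_2 by simp
    also have "dist_of w \<dots> = dist_of w (\<lambda>X. c0 n X * KFP_fun s b u X)
       - ((dist_of w (\<lambda>X. c1 1 n X * dir_deriv (vdir 1) u X) + 1/2 * dist_of w (\<lambda>X. c2 1 n X * u X))
        + (dist_of w (\<lambda>X. c1 2 n X * dir_deriv (vdir 2) u X) + 1/2 * dist_of w (\<lambda>X. c2 2 n X * u X)))"
      by (simp only: dist_of_right dist_of_right_cmult w t t1 su smooth_KFP_fun smooth_dir_deriv test_function_add test_function_cmult)
    finally show ?thesis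
      unfolding Ku du unfolding u_def W_def dist_of_def by (simp add: mult.assoc)
  qed
  have "(\<lambda>n. W (\<lambda>X. c0 n X * conj_KFP s b p X) - ((W (\<lambda>X. c1 1 n X * q 1 X) + W (\<lambda>X. c2 1 n X * p X) / 2)
      + (W (\<lambda>X. c1 2 n X * q 2 X) + W (\<lambda>X. c2 2 n X * p X) / 2))) \<longlonglongrightarrow>
      W (\<lambda>X. 1 * conj_KFP s b p X) - ((W (\<lambda>X. 0 * q 1 X) + W (\<lambda>X. 0 * p X) / 2) + (W (\<lambda>X. 0 * q 2 X) + W (\<lambda>X. 0 * p X) / 2))"
    unfolding W_def by (intro tendsto_diff tendsto_add tendsto_divide tendsto_const lim0 lim1 lim2 q p) simp_all
  moreover have "(\<lambda>n. \<mu> * W (\<lambda>X. c0 n X * p X)) \<longlonglongrightarrow> \<mu> * W (\<lambda>X. 1 * p X)"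
    unfolding W_def by (intro tendsto_mult tendsto_const lim0 p)
  ultimately have "W (\<lambda>X. 1 * conj_KFP s b p X) - ((W (\<lambda>X. 0 * q 1 X) + W (\<lambda>X. 0 * p X) / 2) + (W (\<lambda>X. 0 * q 2 X) + W (\<lambda>X. 0 * p X) / 2))
      = \<mu> * W (\<lambda>X. 1 * p X)"
    unfolding main by (rule LIMSEQ_unique)
  then show ?thesis by (simp add: W_def)
qed

text \<open>The moments of \<open>w\<close> against the monomials satisfy the triangular recursion of the operator. As \<open>\<mu>\<close>
differs from every diagonal entry, all moments vanish by induction on the weight.\<close>

lemma weak_eigenfunction_zero:
  assumes w: "w \<in> L2" and s: "s \<noteq> 0"
    and eig: "\<And>\<phi>. \<phi> \<in> test_functions \<Longrightarrow> dist_of w (KFP_fun s b \<phi>) = \<mu> * dist_of w \<phi>"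
    and \<mu>: "\<And>k1 k2 k3 k4. \<mu> \<noteq> alpha (s\<^sup>2) b k1 k2 k3 k4"
  shows "AE X in lborel. w X = 0"
proof (rule hermite_complete[OF w s])
  define m where "m = (\<lambda>k1 k2 k3 k4. \<integral>X. w X * (emono s b k1 k2 k3 k4 X * gauss X) \<partial>lborel)"
  have int: "integrable lborel (\<lambda>X. w X * (emono s b k1 k2 k3 k4 X * gauss X))" for k1 k2 k3 k4
    by (rule L2_gauss_integrable[OF w exp_growth_emono])
  have rec: "alpha (s\<^sup>2) b k1 k2 k3 k4 * m k1 k2 k3 k4 + of_nat k1 * m (k1 - 1) (Suc k2) k3 k4
     + of_nat k3 * m k1 k2 (k3 - 1) (Suc k4) - 2 * (of_real s)\<^sup>2 * (of_nat k2 * of_nat k4) * m k1 (k2 - 1) k3 (k4 - 1)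
     = \<mu> * m k1 k2 k3 k4" for k1 k2 k3 k4
  proof -
    have "(\<integral>X. w X * (conj_KFP s b (emono s b k1 k2 k3 k4) X * gauss X) \<partial>lborel) = \<mu> * m k1 k2 k3 k4"
      unfolding m_def
      by (rule weak_eigenfunction_gauss[OF w eig smooth_emono exp_growth_emono exp_growth_dir_deriv_emono exp_growth_conj_KFP_emono])
    also have "(\<lambda>X. w X * (conj_KFP s b (emono s b k1 k2 k3 k4) X * gauss X)) = (\<lambda>X.
        alpha (s\<^sup>2) b k1 k2 k3 k4 * (w X * (emono s b k1 k2 k3 k4 X * gauss X))
        + of_nat k1 * (w X * (emono s b (k1 - 1) (Suc k2) k3 k4 X * gauss X))
        + of_nat k3 * (w X * (emono s b k1 k2 (k3 - 1) (Suc k4) X * gauss X))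
        - 2 * (of_real s)\<^sup>2 * (of_nat k2 * of_nat k4) * (w X * (emono s b k1 (k2 - 1) k3 (k4 - 1) X * gauss X)))"
      unfolding conj_KFP_emono by (simp add: fun_eq_iff algebra_simps)
    also have "integral\<^sup>L lborel \<dots> = alpha (s\<^sup>2) b k1 k2 k3 k4 * m k1 k2 k3 k4 + of_nat k1 * m (k1 - 1) (Suc k2) k3 k4
       + of_nat k3 * m k1 k2 (k3 - 1) (Suc k4) - 2 * (of_real s)\<^sup>2 * (of_nat k2 * of_nat k4) * m k1 (k2 - 1) k3 (k4 - 1)"
      unfolding m_def by (simp add: int)
    finally show ?thesis .
  qed
  have "m k1 k2 k3 k4 = 0" if "weight k1 k2 k3 k4 = n" for n k1 k2 k3 k4
    using that
  proof (induction n arbitrary: k1 k2 k3 k4 rule: less_induct)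
    case (less n)
    have z1: "of_nat k1 * m (k1 - 1) (Suc k2) k3 k4 = 0"
      using less.prems less.IH[OF _ refl, of "k1 - 1" "Suc k2" k3 k4] by (cases "k1 = 0") auto
    have z2: "of_nat k3 * m k1 k2 (k3 - 1) (Suc k4) = 0"
      using less.prems less.IH[OF _ refl, of k1 k2 "k3 - 1" "Suc k4"] by (cases "k3 = 0") auto
    have z3: "2 * (of_real s)\<^sup>2 * (of_nat k2 * of_nat k4) * m k1 (k2 - 1) k3 (k4 - 1) = 0"
      using less.prems less.IH[OF _ refl, of k1 "k2 - 1" k3 "k4 - 1"] by (cases "k2 = 0 \<or> k4 = 0") auto
    have "alpha (s\<^sup>2) b k1 k2 k3 k4 * m k1 k2 k3 k4 = \<mu> * m k1 k2 k3 k4"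
      using rec[of k1 k2 k3 k4] unfolding z1 z2 z3 by simp
    then show ?case using \<mu>[of k1 k2 k3 k4] by auto
  qed
  then show "(\<integral>X. w X * (emono s b k1 k2 k3 k4 X * gauss X) \<partial>lborel) = 0" for k1 k2 k3 k4
    unfolding m_def by blast
qed

text \<open>Apply \<open>P - \<mu>\<close> repeatedly to a generalized eigenfunction; the last iterate that is not zero almost
everywhere is an eigenfunction. The equation for it holds almost everywhere only, because the chain
of representatives may pass through functions that vanish almost everywhere without being zero.\<close>

lemma eigenfunction_of_generalized:
  assumes "(u, z) \<in> KFP_shift_graph a b \<mu> ^^ N" "AE X in lborel. z X = 0" "\<not> (AE X in lborel. u X = 0)"
  shows "\<exists>w f. (w, f) \<in> KFP_graph a b \<and> \<not> (AE X in lborel. w X = 0) \<and> (AE X in lborel. f X = \<mu> * w X)"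
  using assms
proof (induction N arbitrary: u)
  case 0
  then show ?case by simp
next
  case (Suc N)
  from Suc.prems(1) obtain y where y: "(u, y) \<in> KFP_shift_graph a b \<mu>" "(y, z) \<in> KFP_shift_graph a b \<mu> ^^ N"
    by (rule relpow_Suc_E2)
  show ?case
  proof (cases "AE X in lborel. y X = 0")
    case True
    from y(1) obtain f where f: "(u, f) \<in> KFP_graph a b" "y = (\<lambda>X. f X - \<mu> * u X)"
      unfolding KFP_shift_graph_def by blast
    have "AE X in lborel. f X = \<mu> * u X" using True unfolding f(2) by simp
    with f(1) Suc.prems(3) show ?thesis by blast
  next
    case False
    from Suc.IH[OF y(2) Suc.prems(2) False] show ?thesis .
  qed
qed

lemma alpha_uminus_b: "alpha a (- b) k1 k2 k3 k4 = alpha a b k3 k4 k1 k2"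
  by (simp add: alpha_def lam_uminus_b)

text \<open>The equation is tested against \<open>\<phi>\<close> and the operator is transposed, which replaces \<open>b\<close> by \<open>- b\<close> and
\<open>sqrt a\<close> by \<open>- sqrt a\<close>. The numbers \<open>alpha\<close> form the same set for both choices of signs.\<close>

lemma generalized_eigenvalue_imp_alpha:
  assumes a: "a > 0" and g: "generalized_eigenvalue a b \<mu>"
  shows "\<exists>k1 k2 k3 k4. \<mu> = alpha a b k1 k2 k3 k4"
proof (rule ccontr)
  assume neg: "\<not> ?thesis"
  from g obtain N u where "(u, \<lambda>p. 0) \<in> KFP_shift_graph a b \<mu> ^^ N" "\<not> (AE X in lborel. u X = 0)"
    unfolding generalized_eigenvalue_def by blast
  from eigenfunction_of_generalized[OF this(1) _ this(2)] obtain w f where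
    w: "(w, f) \<in> KFP_graph a b" "\<not> (AE X in lborel. w X = 0)" "AE X in lborel. f X = \<mu> * w X"
    by auto
  have wL: "w \<in> L2" and fL: "f \<in> L2" using w(1) by (auto simp: KFP_graph_def)
  have "AE X in lborel. w X = 0"
  proof (rule weak_eigenfunction_zero[OF wL, of "- sqrt a" "- b" \<mu>])
    show "- sqrt a \<noteq> 0" using a by simp
    show "\<mu> \<noteq> alpha ((- sqrt a)\<^sup>2) (- b) k1 k2 k3 k4" for k1 k2 k3 k4
      using neg a by (auto simp: alpha_uminus_b)
    fix \<phi> assume \<phi>: "\<phi> \<in> test_functions"
    have [measurable]: "w \<in> borel_measurable borel" "f \<in> borel_measurable borel" "\<phi> \<in> borel_measurable borel"
      using L2_measurable wL fL smooth_measurable[OF test_function_smooth[OF \<phi>]] by auto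
    have "dist_of w (KFP_fun (- sqrt a) (- b) \<phi>) = dist_of f \<phi>"
      using w(1) \<phi> KFP_transpose[OF wL \<phi>, of a b] by (simp add: KFP_graph_def)
    also have "\<dots> = (\<integral>X. \<mu> * (w X * \<phi> X) \<partial>lborel)"
      unfolding dist_of_def by (rule integral_cong_AE) (use w(3) in \<open>auto simp: mult.assoc\<close>)
    also have "\<dots> = \<mu> * dist_of w \<phi>" by (simp add: dist_of_def)
    finally show "dist_of w (KFP_fun (- sqrt a) (- b) \<phi>) = \<mu> * dist_of w \<phi>" .
  qed
  with w(2) show False by simp
qed

lemma generalized_eigenvalues_KFP:
  assumes "a > 0"
  shows "{\<mu>. generalized_eigenvalue a b \<mu>} =
     {lam1 a b * of_nat k1 + lam2 a b * of_nat k2 + lam3 a b * of_nat k3 + lam4 a b * of_nat k4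
             | k1 k2 k3 k4 :: nat. True}"
  using alpha_generalized_eigenvalue[OF assms, of b] generalized_eigenvalue_imp_alpha[OF assms, of b]
  unfolding alpha_def by blast

theorem theorem1p1:
  shows
    "(\<forall>a b :: real. a > 0 \<longrightarrow>
        spectrum (KFP_matrix a b) = {lam1 a b, lam2 a b, lam3 a b, lam4 a b} \<and>
        {\<mu>. generalized_eigenvalue a b \<mu>} =
          {lam1 a b * of_nat k1 + lam2 a b * of_nat k2 + lam3 a b * of_nat k3 + lam4 a b * of_nat k4
             | k1 k2 k3 k4 :: nat. True})
   \<and> (\<exists>C>0. \<exists>\<epsilon>>0. \<forall>a b :: real. a > 0 \<and> b > 0 \<and> japanese a / b^2 < \<epsilon> \<longrightarrow>
        (\<exists>r s :: real. \<bar>r\<bar> \<le> C * (japanese a)^2 / b^4 \<and> \<bar>s\<bar> \<le> C * (japanese a)^2 / b^3 \<and>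
           lam1 a b = complex_of_real (a / b^2 + r) - \<i> * complex_of_real (- (a / b) + s)) \<and>
        (\<exists>r s :: real. \<bar>r\<bar> \<le> C * (japanese a)^2 / b^4 \<and> \<bar>s\<bar> \<le> C * (japanese a)^2 / b^3 \<and>
           lam2 a b = complex_of_real (1 - a / b^2 + r) - \<i> * complex_of_real (b + a / b + s)) \<and>
        (\<exists>r s :: real. \<bar>r\<bar> \<le> C * (japanese a)^2 / b^4 \<and> \<bar>s\<bar> \<le> C * (japanese a)^2 / b^3 \<and>
           lam3 a b = complex_of_real (a / b^2 + r) + \<i> * complex_of_real (- (a / b) + s)) \<and>
        (\<exists>r s :: real. \<bar>r\<bar> \<le> C * (japanese a)^2 / b^4 \<and> \<bar>s\<bar> \<le> C * (japanese a)^2 / b^3 \<and>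
           lam4 a b = complex_of_real (1 - a / b^2 + r) + \<i> * complex_of_real (b + a / b + s)))
   \<and> (\<forall>a b :: real. a > 0 \<and> b \<noteq> 0 \<longrightarrow> (\<forall>\<mu>\<in>spectrum (KFP_matrix a b). Im \<mu> \<noteq> 0))
   \<and> (\<forall>a b :: real. a > 0 \<longrightarrow> spectrum (KFP_matrix a b) = spectrum (KFP_matrix a (- b)))"
proof (intro conjI)
  show "\<forall>a b :: real. a > 0 \<longrightarrow>
        spectrum (KFP_matrix a b) = {lam1 a b, lam2 a b, lam3 a b, lam4 a b} \<and>
        {\<mu>. generalized_eigenvalue a b \<mu>} =
          {lam1 a b * of_nat k1 + lam2 a b * of_nat k2 + lam3 a b * of_nat k3 + lam4 a b * of_nat k4
             | k1 k2 k3 k4 :: nat. True}"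
    by (intro allI impI conjI spectrum_KFP_matrix generalized_eigenvalues_KFP)
next
  show "\<forall>a b :: real. a > 0 \<and> b \<noteq> 0 \<longrightarrow> (\<forall>\<mu>\<in>spectrum (KFP_matrix a b). Im \<mu> \<noteq> 0)"
    using spectrum_KFP_matrix Im_lam_nonzero by metis
next
  show "\<forall>a b :: real. a > 0 \<longrightarrow> spectrum (KFP_matrix a b) = spectrum (KFP_matrix a (- b))"
    by (simp add: spectrum_KFP_matrix lam_uminus_b insert_commute)
next
  show "\<exists>C>0. \<exists>\<epsilon>>0. \<forall>a b :: real. a > 0 \<and> b > 0 \<and> japanese a / b^2 < \<epsilon> \<longrightarrow>
        (\<exists>r s :: real. \<bar>r\<bar> \<le> C * (japanese a)^2 / b^4 \<and> \<bar>s\<bar> \<le> C * (japanese a)^2 / b^3 \<and>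
           lam1 a b = complex_of_real (a / b^2 + r) - \<i> * complex_of_real (- (a / b) + s)) \<and>
        (\<exists>r s :: real. \<bar>r\<bar> \<le> C * (japanese a)^2 / b^4 \<and> \<bar>s\<bar> \<le> C * (japanese a)^2 / b^3 \<and>
           lam2 a b = complex_of_real (1 - a / b^2 + r) - \<i> * complex_of_real (b + a / b + s)) \<and>
        (\<exists>r s :: real. \<bar>r\<bar> \<le> C * (japanese a)^2 / b^4 \<and> \<bar>s\<bar> \<le> C * (japanese a)^2 / b^3 \<and>
           lam3 a b = complex_of_real (a / b^2 + r) + \<i> * complex_of_real (- (a / b) + s)) \<and>
        (\<exists>r s :: real. \<bar>r\<bar> \<le> C * (japanese a)^2 / b^4 \<and> \<bar>s\<bar> \<le> C * (japanese a)^2 / b^3 \<and>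
           lam4 a b = complex_of_real (1 - a / b^2 + r) + \<i> * complex_of_real (b + a / b + s))"
    by (rule exI[of _ 14], rule conjI, simp, rule exI[of _ 1], rule conjI, simp)
       (intro allI impI conjI lam_asymptotics; elim conjE; assumption)
qed

end
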